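(* Let $n\ge 0$ and $0\le k\le n$ be integers, and consider a pseudo $n$-fold category. Let $c$ be a regular gluing diagram for $k$-morphisms, that is to say, a diagram made by cutting a $k$-dimensional cube (with $k$ chosen directions out of $1,\dots,n$ as its axes) by hyperplanes into $p=p_1\cdots p_k$ rectangular blocks of equal size. Let $(k\mathbf{Mor})^p_c$ denote the subcategory of $(k\mathbf{Mor})^p$ of $p$-tuples of $k$-morphisms composable in the diagram $c$. Then any two functors $(k\mathbf{Mor})^p_c\to k\mathbf{Mor}$ built from morphism composition are related by a unique natural isomorphism built from associators $\alpha$ and interchangers $\beta$.
   Context: **Pseudo $n$-fold categories.** Directions are labeled $1,\dots,n$; a combination $I$ is a set of directions. A pseudo $n$-fold category consists of the following data. (a) For each combination $I$, a category $\mathbf{Mor}_I$; put $k\mathbf{Mor}=\coprod_{|I|=k}\mathbf{Mor}_I$ for $0\le k\le n$. Objects of $k\mathbf{Mor}$ are called $k$-morphisms. (b) For each $I$ and $i\in I$, functors $s_i,t_i:\mathbf{Mor}_I\to\mathbf{Mor}_{I\setminus\{i\}}$ (source, target), $\mathrm{id}_i:\mathbf{Mor}_{I\setminus\{i\}}\to\mathbf{Mor}_I$ (identities), and $\circ_i:\mathbf{Mor}_I\times_{\mathbf{Mor}_{I\setminus\{i\}}}\mathbf{Mor}_I\to\mathbf{Mor}_I$ (composition), where the strict pullback consists of pairs $(x,y)$ with $t_i(x)=s_i(y)$, both on objects and on morphisms, and $x\circ_i y$ denotes the value. (c) Natural isomorphisms, for all $I$: associators $\alpha_i:(x\circ_i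 y)\circ_i z\to x\circ_i(y\circ_i z)$ for $i\in I$, and interchangers $\beta_{ij}:(x\circ_i y)\circ_j(x'\circ_i y')\to(x\circ_j x')\circ_i(y\circ_j y')$ for distinct $i,j\in I$, on composable triples and on composable $2\times2$ quadruples, respectively. It is understood that these are compatible with sources and targets: $s_l,t_l$ of a component of $\alpha_i$ (resp. $\beta_{ij}$) is the corresponding component of $\alpha_i$ (resp. $\beta_{ij}$) on the sources, targets if $l\ne i$ (resp. $l\neq i,j$) and an identity if $l=i$ (resp. $l\in\{i,j\}$). The axioms are the following. (1) $\beta_{ji}=\beta_{ij}^{-1}$. (2) Pentagon: for each $i$, the two composites from $((x\circ_i y)\circ_i z)\circ_i u$ to $x\circ_i(y\circ_i(z\circ_i u))$, namely $\alpha\cdot\alpha$ (through $(x\circ_i y)\circ_i(z\circ_i u)$) and $(\mathrm{id}\circ_i\alpha)\cdot\alpha\cdot(\alpha\circ_i\mathrm{id})$, are equal. (3) First hexagon: for $i\ne j$, the two composites from $((x\circ_i y)\circ_i z)\circ_j((x'\circ_i y')\circ_i z')$ to $(x\circ_j x')\circ_i((y\circ_j y')\circ_i(z\circ_j z'))$, namely $\alpha_i\cdot(\beta_{ij}\circ_i\mathrm{id})\cdot\beta_{ij}$ and $(\mathrm{id}\circ_i\beta_{ij})\cdot\beta_{ij}\cdot(\alpha_i\circ_j\alpha_i)$, are equal. (4) Second hexagon: for distinct $i,j,k$, the two composites from $((x\circ_i y)\circ_j(x'\circ_i y'))\circ_k((x''\circ_i y'')\circ_j(x'''\circ_i y'''))$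 to $((x\circ_k x'')\circ_j(x'\circ_k x'''))\circ_i((y\circ_k y'')\circ_j(y'\circ_k y'''))$, namely $(\beta_{jk}\circ_i\beta_{jk})\cdot\beta_{ik}\cdot(\beta_{ij}\circ_k\beta_{ij})$ and $\beta_{ij}\cdot(\beta_{ik}\circ_j\beta_{ik})\cdot\beta_{jk}$, are equal. (5) Strict identities, on objects and morphisms, for $i\ne j$: $\mathrm{id}_is_i(x)\circ_i x=x=x\circ_i\mathrm{id}_it_i(x)$; $\mathrm{id}_i(x\circ_j y)=\mathrm{id}_i(x)\circ_j\mathrm{id}_i(y)$; $\mathrm{id}_i\mathrm{id}_j=\mathrm{id}_j\mathrm{id}_i$; $s_i\mathrm{id}_i(x)=t_i\mathrm{id}_i(x)=x$; $s_i\mathrm{id}_j(x)=\mathrm{id}_js_i(x)$, $t_i\mathrm{id}_j(x)=\mathrm{id}_jt_i(x)$; $s_i(x\circ_i y)=s_i(x)$, $t_i(x\circ_i y)=t_i(y)$; $s_i(x\circ_j y)=s_i(x)\circ_js_i(y)$, $t_i(x\circ_j y)=t_i(x)\circ_jt_i(y)$; $s_is_j=s_js_i$, $t_is_j=s_jt_i$, $t_it_j=t_jt_i$. (6) Unit coherence: $\alpha_i$ is the identity on every composable triple of the form $(\mathrm{id}_is_i(x),x,y)$, $(x,\mathrm{id}_it_i(x),y)$ or $(x,y,\mathrm{id}_it_i(y))$; and $\beta_{ij}$ is the identity $(x\circ_i y)\circ_j(\mathrm{id}_jt_j(x)\circ_i\mathrm{id}_jt_j(y))\to(x\circ_j\mathrm{id}_jt_j(x))\circ_i(y\circ_j\mathrm{id}_jt_j(y))$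 and the identity $(\mathrm{id}_js_j(x)\circ_i\mathrm{id}_js_j(y))\circ_j(x\circ_i y)\to(\mathrm{id}_js_j(x)\circ_jx)\circ_i(\mathrm{id}_js_j(y)\circ_jy)$. **Gluing diagrams.** The blocks of $c$ are placeholders for $k$-morphisms in the $k$ chosen directions. A $p$-tuple (one entry per block) is composable in $c$ if, whenever two blocks are adjacent in direction $i$, the target $t_i$ of the entry in the first block equals the source $s_i$ of the entry in the second block (the same condition applies to tuples of morphisms of the category $k\mathbf{Mor}$). A functor $(k\mathbf{Mor})^p_c\to k\mathbf{Mor}$ is built from morphism composition if it composes all the entries by successively gluing the blocks: for $p=1$ it is the identity; for $p\ge2$ it has the form $F\circ_iF'$, where a hyperplane perpendicular to direction $i$ separates the blocks of $c$ into two nonempty subdiagrams and $F,F'$ are functors built from morphism composition for these subdiagrams. Blocks are not moved around. A natural isomorphism between such functors is built from associators and interchangers if it is a (possibly empty) composite of natural isomorphisms, each obtained by applying one $\alpha_i$, $\beta_{ij}$, or an inverse of these to a sub-composition, combined with identities in the remaining variables. "Unique" means that any two natural isomorphisms so built between the two given functors are equal.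
   Formalization: Functors are taken with their bracketing; F∘_iF' requires the faces to match by the strict laws, not by accident; built isomorphisms may also glue two non-identity ones (such as β∘_kβ), since with identities only, existence fails for the 2×2×2 cube. *)

theory Defs
  imports Main "HOL-Library.FuncSet"
begin

section \<open>Categories, functors, natural isomorphisms\<close>

text \<open>\<open>Cmp C g f\<close> is the composite ``first \<open>f\<close>, then \<open>g\<close>''.\<close>

record ('o, 'a) cat =
  Obj :: "'o set"
  Arr :: "'a set"
  Dom :: "'a \<Rightarrow> 'o"
  Cod :: "'a \<Rightarrow> 'o"
  Idt :: "'o \<Rightarrow> 'a"
  Cmp :: "'a \<Rightarrow> 'a \<Rightarrow> 'a"

record ('o, 'a, 'p, 'b) ftr =
  on_obj :: "'o \<Rightarrow> 'p"
  on_arr :: "'a \<Rightarrow> 'b"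

locale category =
  fixes C :: "('o, 'a) cat"
  assumes dom_obj: "f \<in> Arr C \<Longrightarrow> Dom C f \<in> Obj C"
    and cod_obj: "f \<in> Arr C \<Longrightarrow> Cod C f \<in> Obj C"
    and idt_arr: "x \<in> Obj C \<Longrightarrow> Idt C x \<in> Arr C"
    and dom_idt: "x \<in> Obj C \<Longrightarrow> Dom C (Idt C x) = x"
    and cod_idt: "x \<in> Obj C \<Longrightarrow> Cod C (Idt C x) = x"
    and cmp_arr: "\<lbrakk>f \<in> Arr C; g \<in> Arr C; Cod C f = Dom C g\<rbrakk> \<Longrightarrow> Cmp C g f \<in> Arr C"
    and dom_cmp: "\<lbrakk>f \<in> Arr C; g \<in> Arr C; Cod C f = Dom C g\<rbrakk> \<Longrightarrow> Dom C (Cmp C g f) = Dom C f"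
    and cod_cmp: "\<lbrakk>f \<in> Arr C; g \<in> Arr C; Cod C f = Dom C g\<rbrakk> \<Longrightarrow> Cod C (Cmp C g f) = Cod C g"
    and cmp_idt_right: "f \<in> Arr C \<Longrightarrow> Cmp C f (Idt C (Dom C f)) = f"
    and cmp_idt_left: "f \<in> Arr C \<Longrightarrow> Cmp C (Idt C (Cod C f)) f = f"
    and cmp_assoc: "\<lbrakk>f \<in> Arr C; g \<in> Arr C; h \<in> Arr C; Cod C f = Dom C g; Cod C g = Dom C h\<rbrakk>
      \<Longrightarrow> Cmp C h (Cmp C g f) = Cmp C (Cmp C h g) f"

locale is_functor =
  fixes C :: "('o, 'a) cat" and D :: "('p, 'b) cat" and F :: "('o, 'a, 'p, 'b) ftr"
  assumes source_category: "category C"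
    and target_category: "category D"
    and on_obj: "x \<in> Obj C \<Longrightarrow> on_obj F x \<in> Obj D"
    and on_arr: "f \<in> Arr C \<Longrightarrow> on_arr F f \<in> Arr D"
    and dom_on_arr: "f \<in> Arr C \<Longrightarrow> Dom D (on_arr F f) = on_obj F (Dom C f)"
    and cod_on_arr: "f \<in> Arr C \<Longrightarrow> Cod D (on_arr F f) = on_obj F (Cod C f)"
    and on_arr_idt: "x \<in> Obj C \<Longrightarrow> on_arr F (Idt C x) = Idt D (on_obj F x)"
    and on_arr_cmp: "\<lbrakk>f \<in> Arr C; g \<in> Arr C; Cod C f = Dom C g\<rbrakk>
      \<Longrightarrow> on_arr F (Cmp C g f) = Cmp D (on_arr F g) (on_arr F f)"

definition inverse_arrows :: "('o, 'a) cat \<Rightarrow> 'a \<Rightarrow> 'a \<Rightarrow> bool" where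
  "inverse_arrows C f g \<longleftrightarrow> f \<in> Arr C \<and> g \<in> Arr C \<and> Dom C g = Cod C f \<and> Cod C g = Dom C f \<and>
     Cmp C g f = Idt C (Dom C f) \<and> Cmp C f g = Idt C (Cod C f)"

definition inverse_arr :: "('o, 'a) cat \<Rightarrow> 'a \<Rightarrow> 'a" where
  "inverse_arr C f = (THE g. inverse_arrows C f g)"

locale natural_iso =
  fixes C :: "('o, 'a) cat" and D :: "('p, 'b) cat"
    and F G :: "('o, 'a, 'p, 'b) ftr" and \<eta> :: "'o \<Rightarrow> 'b"
  assumes functor_F: "is_functor C D F"
    and functor_G: "is_functor C D G"
    and component: "x \<in> Obj C \<Longrightarrow> \<eta> x \<in> Arr D"
    and dom_component: "x \<in> Obj C \<Longrightarrow> Dom D (\<eta> x) = on_obj F x"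
    and cod_component: "x \<in> Obj C \<Longrightarrow> Cod D (\<eta> x) = on_obj G x"
    and component_iso: "x \<in> Obj C \<Longrightarrow> \<exists>g. inverse_arrows D (\<eta> x) g"
    and naturality: "f \<in> Arr C \<Longrightarrow>
      Cmp D (\<eta> (Cod C f)) (on_arr F f) = Cmp D (on_arr G f) (\<eta> (Dom C f))"

definition prod_cat :: "('o, 'a) cat \<Rightarrow> ('p, 'b) cat \<Rightarrow> ('o \<times> 'p, 'a \<times> 'b) cat" where
  "prod_cat C D = \<lparr>Obj = Obj C \<times> Obj D, Arr = Arr C \<times> Arr D,
     Dom = (\<lambda>(f, g). (Dom C f, Dom D g)), Cod = (\<lambda>(f, g). (Cod C f, Cod D g)),
     Idt = (\<lambda>(x, y). (Idt C x, Idt D y)),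
     Cmp = (\<lambda>(f', g') (f, g). (Cmp C f' f, Cmp D g' g))\<rparr>"

definition power_cat :: "'b set \<Rightarrow> ('o, 'a) cat \<Rightarrow> ('b \<Rightarrow> 'o, 'b \<Rightarrow> 'a) cat" where
  "power_cat B C = \<lparr>Obj = (\<Pi>\<^sub>E b\<in>B. Obj C), Arr = (\<Pi>\<^sub>E b\<in>B. Arr C),
     Dom = (\<lambda>f. \<lambda>b\<in>B. Dom C (f b)), Cod = (\<lambda>f. \<lambda>b\<in>B. Cod C (f b)),
     Idt = (\<lambda>x. \<lambda>b\<in>B. Idt C (x b)), Cmp = (\<lambda>g f. \<lambda>b\<in>B. Cmp C (g b) (f b))\<rparr>"

definition sub_cat :: "('o, 'a) cat \<Rightarrow> 'o set \<Rightarrow> 'a set \<Rightarrow> ('o, 'a) cat" where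
  "sub_cat C X A = C\<lparr>Obj := Obj C \<inter> X, Arr := Arr C \<inter> A\<rparr>"


section \<open>Pseudo n-fold categories\<close>

text \<open>
  All categories \<open>Mor\<^sub>I\<close> share the two types \<open>'o\<close> and \<open>'a\<close>, but have their own carriers,
  which need be neither equal nor disjoint for different \<open>I\<close>.
  The functors \<open>Src P I i\<close>, \<open>Tgt P I i\<close> go from \<open>Mor\<^sub>I\<close> to the category of \<open>I - {i}\<close>,
  and \<open>Idn P I i\<close> goes back; \<open>Glu P I i\<close> is the composition in direction \<open>i\<close> in \<open>Mor\<^sub>I\<close>.
  \<open>Intch P I i j (x, y, x', y')\<close> is the component of \<open>\<beta>\<^sub>i\<^sub>j\<close> with source
  \<open>(x \<circ>\<^sub>i y) \<circ>\<^sub>j (x' \<circ>\<^sub>i y')\<close>.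
\<close>

record ('o, 'a) nfold =
  Mor :: "nat set \<Rightarrow> ('o, 'a) cat"
  Src :: "nat set \<Rightarrow> nat \<Rightarrow> ('o, 'a, 'o, 'a) ftr"
  Tgt :: "nat set \<Rightarrow> nat \<Rightarrow> ('o, 'a, 'o, 'a) ftr"
  Idn :: "nat set \<Rightarrow> nat \<Rightarrow> ('o, 'a, 'o, 'a) ftr"
  Glu :: "nat set \<Rightarrow> nat \<Rightarrow> ('o \<times> 'o, 'a \<times> 'a, 'o, 'a) ftr"
  Assoc :: "nat set \<Rightarrow> nat \<Rightarrow> 'o \<times> 'o \<times> 'o \<Rightarrow> 'a"
  Intch :: "nat set \<Rightarrow> nat \<Rightarrow> nat \<Rightarrow> 'o \<times> 'o \<times> 'o \<times> 'o \<Rightarrow> 'a"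

abbreviation "so P I i x \<equiv> on_obj (Src P I i) x"
abbreviation "sa P I i f \<equiv> on_arr (Src P I i) f"
abbreviation "to P I i x \<equiv> on_obj (Tgt P I i) x"
abbreviation "ta P I i f \<equiv> on_arr (Tgt P I i) f"
abbreviation "eo P I i x \<equiv> on_obj (Idn P I i) x"
abbreviation "ea P I i f \<equiv> on_arr (Idn P I i) f"
abbreviation "co P I i x y \<equiv> on_obj (Glu P I i) (x, y)"
abbreviation "ca P I i f g \<equiv> on_arr (Glu P I i) (f, g)"

definition pair_set :: "('x \<Rightarrow> 'z) \<Rightarrow> ('x \<Rightarrow> 'z) \<Rightarrow> ('x \<times> 'x) set" where
  "pair_set s t = {(x, y). t x = s y}"

definition triple_set :: "('x \<Rightarrow> 'z) \<Rightarrow> ('x \<Rightarrow> 'z) \<Rightarrow> ('x \<times> 'x \<times> 'x) set" where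
  "triple_set s t = {(x, y, z). t x = s y \<and> t y = s z}"

definition quad_set :: "('x \<Rightarrow> 'z) \<Rightarrow> ('x \<Rightarrow> 'z) \<Rightarrow> ('x \<Rightarrow> 'z) \<Rightarrow> ('x \<Rightarrow> 'z) \<Rightarrow> ('x \<times> 'x \<times> 'x \<times> 'x) set" where
  "quad_set s t s' t' =
     {(x, y, x', y'). t x = s y \<and> t x' = s y' \<and> t' x = s' x' \<and> t' y = s' y'}"

definition pairs :: "('o, 'a) nfold \<Rightarrow> nat set \<Rightarrow> nat \<Rightarrow> ('o \<times> 'o, 'a \<times> 'a) cat" where
  "pairs P I i = sub_cat (prod_cat (Mor P I) (Mor P I))
     (pair_set (so P I i) (to P I i)) (pair_set (sa P I i) (ta P I i))"

definition triples :: "('o, 'a) nfold \<Rightarrow> nat set \<Rightarrow> nat \<Rightarrow> ('o \<times> 'o \<times> 'o, 'a \<times> 'a \<times> 'a) cat" where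
  "triples P I i = sub_cat (prod_cat (Mor P I) (prod_cat (Mor P I) (Mor P I)))
     (triple_set (so P I i) (to P I i)) (triple_set (sa P I i) (ta P I i))"

definition quads :: "('o, 'a) nfold \<Rightarrow> nat set \<Rightarrow> nat \<Rightarrow> nat \<Rightarrow>
    ('o \<times> 'o \<times> 'o \<times> 'o, 'a \<times> 'a \<times> 'a \<times> 'a) cat" where
  "quads P I i j =
     sub_cat (prod_cat (Mor P I) (prod_cat (Mor P I) (prod_cat (Mor P I) (Mor P I))))
     (quad_set (so P I i) (to P I i) (so P I j) (to P I j))
     (quad_set (sa P I i) (ta P I i) (sa P I j) (ta P I j))"

definition assoc_left :: "('o, 'a) nfold \<Rightarrow> nat set \<Rightarrow> nat \<Rightarrow> ('o \<times> 'o \<times> 'o, 'a \<times> 'a \<times> 'a, 'o, 'a) ftr" where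
  "assoc_left P I i = \<lparr>on_obj = (\<lambda>(x, y, z). co P I i (co P I i x y) z),
     on_arr = (\<lambda>(f, g, h). ca P I i (ca P I i f g) h)\<rparr>"

definition assoc_right :: "('o, 'a) nfold \<Rightarrow> nat set \<Rightarrow> nat \<Rightarrow> ('o \<times> 'o \<times> 'o, 'a \<times> 'a \<times> 'a, 'o, 'a) ftr" where
  "assoc_right P I i = \<lparr>on_obj = (\<lambda>(x, y, z). co P I i x (co P I i y z)),
     on_arr = (\<lambda>(f, g, h). ca P I i f (ca P I i g h))\<rparr>"

definition intch_left :: "('o, 'a) nfold \<Rightarrow> nat set \<Rightarrow> nat \<Rightarrow> nat \<Rightarrow>
    ('o \<times> 'o \<times> 'o \<times> 'o, 'a \<times> 'a \<times> 'a \<times> 'a, 'o, 'a) ftr" where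
  "intch_left P I i j =
     \<lparr>on_obj = (\<lambda>(x, y, x', y'). co P I j (co P I i x y) (co P I i x' y')),
      on_arr = (\<lambda>(f, g, f', g'). ca P I j (ca P I i f g) (ca P I i f' g'))\<rparr>"

definition intch_right :: "('o, 'a) nfold \<Rightarrow> nat set \<Rightarrow> nat \<Rightarrow> nat \<Rightarrow>
    ('o \<times> 'o \<times> 'o \<times> 'o, 'a \<times> 'a \<times> 'a \<times> 'a, 'o, 'a) ftr" where
  "intch_right P I i j =
     \<lparr>on_obj = (\<lambda>(x, y, x', y'). co P I i (co P I j x x') (co P I j y y')),
      on_arr = (\<lambda>(f, g, f', g'). ca P I i (ca P I j f f') (ca P I j g g'))\<rparr>"

text \<open>The strict laws, to be instantiated once with objects and once with arrows.\<close>

locale strict_nfold_laws =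
  fixes n :: nat and X :: "nat set \<Rightarrow> 'x set"
    and s t e :: "nat set \<Rightarrow> nat \<Rightarrow> 'x \<Rightarrow> 'x"
    and c :: "nat set \<Rightarrow> nat \<Rightarrow> 'x \<Rightarrow> 'x \<Rightarrow> 'x"
  assumes unit_left: "\<lbrakk>I \<subseteq> {1..n}; i \<in> I; x \<in> X I\<rbrakk> \<Longrightarrow> c I i (e I i (s I i x)) x = x"
    and unit_right: "\<lbrakk>I \<subseteq> {1..n}; i \<in> I; x \<in> X I\<rbrakk> \<Longrightarrow> c I i x (e I i (t I i x)) = x"
    and e_c: "\<lbrakk>I \<subseteq> {1..n}; i \<in> I; j \<in> I; i \<noteq> j; x \<in> X (I - {i}); y \<in> X (I - {i});
        t (I - {i}) j x = s (I - {i}) j y\<rbrakk>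
      \<Longrightarrow> e I i (c (I - {i}) j x y) = c I j (e I i x) (e I i y)"
    and e_e: "\<lbrakk>I \<subseteq> {1..n}; i \<in> I; j \<in> I; i \<noteq> j; x \<in> X (I - {i, j})\<rbrakk>
      \<Longrightarrow> e I i (e (I - {i}) j x) = e I j (e (I - {j}) i x)"
    and s_e: "\<lbrakk>I \<subseteq> {1..n}; i \<in> I; x \<in> X (I - {i})\<rbrakk> \<Longrightarrow> s I i (e I i x) = x"
    and t_e: "\<lbrakk>I \<subseteq> {1..n}; i \<in> I; x \<in> X (I - {i})\<rbrakk> \<Longrightarrow> t I i (e I i x) = x"
    and s_e': "\<lbrakk>I \<subseteq> {1..n}; i \<in> I; j \<in> I; i \<noteq> j; x \<in> X (I - {j})\<rbrakk>
      \<Longrightarrow> s I i (e I j x) = e (I - {i}) j (s (I - {j}) i x)"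
    and t_e': "\<lbrakk>I \<subseteq> {1..n}; i \<in> I; j \<in> I; i \<noteq> j; x \<in> X (I - {j})\<rbrakk>
      \<Longrightarrow> t I i (e I j x) = e (I - {i}) j (t (I - {j}) i x)"
    and s_c: "\<lbrakk>I \<subseteq> {1..n}; i \<in> I; x \<in> X I; y \<in> X I; t I i x = s I i y\<rbrakk>
      \<Longrightarrow> s I i (c I i x y) = s I i x"
    and t_c: "\<lbrakk>I \<subseteq> {1..n}; i \<in> I; x \<in> X I; y \<in> X I; t I i x = s I i y\<rbrakk>
      \<Longrightarrow> t I i (c I i x y) = t I i y"
    and s_c': "\<lbrakk>I \<subseteq> {1..n}; i \<in> I; j \<in> I; i \<noteq> j; x \<in> X I; y \<in> X I; t I j x = s I j y\<rbrakk>
      \<Longrightarrow> s I i (c I j x y) = c (I - {i}) j (s I i x) (s I i y)"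
    and t_c': "\<lbrakk>I \<subseteq> {1..n}; i \<in> I; j \<in> I; i \<noteq> j; x \<in> X I; y \<in> X I; t I j x = s I j y\<rbrakk>
      \<Longrightarrow> t I i (c I j x y) = c (I - {i}) j (t I i x) (t I i y)"
    and s_s: "\<lbrakk>I \<subseteq> {1..n}; i \<in> I; j \<in> I; i \<noteq> j; x \<in> X I\<rbrakk>
      \<Longrightarrow> s (I - {j}) i (s I j x) = s (I - {i}) j (s I i x)"
    and t_s: "\<lbrakk>I \<subseteq> {1..n}; i \<in> I; j \<in> I; i \<noteq> j; x \<in> X I\<rbrakk>
      \<Longrightarrow> t (I - {j}) i (s I j x) = s (I - {i}) j (t I i x)"
    and t_t: "\<lbrakk>I \<subseteq> {1..n}; i \<in> I; j \<in> I; i \<noteq> j; x \<in> X I\<rbrakk>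
      \<Longrightarrow> t (I - {j}) i (t I j x) = t (I - {i}) j (t I i x)"

locale pseudo_nfold_category =
  fixes n :: nat and P :: "('o, 'a) nfold"
  assumes mor_category: "I \<subseteq> {1..n} \<Longrightarrow> category (Mor P I)"
    and src_functor: "\<lbrakk>I \<subseteq> {1..n}; i \<in> I\<rbrakk> \<Longrightarrow> is_functor (Mor P I) (Mor P (I - {i})) (Src P I i)"
    and tgt_functor: "\<lbrakk>I \<subseteq> {1..n}; i \<in> I\<rbrakk> \<Longrightarrow> is_functor (Mor P I) (Mor P (I - {i})) (Tgt P I i)"
    and idn_functor: "\<lbrakk>I \<subseteq> {1..n}; i \<in> I\<rbrakk> \<Longrightarrow> is_functor (Mor P (I - {i})) (Mor P I) (Idn P I i)"
    and glu_functor: "\<lbrakk>I \<subseteq> {1..n}; i \<in> I\<rbrakk> \<Longrightarrow> is_functor (pairs P I i) (Mor P I) (Glu P I i)"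
    and strict_obj: "strict_nfold_laws n (\<lambda>I. Obj (Mor P I)) (so P) (to P) (eo P) (co P)"
    and strict_arr: "strict_nfold_laws n (\<lambda>I. Arr (Mor P I)) (sa P) (ta P) (ea P) (ca P)"
    and assoc_natural: "\<lbrakk>I \<subseteq> {1..n}; i \<in> I\<rbrakk>
      \<Longrightarrow> natural_iso (triples P I i) (Mor P I) (assoc_left P I i) (assoc_right P I i) (Assoc P I i)"
    and intch_natural: "\<lbrakk>I \<subseteq> {1..n}; i \<in> I; j \<in> I; i \<noteq> j\<rbrakk>
      \<Longrightarrow> natural_iso (quads P I i j) (Mor P I) (intch_left P I i j) (intch_right P I i j) (Intch P I i j)"

    \<comment> \<open>compatibility of \<open>\<alpha>\<close> and \<open>\<beta>\<close> with sources and targets\<close>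
    and src_assoc: "\<lbrakk>I \<subseteq> {1..n}; i \<in> I; l \<in> I; l \<noteq> i; (x, y, z) \<in> Obj (triples P I i)\<rbrakk>
      \<Longrightarrow> sa P I l (Assoc P I i (x, y, z)) = Assoc P (I - {l}) i (so P I l x, so P I l y, so P I l z)"
    and tgt_assoc: "\<lbrakk>I \<subseteq> {1..n}; i \<in> I; l \<in> I; l \<noteq> i; (x, y, z) \<in> Obj (triples P I i)\<rbrakk>
      \<Longrightarrow> ta P I l (Assoc P I i (x, y, z)) = Assoc P (I - {l}) i (to P I l x, to P I l y, to P I l z)"
    and src_assoc_same: "\<lbrakk>I \<subseteq> {1..n}; i \<in> I; (x, y, z) \<in> Obj (triples P I i)\<rbrakk>
      \<Longrightarrow> sa P I i (Assoc P I i (x, y, z)) = Idt (Mor P (I - {i})) (so P I i (co P I i (co P I i x y) z))"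
    and tgt_assoc_same: "\<lbrakk>I \<subseteq> {1..n}; i \<in> I; (x, y, z) \<in> Obj (triples P I i)\<rbrakk>
      \<Longrightarrow> ta P I i (Assoc P I i (x, y, z)) = Idt (Mor P (I - {i})) (to P I i (co P I i (co P I i x y) z))"
    and src_intch: "\<lbrakk>I \<subseteq> {1..n}; i \<in> I; j \<in> I; i \<noteq> j; l \<in> I; l \<noteq> i; l \<noteq> j;
        (x, y, x', y') \<in> Obj (quads P I i j)\<rbrakk>
      \<Longrightarrow> sa P I l (Intch P I i j (x, y, x', y')) =
          Intch P (I - {l}) i j (so P I l x, so P I l y, so P I l x', so P I l y')"
    and tgt_intch: "\<lbrakk>I \<subseteq> {1..n}; i \<in> I; j \<in> I; i \<noteq> j; l \<in> I; l \<noteq> i; l \<noteq> j;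
        (x, y, x', y') \<in> Obj (quads P I i j)\<rbrakk>
      \<Longrightarrow> ta P I l (Intch P I i j (x, y, x', y')) =
          Intch P (I - {l}) i j (to P I l x, to P I l y, to P I l x', to P I l y')"
    and src_intch_same: "\<lbrakk>I \<subseteq> {1..n}; i \<in> I; j \<in> I; i \<noteq> j; l \<in> {i, j};
        (x, y, x', y') \<in> Obj (quads P I i j)\<rbrakk>
      \<Longrightarrow> sa P I l (Intch P I i j (x, y, x', y')) =
          Idt (Mor P (I - {l})) (so P I l (co P I j (co P I i x y) (co P I i x' y')))"
    and tgt_intch_same: "\<lbrakk>I \<subseteq> {1..n}; i \<in> I; j \<in> I; i \<noteq> j; l \<in> {i, j};
        (x, y, x', y') \<in> Obj (quads P I i j)\<rbrakk>
      \<Longrightarrow> ta P I l (Intch P I i j (x, y, x', y')) =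
          Idt (Mor P (I - {l})) (to P I l (co P I j (co P I i x y) (co P I i x' y')))"

    and intch_inverse: "\<lbrakk>I \<subseteq> {1..n}; i \<in> I; j \<in> I; i \<noteq> j; (x, y, x', y') \<in> Obj (quads P I i j)\<rbrakk>
      \<Longrightarrow> inverse_arrows (Mor P I) (Intch P I i j (x, y, x', y')) (Intch P I j i (x, x', y, y'))"

    and pentagon: "\<lbrakk>I \<subseteq> {1..n}; i \<in> I;
        (x, y) \<in> Obj (pairs P I i); (y, z) \<in> Obj (pairs P I i); (z, u) \<in> Obj (pairs P I i)\<rbrakk>
      \<Longrightarrow> Cmp (Mor P I) (Assoc P I i (x, y, co P I i z u)) (Assoc P I i (co P I i x y, z, u)) =
          Cmp (Mor P I) (ca P I i (Idt (Mor P I) x) (Assoc P I i (y, z, u)))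
            (Cmp (Mor P I) (Assoc P I i (x, co P I i y z, u))
              (ca P I i (Assoc P I i (x, y, z)) (Idt (Mor P I) u)))"

    and hexagon1: "\<lbrakk>I \<subseteq> {1..n}; i \<in> I; j \<in> I; i \<noteq> j;
        (x, y) \<in> Obj (pairs P I i); (y, z) \<in> Obj (pairs P I i);
        (x', y') \<in> Obj (pairs P I i); (y', z') \<in> Obj (pairs P I i);
        (x, x') \<in> Obj (pairs P I j); (y, y') \<in> Obj (pairs P I j); (z, z') \<in> Obj (pairs P I j)\<rbrakk>
      \<Longrightarrow> Cmp (Mor P I) (Assoc P I i (co P I j x x', co P I j y y', co P I j z z'))
            (Cmp (Mor P I) (ca P I i (Intch P I i j (x, y, x', y')) (Idt (Mor P I) (co P I j z z')))
              (Intch P I i j (co P I i x y, z, co P I i x' y', z'))) =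
          Cmp (Mor P I) (ca P I i (Idt (Mor P I) (co P I j x x')) (Intch P I i j (y, z, y', z')))
            (Cmp (Mor P I) (Intch P I i j (x, co P I i y z, x', co P I i y' z'))
              (ca P I j (Assoc P I i (x, y, z)) (Assoc P I i (x', y', z'))))"

    and hexagon2: "\<lbrakk>I \<subseteq> {1..n}; i \<in> I; j \<in> I; k \<in> I; i \<noteq> j; i \<noteq> k; j \<noteq> k;
        (x, y) \<in> Obj (pairs P I i); (x', y') \<in> Obj (pairs P I i);
        (x'', y'') \<in> Obj (pairs P I i); (x''', y''') \<in> Obj (pairs P I i);
        (x, x') \<in> Obj (pairs P I j); (y, y') \<in> Obj (pairs P I j);
        (x'', x''') \<in> Obj (pairs P I j); (y'', y''') \<in> Obj (pairs P I j);
        (x, x'') \<in> Obj (pairs P I k); (y, y'') \<in> Obj (pairs P I k);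
        (x', x''') \<in> Obj (pairs P I k); (y', y''') \<in> Obj (pairs P I k)\<rbrakk>
      \<Longrightarrow> Cmp (Mor P I)
            (ca P I i (Intch P I j k (x, x', x'', x''')) (Intch P I j k (y, y', y'', y''')))
            (Cmp (Mor P I)
              (Intch P I i k (co P I j x x', co P I j y y', co P I j x'' x''', co P I j y'' y'''))
              (ca P I k (Intch P I i j (x, y, x', y')) (Intch P I i j (x'', y'', x''', y''')))) =
          Cmp (Mor P I)
            (Intch P I i j (co P I k x x'', co P I k y y'', co P I k x' x''', co P I k y' y'''))
            (Cmp (Mor P I)
              (ca P I j (Intch P I i k (x, y, x'', y'')) (Intch P I i k (x', y', x''', y''')))
              (Intch P I j k (co P I i x y, co P I i x' y', co P I i x'' y'', co P I i x''' y''')))"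

    and assoc_unit1: "\<lbrakk>I \<subseteq> {1..n}; i \<in> I; (x, y) \<in> Obj (pairs P I i)\<rbrakk>
      \<Longrightarrow> Assoc P I i (eo P I i (so P I i x), x, y) = Idt (Mor P I) (co P I i x y)"
    and assoc_unit2: "\<lbrakk>I \<subseteq> {1..n}; i \<in> I; (x, y) \<in> Obj (pairs P I i)\<rbrakk>
      \<Longrightarrow> Assoc P I i (x, eo P I i (to P I i x), y) = Idt (Mor P I) (co P I i x y)"
    and assoc_unit3: "\<lbrakk>I \<subseteq> {1..n}; i \<in> I; (x, y) \<in> Obj (pairs P I i)\<rbrakk>
      \<Longrightarrow> Assoc P I i (x, y, eo P I i (to P I i y)) = Idt (Mor P I) (co P I i x y)"
    and intch_unit1: "\<lbrakk>I \<subseteq> {1..n}; i \<in> I; j \<in> I; i \<noteq> j; (x, y) \<in> Obj (pairs P I i)\<rbrakk>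
      \<Longrightarrow> Intch P I i j (x, y, eo P I j (to P I j x), eo P I j (to P I j y)) =
          Idt (Mor P I)
            (co P I j (co P I i x y) (co P I i (eo P I j (to P I j x)) (eo P I j (to P I j y))))"
    and intch_unit2: "\<lbrakk>I \<subseteq> {1..n}; i \<in> I; j \<in> I; i \<noteq> j; (x, y) \<in> Obj (pairs P I i)\<rbrakk>
      \<Longrightarrow> Intch P I i j (eo P I j (so P I j x), eo P I j (so P I j y), x, y) =
          Idt (Mor P I)
            (co P I j (co P I i (eo P I j (so P I j x)) (eo P I j (so P I j y))) (co P I i x y))"


section \<open>Gluing diagrams and composable tuples\<close>

text \<open>
  A block of a diagram with axes \<open>K\<close> is given by its integer coordinates
  \<open>b \<in> K \<rightarrow>\<^sub>E \<nat>\<close>; the regular diagram with \<open>p i\<close> blocks in each direction \<open>i \<in> K\<close> has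
  \<open>\<Prod>i\<in>K. p i\<close> blocks. Subdiagrams are sets of blocks.
\<close>

type_synonym block = "nat \<Rightarrow> nat"

definition regular_diagram :: "nat set \<Rightarrow> (nat \<Rightarrow> nat) \<Rightarrow> block set" where
  "regular_diagram K p = (\<Pi>\<^sub>E i\<in>K. {..<p i})"

definition matching :: "nat set \<Rightarrow> block set \<Rightarrow> (nat \<Rightarrow> 'x \<Rightarrow> 'x) \<Rightarrow> (nat \<Rightarrow> 'x \<Rightarrow> 'x) \<Rightarrow> (block \<Rightarrow> 'x) set" where
  "matching K D s t = {X. \<forall>i\<in>K. \<forall>b\<in>D. b(i := Suc (b i)) \<in> D \<longrightarrow> t i (X b) = s i (X (b(i := Suc (b i))))}"

text \<open>
  The entries of a composable tuple are \<open>k\<close>-morphisms in the \<open>k\<close> directions of the axes of the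
  diagram, so they lie in the summand \<open>Mor\<^sub>K\<close> of the coproduct of all \<open>Mor\<^sub>I\<close> with \<open>|I| = k\<close>,
  and so do all their composites.
\<close>

definition composable_tuples ::
    "('o, 'a) nfold \<Rightarrow> nat set \<Rightarrow> block set \<Rightarrow> (block \<Rightarrow> 'o, block \<Rightarrow> 'a) cat" where
  "composable_tuples P K D = sub_cat (power_cat D (Mor P K))
     (matching K D (so P K) (to P K)) (matching K D (sa P K) (ta P K))"


section \<open>Functors built from morphism composition\<close>

text \<open>
  As always in coherence theorems, a functor built from morphism composition is given together
  with the way it is built: in a particular pseudo n-fold category, two
  different bracketings may accidentally yield equal functors without the coherence isomorphism
  between them being the identity. \<open>Glue i F G\<close> stands for \<open>F \<circ>\<^sub>i G\<close>.
\<close>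

datatype scheme = Block block | Glue nat scheme scheme

primrec blocks :: "scheme \<Rightarrow> block set" where
  "blocks (Block b) = {b}"
| "blocks (Glue i F G) = blocks F \<union> blocks G"

text \<open>
  By the strict laws for \<open>s\<^sub>i (x \<circ>\<^sub>j y)\<close> and \<open>t\<^sub>i (x \<circ>\<^sub>j y)\<close>, the source and the target in
  direction \<open>i\<close> of a composite of blocks are composites of the sources and targets of
  the blocks at the boundary, with the following schemes. The coordinate \<open>i\<close> of a boundary block
  is forgotten.
\<close>

primrec src_face :: "nat \<Rightarrow> scheme \<Rightarrow> scheme" where
  "src_face i (Block b) = Block (b(i := undefined))"
| "src_face i (Glue j F G) = (if j = i then src_face i F else Glue j (src_face i F) (src_face i G))"

primrec tgt_face :: "nat \<Rightarrow> scheme \<Rightarrow> scheme" where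
  "tgt_face i (Block b) = Block (b(i := undefined))"
| "tgt_face i (Glue j F G) = (if j = i then tgt_face i G else Glue j (tgt_face i F) (tgt_face i G))"

text \<open>
  The last premise of \<open>glue\<close> says that \<open>F \<circ>\<^sub>i G\<close> is defined: \<open>t\<^sub>i F\<close> and \<open>s\<^sub>i G\<close> are the same
  composite of the morphisms at the separating hyperplane. For instance, \<open>(x \<circ>\<^sub>j y) \<circ>\<^sub>j z\<close>
  cannot be glued in direction \<open>i\<close> to \<open>x' \<circ>\<^sub>j (y' \<circ>\<^sub>j z')\<close>, since the associator in direction \<open>j\<close> need
  not be trivial on the common boundary.
\<close>

inductive built_from_composition :: "nat set \<Rightarrow> block set \<Rightarrow> scheme \<Rightarrow> bool"
  for K :: "nat set" where
  block: "built_from_composition K {b} (Block b)"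
| glue: "\<lbrakk>i \<in> K; {b \<in> D. b i < a} \<noteq> {}; {b \<in> D. a \<le> b i} \<noteq> {};
    built_from_composition K {b \<in> D. b i < a} F; built_from_composition K {b \<in> D. a \<le> b i} G;
    tgt_face i F = src_face i G\<rbrakk>
    \<Longrightarrow> built_from_composition K D (Glue i F G)"

primrec eval :: "(nat \<Rightarrow> 'x \<Rightarrow> 'x \<Rightarrow> 'x) \<Rightarrow> scheme \<Rightarrow> (block \<Rightarrow> 'x) \<Rightarrow> 'x" where
  "eval c (Block b) X = X b"
| "eval c (Glue i F G) X = c i (eval c F X) (eval c G X)"

definition composition_functor ::
    "('o, 'a) nfold \<Rightarrow> nat set \<Rightarrow> scheme \<Rightarrow> (block \<Rightarrow> 'o, block \<Rightarrow> 'a, 'o, 'a) ftr" where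
  "composition_functor P K T = \<lparr>on_obj = eval (co P K) T, on_arr = eval (ca P K) T\<rparr>"


section \<open>Natural isomorphisms built from associators and interchangers\<close>

text \<open>
  A natural isomorphism between composites of the diagram \<open>D\<close> is the family of its components,
  restricted to the composable tuples of \<open>D\<close> so that equality of natural isomorphisms is equality in HOL.

  The rule \<open>glue\<close> applies structure isomorphisms to sub-compositions; it includes the case that
  one of the two factors is an identity. That case does not suffice: \<open>t\<^sub>l\<close> of a component of \<open>\<beta>\<^sub>i\<^sub>j\<close>
  (\<open>l \<noteq> i, j\<close>) is again a component of \<open>\<beta>\<^sub>i\<^sub>j\<close>, so that \<open>\<beta>\<^sub>i\<^sub>j \<circ>\<^sub>l \<beta>\<^sub>i\<^sub>j\<close>, which
  occurs in the second hexagon, is defined but \<open>\<beta>\<^sub>i\<^sub>j \<circ>\<^sub>l id\<close> is not. The last premise of \<open>glue\<close> says that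
  \<open>\<eta> \<circ>\<^sub>i \<theta>\<close> is defined.
\<close>

inductive built_iso :: "('o, 'a) nfold \<Rightarrow> nat set \<Rightarrow> block set \<Rightarrow> scheme \<Rightarrow> scheme \<Rightarrow>
    ((block \<Rightarrow> 'o) \<Rightarrow> 'a) \<Rightarrow> bool"
  for P :: "('o, 'a) nfold" and K :: "nat set" where
  assoc: "\<lbrakk>built_from_composition K D (Glue i (Glue i F G) H);
      built_from_composition K D (Glue i F (Glue i G H))\<rbrakk>
    \<Longrightarrow> built_iso P K D (Glue i (Glue i F G) H) (Glue i F (Glue i G H))
      (\<lambda>X\<in>Obj (composable_tuples P K D).
         Assoc P K i (eval (co P K) F X, eval (co P K) G X, eval (co P K) H X))"
| assoc_inv: "\<lbrakk>built_from_composition K D (Glue i (Glue i F G) H);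
      built_from_composition K D (Glue i F (Glue i G H))\<rbrakk>
    \<Longrightarrow> built_iso P K D (Glue i F (Glue i G H)) (Glue i (Glue i F G) H)
      (\<lambda>X\<in>Obj (composable_tuples P K D). inverse_arr (Mor P K)
         (Assoc P K i (eval (co P K) F X, eval (co P K) G X, eval (co P K) H X)))"
| intch: "\<lbrakk>i \<noteq> j; built_from_composition K D (Glue j (Glue i F G) (Glue i F' G'));
      built_from_composition K D (Glue i (Glue j F F') (Glue j G G'))\<rbrakk>
    \<Longrightarrow> built_iso P K D (Glue j (Glue i F G) (Glue i F' G')) (Glue i (Glue j F F') (Glue j G G'))
      (\<lambda>X\<in>Obj (composable_tuples P K D).
         Intch P K i j (eval (co P K) F X, eval (co P K) G X, eval (co P K) F' X, eval (co P K) G' X))"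
| intch_inv: "\<lbrakk>i \<noteq> j; built_from_composition K D (Glue j (Glue i F G) (Glue i F' G'));
      built_from_composition K D (Glue i (Glue j F F') (Glue j G G'))\<rbrakk>
    \<Longrightarrow> built_iso P K D (Glue i (Glue j F F') (Glue j G G')) (Glue j (Glue i F G) (Glue i F' G'))
      (\<lambda>X\<in>Obj (composable_tuples P K D). inverse_arr (Mor P K)
         (Intch P K i j (eval (co P K) F X, eval (co P K) G X, eval (co P K) F' X, eval (co P K) G' X)))"
| ident: "built_from_composition K D T
    \<Longrightarrow> built_iso P K D T T (\<lambda>X\<in>Obj (composable_tuples P K D). Idt (Mor P K) (eval (co P K) T X))"
| comp: "\<lbrakk>built_iso P K D T T' \<eta>; built_iso P K D T' T'' \<theta>\<rbrakk>
    \<Longrightarrow> built_iso P K D T T'' (\<lambda>X\<in>Obj (composable_tuples P K D). Cmp (Mor P K) (\<theta> X) (\<eta> X))"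
| glue: "\<lbrakk>built_iso P K (blocks F) F F' \<eta>; built_iso P K (blocks G) G G' \<theta>;
      built_from_composition K D (Glue i F G); built_from_composition K D (Glue i F' G');
      \<forall>X\<in>Obj (composable_tuples P K D).
        ta P K i (\<eta> (restrict X (blocks F))) = sa P K i (\<theta> (restrict X (blocks G)))\<rbrakk>
    \<Longrightarrow> built_iso P K D (Glue i F G) (Glue i F' G')
      (\<lambda>X\<in>Obj (composable_tuples P K D).
         ca P K i (\<eta> (restrict X (blocks F))) (\<theta> (restrict X (blocks G))))"

end

theory Submission
  imports Defs
begin

text \<open>
  Composites of a box of blocks are compared with a normal form, which splits off the first layer of
  blocks in the first direction \<open>m\<close> in which the box is at least two blocks thick.
  The composite of the normal forms of the two halves of a box, cut at \<open>a\<close> in direction \<open>i\<close>, is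
  sent to the normal form of the box by an isomorphism \<open>\<sigma>\<^sub>i\<^sub>,\<^sub>a\<close> which is computed layer by layer, with an
  associator if \<open>i = m\<close> and with an interchanger \<open>\<beta>\<^sub>m\<^sub>i\<close> otherwise. By recursion, this gives an isomorphism
  from each composite to the normal form.

  All associators and interchangers commute with these isomorphisms to the normal form; so every natural
  isomorphism built from them is the composite of the one of its source and the inverse of the one of its target.
  For associators in direction \<open>i\<close> this reduces to a compatibility of \<open>\<sigma>\<^sub>i\<^sub>,\<^sub>a\<close> and \<open>\<sigma>\<^sub>i\<^sub>,\<^sub>b\<close>, which is
  proved by induction on the box, with the pentagon if \<open>i = m\<close> and the first hexagon otherwise.
  For interchangers it reduces to a compatibility of \<open>\<sigma>\<^sub>i\<^sub>,\<^sub>a\<close> and \<open>\<sigma>\<^sub>j\<^sub>,\<^sub>b\<close>, which uses the first hexagon if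
  \<open>m\<close> is \<open>i\<close> or \<open>j\<close> and the second hexagon otherwise.
\<close>

text \<open>The obstacle is that gluing is partial: \<open>f \<odot>\<^sub>i g\<close> exists only
  if the faces of \<open>f\<close> and \<open>g\<close> agree strictly, so a coherence cell cannot
  in general be whiskered with an identity. Every construction therefore comes with a proof that
  neighbouring instances match along each face. Two facts control the faces: along their own
  directions \<open>\<alpha>\<close> and \<open>\<beta>\<close> have identity faces, and along the
  other directions their faces are again components of \<open>\<alpha>\<close> and
  \<open>\<beta>\<close>. The normal form fits this. Its first cut depends only on which directions
  are thick, so a face of a normal form is the normal form of the face, and normal forms of
  neighbouring boxes can be glued. Moreover, a cut in a direction other than \<open>m\<close> leaves
  \<open>m\<close> the first thick direction of both halves, so the recursions for the box and for
  its halves unfold in parallel. The isomorphisms to the normal form are defined by recursion and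
  not as members of \<open>built_iso\<close>. Uniqueness is an invariant of the rules of
  \<open>built_iso\<close>; existence is shown separately, by following the same recursion inside
  \<open>built_iso\<close>, where the invariant supplies the matching premises of gluing.\<close>

section \<open>Boxes, tilings and normal forms\<close>

text \<open>Unfolding updates pointwise would destroy the terms \<open>lo(i := a)\<close> below.\<close>

declare fun_upd_apply [simp del] fun_upd_same [simp] fun_upd_other [simp] fun_upd_other[OF not_sym, simp]

section \<open>Boxes of blocks\<close>

definition box :: "nat set \<Rightarrow> block \<Rightarrow> block \<Rightarrow> block set" where
  "box K lo hi = (\<Pi>\<^sub>E i\<in>K. {lo i..<hi i})"

text \<open>Corners are \<open>undefined\<close> outside \<open>K\<close>. Hence a tiling determines
  them (\<open>tiling_unique\<close>), and no direction outside \<open>K\<close> is thick.\<close>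

definition bounds :: "nat set \<Rightarrow> block \<Rightarrow> block \<Rightarrow> bool" where
  "bounds K lo hi \<longleftrightarrow> lo \<in> extensional K \<and> hi \<in> extensional K \<and> (\<forall>i\<in>K. lo i < hi i)"

lemma bounds_less: "bounds K lo hi \<Longrightarrow> i \<in> K \<Longrightarrow> lo i < hi i"
  by (simp add: bounds_def)

lemma bounds_hi: "bounds K lo hi \<Longrightarrow> i \<in> K \<Longrightarrow> lo i < a \<Longrightarrow> bounds K lo (hi(i := a))"
  by (auto simp: bounds_def extensional_def fun_upd_apply)

lemma bounds_lo: "bounds K lo hi \<Longrightarrow> i \<in> K \<Longrightarrow> a < hi i \<Longrightarrow> bounds K (lo(i := a)) hi"
  by (auto simp: bounds_def extensional_def fun_upd_apply)

lemma lo_in_box: "bounds K lo hi \<Longrightarrow> lo \<in> box K lo hi"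
  by (auto simp: bounds_def box_def PiE_iff)

lemma box_iff: "b \<in> box K lo hi \<longleftrightarrow> b \<in> extensional K \<and> (\<forall>i\<in>K. lo i \<le> b i \<and> b i < hi i)"
  by (auto simp: box_def PiE_iff)

lemma box_below:
  assumes "i \<in> K" "a \<le> hi i"
  shows "{b \<in> box K lo hi. b i < a} = box K lo (hi(i := a))"
proof (intro set_eqI iffI)
  fix b assume b: "b \<in> box K lo (hi(i := a))"
  then have j: "lo j \<le> b j \<and> b j < (hi(i := a)) j" if "j \<in> K" for j
    using that by (simp only: box_iff)
  then have "lo j \<le> b j \<and> b j < hi j" if "j \<in> K" for j
    using that j[of j] assms(2) by (cases "j = i") auto
  then show "b \<in> {b \<in> box K lo hi. b i < a}"
    using b j[of i] assms(1) by (simp add: box_iff)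
qed (auto simp: box_iff fun_upd_apply)

lemma box_above:
  assumes "i \<in> K" "lo i \<le> a"
  shows "{b \<in> box K lo hi. a \<le> b i} = box K (lo(i := a)) hi"
proof (intro set_eqI iffI)
  fix b assume b: "b \<in> box K (lo(i := a)) hi"
  then have j: "(lo(i := a)) j \<le> b j \<and> b j < hi j" if "j \<in> K" for j
    using that by (simp only: box_iff)
  then have "lo j \<le> b j \<and> b j < hi j" if "j \<in> K" for j
    using that j[of j] assms(2) by (cases "j = i") auto
  then show "b \<in> {b \<in> box K lo hi. a \<le> b i}"
    using b j[of i] assms(1) by (simp add: box_iff)
qed (auto simp: box_iff fun_upd_apply)

lemma box_split: "i \<in> K \<Longrightarrow> lo i \<le> a \<Longrightarrow> a \<le> hi i \<Longrightarrow>
    box K lo hi = box K lo (hi(i := a)) \<union> box K (lo(i := a)) hi"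
  using box_below[of i K a hi lo] box_above[of i K lo a hi] by fastforce

lemma box_unit: "bounds K lo hi \<Longrightarrow> \<forall>i\<in>K. hi i = Suc (lo i) \<Longrightarrow> box K lo hi = {lo}"
  by (fastforce simp: bounds_def box_def PiE_iff extensional_def)

lemma box_singleton:
  assumes "bounds K lo hi" "box K lo hi = {b}"
  shows "b = lo" "\<forall>i\<in>K. hi i = Suc (lo i)"
proof -
  show b: "b = lo"
    using lo_in_box[OF assms(1)] assms(2) by simp
  show "\<forall>i\<in>K. hi i = Suc (lo i)"
  proof
    fix i assume i: "i \<in> K"
    show "hi i = Suc (lo i)"
    proof (rule ccontr)
      assume "hi i \<noteq> Suc (lo i)"
      then have "Suc (lo i) < hi i"
        using bounds_less[OF assms(1) i] by linarith
      \<comment> \<open>If side \<open>i\<close> were longer, the neighbour of \<open>lo\<close> in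
        direction \<open>i\<close> would be a second block of the box.\<close>
      then have "lo(i := Suc (lo i)) \<in> box K lo hi"
        using assms(1) i by (auto simp: fun_upd_apply bounds_def box_def PiE_iff extensional_def)
      then have "(lo(i := Suc (lo i))) i = lo i"
        using assms(2) b by (metis singletonD)
      then show False
        by simp
    qed
  qed
qed

section \<open>Tilings of boxes and their corners\<close>

text \<open>This is \<open>built_from_composition\<close> for boxes, with the corners as arguments:
  the position of each cut becomes part of the derivation, so that cuts in different schemes can be
  compared.\<close>

inductive tiling :: "nat set \<Rightarrow> block \<Rightarrow> block \<Rightarrow> scheme \<Rightarrow> bool" for K where
  block: "\<lbrakk>bounds K lo hi; \<forall>i\<in>K. hi i = Suc (lo i)\<rbrakk> \<Longrightarrow> tiling K lo hi (Block lo)"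
| glue: "\<lbrakk>bounds K lo hi; i \<in> K; lo i < a; a < hi i; tiling K lo (hi(i := a)) F;
    tiling K (lo(i := a)) hi G; tgt_face i F = src_face i G\<rbrakk> \<Longrightarrow> tiling K lo hi (Glue i F G)"

inductive_cases tiling_BlockE: "tiling K lo hi (Block b)"
inductive_cases tiling_GlueE: "tiling K lo hi (Glue i F G)"

lemma tiling_bounds: "tiling K lo hi T \<Longrightarrow> bounds K lo hi"
  by (auto elim: tiling.cases)

lemma tiling_imp_built: "tiling K lo hi T \<Longrightarrow> built_from_composition K (box K lo hi) T"
proof (induction rule: tiling.induct)
  case (block lo hi)
  then show ?case
    by (simp add: box_unit built_from_composition.block)
next
  case (glue lo hi i a F G)
  have eqs: "{b \<in> box K lo hi. b i < a} = box K lo (hi(i := a))"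
    "{b \<in> box K lo hi. a \<le> b i} = box K (lo(i := a)) hi"
    using glue.hyps by (simp_all add: box_below box_above)
  have "lo \<in> box K lo (hi(i := a))" "lo(i := a) \<in> box K (lo(i := a)) hi"
    using lo_in_box bounds_hi bounds_lo glue.hyps by blast+
  then show ?case
    using glue.hyps glue.IH
    by (intro built_from_composition.glue[where a = a, unfolded eqs]) (auto simp only: eqs)
qed

lemma built_imp_tiling:
  "built_from_composition K D T \<Longrightarrow> bounds K lo hi \<Longrightarrow> D = box K lo hi \<Longrightarrow> tiling K lo hi T"
proof (induction arbitrary: lo hi rule: built_from_composition.induct)
  case (block b)
  then show ?case
    using box_singleton[of K lo hi b] tiling.block[of K lo hi] by metis
next
  case (glue i D a F G)
  obtain b b' where b: "b \<in> box K lo hi" "b i < a" and b': "b' \<in> box K lo hi" "a \<le> b' i"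
    using glue.hyps(2,3) glue.prems(2) by blast
  \<comment> \<open>Both halves are nonempty, so the hyperplane lies strictly inside the
    box.\<close>
  have a: "lo i < a" "a < hi i"
    using b b' glue.hyps(1) by (auto simp: box_iff intro: le_less_trans)
  have "tiling K lo (hi(i := a)) F"
    using glue.prems a glue.hyps(1) by (intro glue.IH(1)) (auto simp: bounds_hi box_below[symmetric])
  moreover have "tiling K (lo(i := a)) hi G"
    using glue.prems a glue.hyps(1) by (intro glue.IH(2)) (auto simp: bounds_lo box_above[symmetric])
  ultimately show ?case
    using glue.prems a glue.hyps by (intro tiling.glue[where a = a])
qed

lemma tiling_blocks: "tiling K lo hi T \<Longrightarrow> blocks T = box K lo hi"
proof (induction rule: tiling.induct)
  case (glue lo hi i a F G)
  then show ?case
    using box_split[of i K lo a hi] by simp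
qed (simp add: box_unit)

text \<open>The extreme blocks sit at the ends of the leftmost and the rightmost branch, so
  \<open>lo_of\<close> and \<open>hi_of\<close> recover the corners of a tiled box from the scheme
  alone. The definition of \<open>normalize\<close> reads off its cuts in this way.\<close>

primrec lo_of :: "scheme \<Rightarrow> block" where
  "lo_of (Block b) = b"
| "lo_of (Glue i F G) = lo_of F"

primrec hi_of :: "nat set \<Rightarrow> scheme \<Rightarrow> block" where
  "hi_of K (Block b) = (\<lambda>i\<in>K. Suc (b i))"
| "hi_of K (Glue i F G) = hi_of K G"

lemma tiling_lo_of: "tiling K lo hi T \<Longrightarrow> lo_of T = lo"
  by (induction rule: tiling.induct) auto

lemma tiling_hi_of: "tiling K lo hi T \<Longrightarrow> hi_of K T = hi"
  by (induction rule: tiling.induct) (auto simp: bounds_def extensional_def)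

lemma tiling_unique: "tiling K lo hi T \<Longrightarrow> tiling K lo' hi' T \<Longrightarrow> lo' = lo \<and> hi' = hi"
  using tiling_lo_of tiling_hi_of by metis

lemma lo_of_src_face: "j \<noteq> l \<Longrightarrow> lo_of (src_face l T) j = lo_of T j"
  by (induction T) auto

text \<open>The leftmost block of a target face may come from the second factor. In a tiling that
  factor starts at \<open>lo(l := a)\<close>, so only coordinate \<open>l\<close> can differ. This
  identifies cuts on the two sides of a common face.\<close>

lemma lo_of_tgt_face: "tiling K lo hi T \<Longrightarrow> j \<noteq> l \<Longrightarrow> lo_of (tgt_face l T) j = lo j"
  by (induction rule: tiling.induct) auto

section \<open>Thick directions and the normal form of a box\<close>

definition thick :: "block \<Rightarrow> block \<Rightarrow> nat set" where
  "thick lo hi = {j. Suc (lo j) < hi j}"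

text \<open>Summing over the thick directions alone gives a size that does not mention
  \<open>K\<close>; it is the measure for all recursions and inductions on boxes.\<close>

definition bulk :: "block \<Rightarrow> block \<Rightarrow> nat" where
  "bulk lo hi = (\<Sum>j\<in>thick lo hi. hi j - lo j)"

text \<open>A relational form of the \<open>LEAST\<close> in \<open>normal\<close> and
  \<open>split_iso\<close>, easier to transfer from a box to its parts.\<close>

definition lead :: "block \<Rightarrow> block \<Rightarrow> nat \<Rightarrow> bool" where
  "lead lo hi m \<longleftrightarrow> Suc (lo m) < hi m \<and> (\<forall>j<m. \<not> Suc (lo j) < hi j)"

lemma lead_Least: "lead lo hi m \<Longrightarrow> (LEAST j. Suc (lo j) < hi j) = m"
  unfolding lead_def by (intro Least_equality) (auto simp: not_less[symmetric])

lemma lead_exists: "thick lo hi \<noteq> {} \<Longrightarrow> \<exists>m. lead lo hi m"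
  unfolding lead_def thick_def
  by (rule exI[of _ "LEAST j. Suc (lo j) < hi j"]) (auto intro: LeastI dest: not_less_Least)

lemma lead_less: "lead lo hi m \<Longrightarrow> Suc (lo i) < hi i \<Longrightarrow> i \<noteq> m \<Longrightarrow> m < i"
  unfolding lead_def by (meson linorder_neqE_nat)

lemma bounds_thick: "bounds K lo hi \<Longrightarrow> Suc (lo i) < hi i \<Longrightarrow> i \<in> K"
  unfolding bounds_def extensional_def by force

lemma finite_thick: "finite K \<Longrightarrow> bounds K lo hi \<Longrightarrow> finite (thick lo hi)"
  by (rule finite_subset[of _ K]) (auto simp: thick_def bounds_thick)

lemma bounds_lead: "bounds K lo hi \<Longrightarrow> lead lo hi m \<Longrightarrow> m \<in> K"
  by (auto simp: lead_def bounds_thick)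

text \<open>A direction that becomes thin drops out of the sum. Counting it with its remaining
  length only overestimates the new sum, and shortening one thick direction already makes that
  overestimate smaller than the old sum.\<close>

lemma bulk_less:
  assumes "finite (thick lo hi)" "\<forall>j. lo j \<le> lo' j \<and> hi' j \<le> hi j"
    and "Suc (lo i) < hi i" "hi' i - lo' i < hi i - lo i"
  shows "bulk lo' hi' < bulk lo hi"
proof -
  have sub: "thick lo' hi' \<subseteq> thick lo hi"
    using assms(2) by (auto simp: thick_def) (meson Suc_le_mono le_less_trans less_le_trans)
  have "bulk lo' hi' \<le> (\<Sum>j\<in>thick lo hi. hi' j - lo' j)"
    unfolding bulk_def using sub assms(1) by (intro sum_mono2) auto
  also have "\<dots> < bulk lo hi"
    unfolding bulk_def using assms
    by (intro sum_strict_mono_ex1) (auto simp: thick_def diff_le_mono2 intro!: diff_le_mono order_trans[OF diff_le_mono diff_le_mono2])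
  finally show ?thesis .
qed

lemma bulk_hi: "finite (thick lo hi) \<Longrightarrow> lo i < a \<Longrightarrow> a < hi i \<Longrightarrow> bulk lo (hi(i := a)) < bulk lo hi"
  by (rule bulk_less[where i = i]) (auto simp: fun_upd_apply)

lemma bulk_lo: "finite (thick lo hi) \<Longrightarrow> lo i < a \<Longrightarrow> a < hi i \<Longrightarrow> bulk (lo(i := a)) hi < bulk lo hi"
  by (rule bulk_less[where i = i]) (auto simp: fun_upd_apply)

lemma bulk_lead:
  assumes "finite (thick lo hi)" "thick lo hi \<noteq> {}"
  defines "m \<equiv> LEAST j. Suc (lo j) < hi j"
  shows "bulk lo (hi(m := Suc (lo m))) < bulk lo hi" "bulk (lo(m := Suc (lo m))) hi < bulk lo hi"
proof -
  have "Suc (lo m) < hi m"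
    using lead_exists[OF assms(2)] lead_Least unfolding m_def lead_def by blast
  then show "bulk lo (hi(m := Suc (lo m))) < bulk lo hi" "bulk (lo(m := Suc (lo m))) hi < bulk lo hi"
    using assms(1) by (auto intro: bulk_hi bulk_lo)
qed

text \<open>The guard makes the recursion total: for arbitrary corners infinitely many directions
  could be thick, and then \<open>bulk\<close> is no measure. For boxes over a finite
  \<open>K\<close> it holds by \<open>finite_thick\<close>.\<close>

function normal :: "block \<Rightarrow> block \<Rightarrow> scheme" where
  "normal lo hi = (if finite (thick lo hi) \<and> thick lo hi \<noteq> {}
     then let m = LEAST j. Suc (lo j) < hi j in
       Glue m (normal lo (hi(m := Suc (lo m)))) (normal (lo(m := Suc (lo m))) hi)
     else Block lo)"
  by auto
termination
  by (relation "measure (\<lambda>(lo, hi). bulk lo hi)") (auto simp: bulk_lead)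

declare normal.simps[simp del]

lemma normal_lead:
  assumes "finite (thick lo hi)" "lead lo hi m"
  shows "normal lo hi = Glue m (normal lo (hi(m := Suc (lo m)))) (normal (lo(m := Suc (lo m))) hi)"
proof -
  have "thick lo hi \<noteq> {}"
    using assms(2) by (auto simp: lead_def thick_def)
  then show ?thesis
    using assms by (subst normal.simps) (simp add: lead_Least Let_def)
qed

lemma normal_thin: "thick lo hi = {} \<Longrightarrow> normal lo hi = Block lo"
  by (subst normal.simps) simp

lemma thick_forget: "thick (lo(l := u)) (hi(l := u)) = thick lo hi - {l}"
  by (auto simp: thick_def fun_upd_apply)

text \<open>Forgetting coordinate \<open>l\<close> removes \<open>l\<close> from the thick
  directions and leaves the order of the others. So a cut along another direction is still the first
  cut of the face, and a cut along \<open>l\<close> is invisible in it.\<close>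

lemma normal_face:
  "tgt_face l (normal lo hi) = normal (lo(l := undefined)) (hi(l := undefined)) \<and>
   src_face l (normal lo hi) = normal (lo(l := undefined)) (hi(l := undefined))"
proof (induction lo hi rule: normal.induct)
  case (1 lo hi)
  show ?case
  proof (cases "finite (thick lo hi) \<and> thick lo hi \<noteq> {}")
    case True
    define m where "m = (LEAST j. Suc (lo j) < hi j)"
    have m: "lead lo hi m"
      using True lead_exists lead_Least m_def by metis
    note IH = 1[OF True m_def]
    note eq = normal_lead[OF conjunct1[OF True] m]
    show ?thesis
    proof (cases "l = m")
      case True
      \<comment> \<open>Either face comes from one of the two pieces, and these become the same box
        once coordinate \<open>l\<close> is forgotten.\<close>
      then show ?thesis
        using IH by (simp add: eq)
    next
      case False
      then have "lead (lo(l := undefined)) (hi(l := undefined)) m"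
        using m by (auto simp: lead_def fun_upd_apply)
      then have "normal (lo(l := undefined)) (hi(l := undefined)) =
          Glue m (normal (lo(l := undefined)) ((hi(l := undefined))(m := Suc (lo m))))
            (normal ((lo(l := undefined))(m := Suc (lo m))) (hi(l := undefined)))"
        using normal_lead[of "lo(l := undefined)" "hi(l := undefined)" m] False True
        by (simp add: thick_forget)
      then show ?thesis
        using IH False by (simp add: eq fun_upd_twist)
    qed
  next
    case False
    \<comment> \<open>Removing one direction leaves an empty set empty and an infinite set
      infinite.\<close>
    then have "\<not> (finite (thick lo hi - {l}) \<and> thick lo hi - {l} \<noteq> {})"
      by auto
    then have "normal (lo(l := undefined)) (hi(l := undefined)) = Block (lo(l := undefined))"
      by (subst normal.simps) (simp only: thick_forget if_False)
    moreover have "normal lo hi = Block lo"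
      using False by (subst normal.simps) (simp only: if_False)
    ultimately show ?thesis
      by simp
  qed
qed

text \<open>Forgetting coordinate \<open>l\<close> turns both halves into the same box; hence normal
  forms of the two halves of a cut can always be glued.\<close>

lemma normal_face_eq:
  "tgt_face l (normal lo (hi(l := a))) = src_face l (normal (lo(l := a)) hi)"
  by (simp add: normal_face)

lemma normal_tiling: "finite K \<Longrightarrow> bounds K lo hi \<Longrightarrow> tiling K lo hi (normal lo hi)"
proof (induction "bulk lo hi" arbitrary: lo hi rule: less_induct)
  case less
  have fin: "finite (thick lo hi)"
    using less.prems finite_thick by blast
  show ?case
  proof (cases "thick lo hi = {}")
    case True
    then have "\<not> Suc (lo i) < hi i" for i
      by (auto simp: thick_def)
    then have "\<forall>i\<in>K. hi i = Suc (lo i)"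
      using bounds_less[OF less.prems(2)] by (metis Suc_lessI)
    then show ?thesis
      using True less.prems by (simp add: normal_thin tiling.block)
  next
    case False
    then obtain m where m: "lead lo hi m"
      using lead_exists by blast
    then have "Suc (lo m) < hi m" "m \<in> K"
      using bounds_lead less.prems by (auto simp: lead_def)
    then show ?thesis
      unfolding normal_lead[OF fin m] using less.prems fin
      by (intro tiling.glue[where a = "Suc (lo m)"] less.hyps bulk_hi bulk_lo bounds_hi bounds_lo normal_face_eq)
        auto
  qed
qed

text \<open>
  Simultaneous induction for a property \<open>P\<close> of tilings and a property \<open>Q\<close> of pairs of tilings
  with a common face: \<open>P\<close> for \<open>F \<circ>\<^sub>i G\<close> typically needs that \<open>F\<close> and \<open>G\<close> match, and
  a match along \<open>l\<close> is reduced to smaller tilings by dropping the parts away from the common face.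
\<close>

lemma tiling_pair_induct:
  fixes P :: "block \<Rightarrow> block \<Rightarrow> scheme \<Rightarrow> bool"
    and Q :: "nat \<Rightarrow> nat \<Rightarrow> block \<Rightarrow> block \<Rightarrow> scheme \<Rightarrow> scheme \<Rightarrow> bool"
  assumes Block: "\<And>lo hi. \<lbrakk>bounds K lo hi; \<forall>i\<in>K. hi i = Suc (lo i)\<rbrakk> \<Longrightarrow> P lo hi (Block lo)"
    and Glue: "\<And>lo hi i a F G. \<lbrakk>bounds K lo hi; i \<in> K; lo i < a; a < hi i;
        tiling K lo (hi(i := a)) F; tiling K (lo(i := a)) hi G;
        P lo (hi(i := a)) F; P (lo(i := a)) hi G; Q i a lo hi F G\<rbrakk> \<Longrightarrow> P lo hi (Glue i F G)"
    and QBlock: "\<And>lo hi l. \<lbrakk>bounds K lo hi; l \<in> K; hi l = Suc (Suc (lo l));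
        \<forall>i\<in>K - {l}. hi i = Suc (lo i)\<rbrakk>
        \<Longrightarrow> Q l (Suc (lo l)) lo hi (Block lo) (Block (lo(l := Suc (lo l))))"
    and QLeft: "\<And>lo hi l a b F F' G. \<lbrakk>bounds K lo hi; l \<in> K; lo l < a; a < b; b < hi l;
        tiling K lo (hi(l := a)) F; tiling K (lo(l := a)) (hi(l := b)) F'; tiling K (lo(l := b)) hi G;
        P lo (hi(l := a)) F; P (lo(l := a)) (hi(l := b)) F'; P (lo(l := b)) hi G;
        Q l a lo (hi(l := b)) F F'; Q l b (lo(l := a)) hi F' G\<rbrakk> \<Longrightarrow> Q l b lo hi (Glue l F F') G"
    and QRight: "\<And>lo hi l a b F G G'. \<lbrakk>bounds K lo hi; l \<in> K; lo l < b; b < a; a < hi l;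
        tiling K lo (hi(l := b)) F; tiling K (lo(l := b)) (hi(l := a)) G; tiling K (lo(l := a)) hi G';
        P lo (hi(l := b)) F; P (lo(l := b)) (hi(l := a)) G; P (lo(l := a)) hi G';
        Q l b lo (hi(l := a)) F G; Q l a (lo(l := b)) hi G G'\<rbrakk> \<Longrightarrow> Q l b lo hi F (Glue l G G')"
    and QCross: "\<And>lo hi l b j a F F' G G'. \<lbrakk>bounds K lo hi; l \<in> K; lo l < b; b < hi l;
        j \<in> K; j \<noteq> l; lo j < a; a < hi j;
        tiling K lo (hi(l := b, j := a)) F; tiling K (lo(j := a)) (hi(l := b)) F';
        tiling K (lo(l := b)) (hi(j := a)) G; tiling K (lo(l := b, j := a)) hi G';
        P lo (hi(l := b, j := a)) F; P (lo(j := a)) (hi(l := b)) F';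
        P (lo(l := b)) (hi(j := a)) G; P (lo(l := b, j := a)) hi G';
        Q j a lo (hi(l := b)) F F'; Q j a (lo(l := b)) hi G G';
        Q l b lo (hi(j := a)) F G; Q l b (lo(j := a)) hi F' G'\<rbrakk>
        \<Longrightarrow> Q l b lo hi (Glue j F F') (Glue j G G')"
  shows "tiling K lo hi T \<Longrightarrow> P lo hi T"
    and "\<lbrakk>tiling K lo (hi(l := b)) F; tiling K (lo(l := b)) hi G; bounds K lo hi; l \<in> K; lo l < b; b < hi l;
      tgt_face l F = src_face l G\<rbrakk> \<Longrightarrow> Q l b lo hi F G"
proof -
  \<comment> \<open>Strong induction on a common bound \<open>k\<close>: the size of the tiling for
    \<open>P\<close>, the total size of both tilings for \<open>Q\<close>. A \<open>Glue\<close> is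
    larger than the sum of its factors, so \<open>P\<close> for a \<open>Glue\<close> may use
    \<open>Q\<close> for its factors.\<close>
  have main: "(\<forall>lo hi T. size T \<le> k \<longrightarrow> tiling K lo hi T \<longrightarrow> P lo hi T) \<and>
    (\<forall>lo hi l b F G. size F + size G \<le> k \<longrightarrow> tiling K lo (hi(l := b)) F \<longrightarrow> tiling K (lo(l := b)) hi G \<longrightarrow>
      bounds K lo hi \<longrightarrow> l \<in> K \<longrightarrow> lo l < b \<longrightarrow> b < hi l \<longrightarrow> tgt_face l F = src_face l G \<longrightarrow> Q l b lo hi F G)" for k
  proof (induction k rule: less_induct)
    case (less k)
    have IHP: "P lo hi T" if "tiling K lo hi T" "size T < k" for lo hi T
      using less that by blast
    have IHQ: "Q l b lo hi F G" if "tiling K lo (hi(l := b)) F" "tiling K (lo(l := b)) hi G"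
      "size F + size G < k" "bounds K lo hi" "l \<in> K" "lo l < b" "b < hi l" "tgt_face l F = src_face l G"
      for lo hi l b F G
      using less that by blast
    have "P lo hi T" if T: "tiling K lo hi T" "size T \<le> k" for lo hi T
      using T(1)
    proof cases
      case block
      then show ?thesis
        using Block by simp
    next
      case (glue i a F G)
      moreover have "size F < k" "size G < k" "size F + size G < k"
        using T(2) glue(1) by auto
      ultimately show ?thesis
        by (metis Glue IHP IHQ)
    qed
    moreover have "Q l b lo hi F G" if F: "tiling K lo (hi(l := b)) F" and G: "tiling K (lo(l := b)) hi G"
      and size: "size F + size G \<le> k" and bd: "bounds K lo hi" "l \<in> K" "lo l < b" "b < hi l"
      and face: "tgt_face l F = src_face l G" for lo hi l b F G
    \<comment> \<open>A cut along \<open>l\<close> at the root of either tiling does not show in the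
      common face and is peeled off. If neither root is cut along \<open>l\<close>, equal faces
      force both to be blocks or both to be cut in the same direction \<open>j\<close>.\<close>
    proof (cases "\<exists>F1 F2. F = Glue l F1 F2")
      case True
      then obtain F1 F2 where F12: "F = Glue l F1 F2"
        by blast
      obtain a where a: "lo l < a" "a < b" "tiling K lo (hi(l := a)) F1"
        "tiling K (lo(l := a)) (hi(l := b)) F2" "tgt_face l F1 = src_face l F2"
        using F unfolding F12 by (auto elim: tiling_GlueE)
      have sz: "size F1 + size F2 < k" "size F1 < k" "size F2 < k" "size G < k" "size F2 + size G < k"
        using size F12 by auto
      show ?thesis
        unfolding F12 using a bd G sz face F12
        by (intro QLeft[where a = a] IHP IHQ) (auto intro: bounds_hi bounds_lo)
    next
      case nF: False
      show ?thesis
      proof (cases "\<exists>G1 G2. G = Glue l G1 G2")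
        case True
        then obtain G1 G2 where G12: "G = Glue l G1 G2"
          by blast
        obtain a where a: "b < a" "a < hi l" "tiling K (lo(l := b)) (hi(l := a)) G1"
          "tiling K (lo(l := a)) hi G2" "tgt_face l G1 = src_face l G2"
          using G unfolding G12 by (auto elim: tiling_GlueE)
        have sz: "size G1 + size G2 < k" "size G1 < k" "size G2 < k" "size F < k" "size F + size G1 < k"
          using size G12 by auto
        show ?thesis
          unfolding G12 using a bd F sz face G12
          by (intro QRight[where a = a] IHP IHQ) (auto intro: bounds_hi bounds_lo)
      next
        case nG: False
        show ?thesis
        proof (cases F)
          case (Block f)
          then obtain g where g: "G = Block g"
            using face nG by (cases G) (auto split: if_splits)
          have "f = lo" "\<forall>i\<in>K. (hi(l := b)) i = Suc (lo i)"
            using F Block by (auto elim: tiling_BlockE)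
          moreover have "g = lo(l := b)" "\<forall>i\<in>K. hi i = Suc ((lo(l := b)) i)"
            using G g by (auto elim: tiling_BlockE)
          ultimately show ?thesis
            using QBlock[of lo hi l] bd Block g by force
        next
          case (Glue j F1 F2)
          then have jl: "j \<noteq> l"
            using nF by blast
          then obtain G1 G2 where G12: "G = Glue j G1 G2"
            and faces: "tgt_face l F1 = src_face l G1" "tgt_face l F2 = src_face l G2"
            using face nG Glue by (cases G) (auto split: if_splits)
          obtain a where a: "j \<in> K" "lo j < a" "a < hi j" "tiling K lo (hi(l := b, j := a)) F1"
            "tiling K (lo(j := a)) (hi(l := b)) F2" "tgt_face j F1 = src_face j F2"
            using F jl unfolding Glue by (auto elim: tiling_GlueE)
          obtain a' where a': "tiling K (lo(l := b)) (hi(j := a')) G1"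
            "tiling K (lo(l := b, j := a')) hi G2" "tgt_face j G1 = src_face j G2"
            using G jl unfolding G12 by (auto elim: tiling_GlueE)
          \<comment> \<open>The second factors have a common face, and \<open>a\<close> and
            \<open>a'\<close> are coordinate \<open>j\<close> of its lower corner, computed from
            either side.\<close>
          have "a' = a"
            using lo_of_tgt_face[OF a(5) jl] lo_of_src_face[OF jl, of G2] tiling_lo_of[OF a'(2)] faces
            by simp
          note a' = a'[unfolded this]
          have sz: "size F1 + size F2 < k" "size G1 + size G2 < k" "size F1 < k" "size F2 < k"
            "size G1 < k" "size G2 < k" "size F1 + size G1 < k" "size F2 + size G2 < k"
            using size G12 Glue by auto
          have tw: "hi(l := b, j := a) = hi(j := a, l := b)" "lo(l := b, j := a) = lo(j := a, l := b)"
            using jl by (auto simp: fun_upd_twist)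
          have tils: "tiling K lo (hi(j := a, l := b)) F1" "tiling K (lo(j := a, l := b)) hi G2"
            using a a' tw by auto
          show ?thesis
            unfolding G12 Glue using a a' tils bd sz jl faces
            by (intro QCross[where a = a] IHP IHQ) (auto intro: bounds_hi bounds_lo)
        qed
      qed
    qed
    ultimately show ?case
      by blast
  qed
  show "tiling K lo hi T \<Longrightarrow> P lo hi T"
    using main by blast
  show "\<lbrakk>tiling K lo (hi(l := b)) F; tiling K (lo(l := b)) hi G; bounds K lo hi; l \<in> K; lo l < b; b < hi l;
      tgt_face l F = src_face l G\<rbrakk> \<Longrightarrow> Q l b lo hi F G"
    using main by blast
qed

lemma finite_K: "(K :: nat set) \<subseteq> {1..n} \<Longrightarrow> finite K"
  by (rule finite_subset) auto

section \<open>Composites of tilings\<close>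

text \<open>Composability on a box without extensionality, so that one tuple serves for all
  sub-boxes.\<close>

definition grid :: "nat set \<Rightarrow> 'x set \<Rightarrow> (nat \<Rightarrow> 'x \<Rightarrow> 'x) \<Rightarrow> (nat \<Rightarrow> 'x \<Rightarrow> 'x) \<Rightarrow>
    block \<Rightarrow> block \<Rightarrow> (block \<Rightarrow> 'x) \<Rightarrow> bool" where
  "grid K A s t lo hi X \<longleftrightarrow>
     bounds K lo hi \<and> (\<forall>b\<in>box K lo hi. X b \<in> A) \<and> X \<in> matching K (box K lo hi) s t"

lemma matching_mono: "D' \<subseteq> D \<Longrightarrow> X \<in> matching K D s t \<Longrightarrow> X \<in> matching K D' s t"
  by (auto simp: matching_def)

lemma matching_cong: "(\<And>b. b \<in> D \<Longrightarrow> X b = Y b) \<Longrightarrow> X \<in> matching K D s t \<longleftrightarrow> Y \<in> matching K D s t"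
  by (auto simp: matching_def)

lemma grid_bounds: "grid K A s t lo hi X \<Longrightarrow> bounds K lo hi"
  by (simp add: grid_def)

lemma grid_hi:
  assumes "grid K A s t lo hi X" "i \<in> K" "lo i < a" "a < hi i"
  shows "grid K A s t lo (hi(i := a)) X"
proof -
  have "box K lo (hi(i := a)) \<subseteq> box K lo hi"
    using assms box_below[of i K a hi lo] by auto
  then show ?thesis
    using assms by (auto simp: grid_def intro: bounds_hi matching_mono)
qed

lemma grid_lo:
  assumes "grid K A s t lo hi X" "i \<in> K" "lo i < a" "a < hi i"
  shows "grid K A s t (lo(i := a)) hi X"
proof -
  have "box K (lo(i := a)) hi \<subseteq> box K lo hi"
    using assms box_above[of i K lo a hi] by auto
  then show ?thesis
    using assms by (auto simp: grid_def intro: bounds_lo matching_mono)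
qed

lemma grid_cong: "(\<And>b. b \<in> box K lo hi \<Longrightarrow> X b = Y b) \<Longrightarrow> grid K A s t lo hi X \<longleftrightarrow> grid K A s t lo hi Y"
  using matching_cong[of "box K lo hi" X Y] by (auto simp: grid_def)

lemma eval_cong: "(\<And>b. b \<in> blocks T \<Longrightarrow> X b = Y b) \<Longrightarrow> eval c T X = eval c T Y"
  by (induction T) auto

text \<open>Closure under gluing comes from the functor \<open>Glu\<close> and is added to the
  strict laws here, so that the well-definedness of composites is proved once for objects and
  arrows.\<close>

locale closed_nfold_laws = strict_nfold_laws +
  assumes c_closed: "\<lbrakk>I \<subseteq> {1..n}; i \<in> I; x \<in> X I; y \<in> X I; t I i x = s I i y\<rbrakk> \<Longrightarrow> c I i x y \<in> X I"
begin

text \<open>By the strict laws, a face of a composite is the composite of the faces, or the face of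
  one factor for the direction of the cut. So equal faces of schemes give equal faces of values,
  which is what makes each \<open>Glue\<close> in a tiling defined.\<close>

lemma eval_tiling:
  assumes K: "K \<subseteq> {1..n}"
  shows "tiling K lo hi T \<Longrightarrow> grid K (X K) (s K) (t K) lo hi Y \<Longrightarrow> eval (c K) T Y \<in> X K" (is "_ \<Longrightarrow> PROP ?closed")
    and "\<lbrakk>tiling K lo (hi(l := b)) F; tiling K (lo(l := b)) hi G; bounds K lo hi; l \<in> K; lo l < b; b < hi l;
      tgt_face l F = src_face l G; grid K (X K) (s K) (t K) lo hi Y\<rbrakk> \<Longrightarrow>
      t K l (eval (c K) F Y) = s K l (eval (c K) G Y)"
proof -
  let ?g = "\<lambda>lo hi. grid K (X K) (s K) (t K) lo hi Y"
  let ?P = "\<lambda>lo hi T. ?g lo hi \<longrightarrow> eval (c K) T Y \<in> X K"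
  let ?Q = "\<lambda>l b lo hi F G. ?g lo hi \<longrightarrow> t K l (eval (c K) F Y) = s K l (eval (c K) G Y)"
  have Block: "?P lo hi (Block lo)" for lo hi
    by (auto simp: grid_def lo_in_box)
  have Glue: "?P lo hi (Glue i F G)" if "i \<in> K" "lo i < a" "a < hi i" "?P lo (hi(i := a)) F"
    "?P (lo(i := a)) hi G" "?Q i a lo hi F G" for lo hi i a F G
    using that K by (auto intro!: c_closed intro: grid_hi grid_lo)
  have QBlock: "?Q l (Suc (lo l)) lo hi (Block lo) (Block (lo(l := Suc (lo l))))"
    if "l \<in> K" "hi l = Suc (Suc (lo l))" for lo hi l
  proof
    assume g: "?g lo hi"
    then have "lo \<in> box K lo hi"
      by (simp add: grid_def lo_in_box)
    moreover from this have "lo(l := Suc (lo l)) \<in> box K lo hi"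
      using that by (auto simp: box_iff extensional_def fun_upd_apply)
    ultimately show "t K l (eval (c K) (Block lo) Y) = s K l (eval (c K) (Block (lo(l := Suc (lo l)))) Y)"
      using g that by (simp add: grid_def matching_def)
  qed
  have QLeft: "?Q l b lo hi (Glue l F F') G"
    if "l \<in> K" "lo l < a" "a < b" "b < hi l" "?P lo (hi(l := a)) F" "?P (lo(l := a)) (hi(l := b)) F'"
      "?Q l a lo (hi(l := b)) F F'" "?Q l b (lo(l := a)) hi F' G" for lo hi l a b F F' G
  proof
    assume g: "?g lo hi"
    have "?g lo (hi(l := b))" "?g (lo(l := a)) hi"
      using g that by (auto intro: grid_hi grid_lo)
    moreover from this have "?g lo (hi(l := a))" "?g (lo(l := a)) (hi(l := b))"
      using that grid_hi[of K _ _ _ lo "hi(l := b)" Y l a] grid_hi[of K _ _ _ "lo(l := a)" hi Y l b] by auto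
    ultimately show "t K l (eval (c K) (Glue l F F') Y) = s K l (eval (c K) G Y)"
      using that K by (simp add: t_c)
  qed
  have QRight: "?Q l b lo hi F (Glue l G G')"
    if "l \<in> K" "lo l < b" "b < a" "a < hi l" "?P (lo(l := b)) (hi(l := a)) G" "?P (lo(l := a)) hi G'"
      "?Q l b lo (hi(l := a)) F G" "?Q l a (lo(l := b)) hi G G'" for lo hi l a b F G G'
  proof
    assume g: "?g lo hi"
    have "?g lo (hi(l := a))" "?g (lo(l := b)) hi"
      using g that by (auto intro: grid_hi grid_lo)
    moreover from this have "?g (lo(l := a)) hi" "?g (lo(l := b)) (hi(l := a))"
      using that grid_lo[of K _ _ _ "lo(l := b)" hi Y l a] grid_hi[of K _ _ _ "lo(l := b)" hi Y l a] by auto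
    ultimately show "t K l (eval (c K) F Y) = s K l (eval (c K) (Glue l G G') Y)"
      using that K by (simp add: s_c)
  qed
  have QCross: "?Q l b lo hi (Glue j F F') (Glue j G G')"
    if *: "l \<in> K" "lo l < b" "b < hi l" "j \<in> K" "j \<noteq> l" "lo j < a" "a < hi j"
      "?P lo (hi(l := b, j := a)) F" "?P (lo(j := a)) (hi(l := b)) F'"
      "?P (lo(l := b)) (hi(j := a)) G" "?P (lo(l := b, j := a)) hi G'"
      "?Q j a lo (hi(l := b)) F F'" "?Q j a (lo(l := b)) hi G G'"
      "?Q l b lo (hi(j := a)) F G" "?Q l b (lo(j := a)) hi F' G'" for lo hi l b j a F F' G G'
  proof
    assume g: "?g lo hi"
    have 1: "?g lo (hi(l := b))" "?g (lo(l := b)) hi" "?g lo (hi(j := a))" "?g (lo(j := a)) hi"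
      using grid_hi[OF g *(1-3)] grid_lo[OF g *(1-3)] grid_hi[OF g *(4,6,7)] grid_lo[OF g *(4,6,7)]
      by simp_all
    have 2: "?g lo (hi(l := b, j := a))" "?g (lo(j := a)) (hi(l := b))"
      "?g (lo(l := b)) (hi(j := a))" "?g (lo(l := b, j := a)) hi"
      using grid_hi[OF 1(1), of j a] grid_hi[OF 1(4), of l b] grid_hi[OF 1(2), of j a]
        grid_lo[OF 1(2), of j a] *(1-7) by simp_all
    show "t K l (eval (c K) (Glue j F F') Y) = s K l (eval (c K) (Glue j G G') Y)"
      using that K 1 2 by (simp add: s_c' t_c')
  qed
  show "eval (c K) T Y \<in> X K" if "tiling K lo hi T" "?g lo hi"
  proof -
    have "?P lo hi T"
      by (rule tiling_pair_induct(1)[of K ?P ?Q], rule Block, (rule Glue; assumption),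
        (rule QBlock; assumption), (rule QLeft; assumption), (rule QRight; assumption),
        (rule QCross; assumption), (rule that)+)
    then show ?thesis
      using that by blast
  qed
  show "t K l (eval (c K) F Y) = s K l (eval (c K) G Y)"
    if "tiling K lo (hi(l := b)) F" "tiling K (lo(l := b)) hi G" "bounds K lo hi" "l \<in> K" "lo l < b"
      "b < hi l" "tgt_face l F = src_face l G" "?g lo hi"
  proof -
    have "?Q l b lo hi F G"
      by (rule tiling_pair_induct(2)[of K ?P ?Q], rule Block, (rule Glue; assumption),
        (rule QBlock; assumption), (rule QLeft; assumption), (rule QRight; assumption),
        (rule QCross; assumption), (rule that)+)
    then show ?thesis
      using that by blast
  qed
qed

end

section \<open>Gluing in the category of a fixed cube\<close>

lemma (in category) inverse_arrows_unique:
  assumes "inverse_arrows C f g" "inverse_arrows C f g'"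
  shows "g' = g"
proof -
  have "g' = Cmp C (Cmp C g f) g'"
    using assms cmp_idt_left[of g'] by (simp add: inverse_arrows_def)
  also have "\<dots> = Cmp C g (Cmp C f g')"
    using assms cmp_assoc[of g' f g] by (simp add: inverse_arrows_def)
  also have "\<dots> = g"
    using assms cmp_idt_right[of g] by (simp add: inverse_arrows_def)
  finally show ?thesis .
qed

lemma functor_inverse:
  assumes "is_functor C D F" "inverse_arrows C f g"
  shows "inverse_arrows D (on_arr F f) (on_arr F g)"
proof -
  interpret is_functor C D F
    by (rule assms(1))
  interpret C: category C
    by (rule source_category)
  have f: "f \<in> Arr C" and g: "g \<in> Arr C" and gf: "Dom C g = Cod C f" "Cod C g = Dom C f"
    using assms(2) by (auto simp: inverse_arrows_def)
  show ?thesis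
    unfolding inverse_arrows_def
    using assms(2) f g gf on_arr_cmp[OF f g] on_arr_cmp[OF g f] on_arr_idt C.dom_obj C.cod_obj
    by (auto simp: inverse_arrows_def on_arr dom_on_arr cod_on_arr)
qed

locale cube_category = pseudo_nfold_category n P for n and P :: "('o, 'a) nfold" +
  fixes K :: "nat set"
  assumes K: "K \<subseteq> {1..n}"
begin

abbreviation "M \<equiv> Mor P K"
abbreviation "Ob \<equiv> Obj M"
abbreviation "\<iota> \<equiv> Idt M"
abbreviation cmp (infixr "\<cdot>" 65) where "g \<cdot> f \<equiv> Cmp M g f"
abbreviation glue_obj ("(_ \<otimes>\<^sub>_ _)" [71, 1000, 71] 70) where "x \<otimes>\<^sub>i y \<equiv> co P K i x y"
abbreviation glue_arr ("(_ \<odot>\<^sub>_ _)" [71, 1000, 71] 70) where "f \<odot>\<^sub>i g \<equiv> ca P K i f g"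
abbreviation "\<alpha> i x y z \<equiv> Assoc P K i (x, y, z)"
abbreviation "\<beta> i j x y x' y' \<equiv> Intch P K i j (x, y, x', y')"

definition hom :: "'a \<Rightarrow> 'o \<Rightarrow> 'o \<Rightarrow> bool" where
  "hom f x y \<longleftrightarrow> f \<in> Arr M \<and> Dom M f = x \<and> Cod M f = y"

text \<open>With membership in \<open>K\<close> and in the carriers included, one such fact
  discharges all side conditions of a gluing.\<close>

definition oadj :: "nat \<Rightarrow> 'o \<Rightarrow> 'o \<Rightarrow> bool" where
  "oadj i x y \<longleftrightarrow> i \<in> K \<and> x \<in> Ob \<and> y \<in> Ob \<and> to P K i x = so P K i y"

definition adj :: "nat \<Rightarrow> 'a \<Rightarrow> 'a \<Rightarrow> bool" where
  "adj i f g \<longleftrightarrow> i \<in> K \<and> f \<in> Arr M \<and> g \<in> Arr M \<and> ta P K i f = sa P K i g"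

text \<open>\<open>\<alpha>\<^sub>i\<close>, \<open>\<beta>\<^sub>i\<^sub>j\<close> and \<open>\<beta>\<^sub>j\<^sub>i\<close> are rigid in direction \<open>i\<close>, so they can be glued along \<open>i\<close> with identities.\<close>

definition rigid :: "nat \<Rightarrow> 'a \<Rightarrow> bool" where
  "rigid i f \<longleftrightarrow> i \<in> K \<and> f \<in> Arr M \<and>
     sa P K i f = Idt (Mor P (K - {i})) (so P K i (Dom M f)) \<and>
     ta P K i f = Idt (Mor P (K - {i})) (to P K i (Dom M f))"

definition iso :: "'a \<Rightarrow> bool" where
  "iso f \<longleftrightarrow> (\<exists>g. inverse_arrows M f g)"

sublocale M: category M
  using mor_category K by blast

lemma face_category: "category (Mor P (K - {i}))"
  using mor_category K by blast

lemma src: "i \<in> K \<Longrightarrow> is_functor M (Mor P (K - {i})) (Src P K i)"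
  using src_functor K by blast

lemma tgt: "i \<in> K \<Longrightarrow> is_functor M (Mor P (K - {i})) (Tgt P K i)"
  using tgt_functor K by blast

lemma hom_obj: "hom f x y \<Longrightarrow> x \<in> Ob" "hom f x y \<Longrightarrow> y \<in> Ob"
  by (auto simp: hom_def M.dom_obj M.cod_obj)

lemma hom_id: "x \<in> Ob \<Longrightarrow> hom (\<iota> x) x x"
  by (simp add: hom_def M.idt_arr M.dom_idt M.cod_idt)

lemma hom_cmp: "hom f x y \<Longrightarrow> hom g y z \<Longrightarrow> hom (g \<cdot> f) x z"
  by (simp add: hom_def M.cmp_arr M.dom_cmp M.cod_cmp)

lemma cmp_id_left: "hom f x y \<Longrightarrow> \<iota> y \<cdot> f = f"
  using M.cmp_idt_left by (auto simp: hom_def)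

lemma cmp_id_right: "hom f x y \<Longrightarrow> f \<cdot> \<iota> x = f"
  using M.cmp_idt_right by (auto simp: hom_def)

lemma assoc: "hom f x y \<Longrightarrow> hom g y z \<Longrightarrow> hom h z w \<Longrightarrow> (h \<cdot> g) \<cdot> f = h \<cdot> g \<cdot> f"
  by (auto simp: hom_def M.cmp_assoc)

lemma adj_dom: "adj i f g \<Longrightarrow> hom f x y \<Longrightarrow> hom g x' y' \<Longrightarrow> oadj i x x'"
  unfolding adj_def hom_def oadj_def
  using is_functor.dom_on_arr[OF src, of i g] is_functor.dom_on_arr[OF tgt, of i f]
  by (auto simp: M.dom_obj)

lemma adj_cod: "adj i f g \<Longrightarrow> hom f x y \<Longrightarrow> hom g x' y' \<Longrightarrow> oadj i y y'"
  unfolding adj_def hom_def oadj_def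
  using is_functor.cod_on_arr[OF src, of i g] is_functor.cod_on_arr[OF tgt, of i f]
  by (auto simp: M.cod_obj)

lemma adj_id: "oadj i x y \<Longrightarrow> adj i (\<iota> x) (\<iota> y)"
  unfolding adj_def oadj_def
  by (simp add: M.idt_arr is_functor.on_arr_idt[OF src] is_functor.on_arr_idt[OF tgt])

lemma ta_cmp: "i \<in> K \<Longrightarrow> hom f x y \<Longrightarrow> hom g y z \<Longrightarrow>
    ta P K i (g \<cdot> f) = Cmp (Mor P (K - {i})) (ta P K i g) (ta P K i f)"
  by (simp add: hom_def is_functor.on_arr_cmp[OF tgt])

lemma sa_cmp: "i \<in> K \<Longrightarrow> hom f x y \<Longrightarrow> hom g y z \<Longrightarrow>
    sa P K i (g \<cdot> f) = Cmp (Mor P (K - {i})) (sa P K i g) (sa P K i f)"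
  by (simp add: hom_def is_functor.on_arr_cmp[OF src])

lemma adj_cmp:
  assumes "hom f x y" "hom f' y z" "hom g x' y'" "hom g' y' z'" "adj i f g" "adj i f' g'"
  shows "adj i (f' \<cdot> f) (g' \<cdot> g)"
proof -
  have "i \<in> K"
    using assms(5) by (simp add: adj_def)
  then show ?thesis
    using assms hom_cmp[OF assms(1,2)] hom_cmp[OF assms(3,4)]
      ta_cmp[OF _ assms(1,2)] sa_cmp[OF _ assms(3,4)]
    by (auto simp: adj_def hom_def)
qed

lemma pairs_Arr: "i \<in> K \<Longrightarrow> (f, g) \<in> Arr (pairs P K i) \<longleftrightarrow> adj i f g"
  by (auto simp: pairs_def sub_cat_def prod_cat_def pair_set_def adj_def)

lemma pairs_Obj: "i \<in> K \<Longrightarrow> (x, y) \<in> Obj (pairs P K i) \<longleftrightarrow> oadj i x y"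
  by (auto simp: pairs_def sub_cat_def prod_cat_def pair_set_def oadj_def)

lemma pairs_sel [simp]:
  "Dom (pairs P K i) (f, g) = (Dom M f, Dom M g)" "Cod (pairs P K i) (f, g) = (Cod M f, Cod M g)"
  "Idt (pairs P K i) (x, y) = (\<iota> x, \<iota> y)" "Cmp (pairs P K i) (f', g') (f, g) = (f' \<cdot> f, g' \<cdot> g)"
  by (simp_all add: pairs_def sub_cat_def prod_cat_def)

lemma adj_K: "adj i f g \<Longrightarrow> i \<in> K"
  by (simp add: adj_def)

lemma oadj_K: "oadj i f g \<Longrightarrow> i \<in> K"
  by (simp add: oadj_def)

lemma glu: "i \<in> K \<Longrightarrow> is_functor (pairs P K i) M (Glu P K i)"
  using glu_functor K by blast

lemma obj_glue: "oadj i x y \<Longrightarrow> x \<otimes>\<^sub>i y \<in> Ob"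
  using is_functor.on_obj[OF glu] pairs_Obj oadj_K by metis

lemma hom_glue: "hom f x y \<Longrightarrow> hom g x' y' \<Longrightarrow> adj i f g \<Longrightarrow> hom (f \<odot>\<^sub>i g) (x \<otimes>\<^sub>i x') (y \<otimes>\<^sub>i y')"
  using is_functor.on_arr[OF glu, of i "(f, g)"] is_functor.dom_on_arr[OF glu, of i "(f, g)"]
    is_functor.cod_on_arr[OF glu, of i "(f, g)"] adj_K[of i f g]
  by (auto simp: hom_def pairs_Arr)

lemma glue_id: "oadj i x y \<Longrightarrow> \<iota> x \<odot>\<^sub>i \<iota> y = \<iota> (x \<otimes>\<^sub>i y)"
  using is_functor.on_arr_idt[OF glu, of i "(x, y)"] pairs_Obj[of i x y] oadj_K by auto

lemma interchange:
  assumes "hom f x y" "hom f' y z" "hom g x' y'" "hom g' y' z'" "adj i f g" "adj i f' g'"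
  shows "(f' \<cdot> f) \<odot>\<^sub>i (g' \<cdot> g) = (f' \<odot>\<^sub>i g') \<cdot> (f \<odot>\<^sub>i g)"
  using is_functor.on_arr_cmp[OF glu, of i "(f, g)" "(f', g')"] assms adj_K[OF assms(5)]
  by (simp add: hom_def pairs_Arr)

lemma laws_obj: "closed_nfold_laws n (\<lambda>I. Obj (Mor P I)) (so P) (to P) (eo P) (co P)"
proof (intro closed_nfold_laws.intro strict_obj closed_nfold_laws_axioms.intro)
  fix I i x y assume *: "I \<subseteq> {1..n}" "i \<in> I" "x \<in> Obj (Mor P I)" "y \<in> Obj (Mor P I)" "to P I i x = so P I i y"
  then have "(x, y) \<in> Obj (pairs P I i)"
    by (simp add: pairs_def sub_cat_def prod_cat_def pair_set_def)
  then show "co P I i x y \<in> Obj (Mor P I)"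
    using is_functor.on_obj[OF glu_functor] * by blast
qed

lemma laws_arr: "closed_nfold_laws n (\<lambda>I. Arr (Mor P I)) (sa P) (ta P) (ea P) (ca P)"
proof (intro closed_nfold_laws.intro strict_arr closed_nfold_laws_axioms.intro)
  fix I i x y assume *: "I \<subseteq> {1..n}" "i \<in> I" "x \<in> Arr (Mor P I)" "y \<in> Arr (Mor P I)" "ta P I i x = sa P I i y"
  then have "(x, y) \<in> Arr (pairs P I i)"
    by (simp add: pairs_def sub_cat_def prod_cat_def pair_set_def)
  then show "ca P I i x y \<in> Arr (Mor P I)"
    using is_functor.on_arr[OF glu_functor] * by blast
qed

sublocale obj: closed_nfold_laws n "\<lambda>I. Obj (Mor P I)" "so P" "to P" "eo P" "co P"
  by (rule laws_obj)

sublocale arr: closed_nfold_laws n "\<lambda>I. Arr (Mor P I)" "sa P" "ta P" "ea P" "ca P"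
  by (rule laws_arr)

lemma adj_left: "adj i f g \<Longrightarrow> adj i g h \<Longrightarrow> adj i (f \<odot>\<^sub>i g) h"
  using K by (simp add: adj_def arr.t_c arr.c_closed)

lemma adj_right: "adj i f g \<Longrightarrow> adj i g h \<Longrightarrow> adj i f (g \<odot>\<^sub>i h)"
  using K by (simp add: adj_def arr.s_c arr.c_closed)

text \<open>The faces of both composites along \<open>j\<close> are glued from the faces of their
  factors, and these agree one by one.\<close>

lemma adj_cross: "i \<noteq> j \<Longrightarrow> adj i f g \<Longrightarrow> adj i f' g' \<Longrightarrow> adj j f f' \<Longrightarrow> adj j g g' \<Longrightarrow>
    adj j (f \<odot>\<^sub>i g) (f' \<odot>\<^sub>i g')"
  using K by (simp add: adj_def arr.s_c' arr.t_c' arr.c_closed)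

lemma oadj_left: "oadj i x y \<Longrightarrow> oadj i y z \<Longrightarrow> oadj i (x \<otimes>\<^sub>i y) z"
  using K by (simp add: oadj_def obj.t_c obj.c_closed)

lemma oadj_right: "oadj i x y \<Longrightarrow> oadj i y z \<Longrightarrow> oadj i x (y \<otimes>\<^sub>i z)"
  using K by (simp add: oadj_def obj.s_c obj.c_closed)

lemma oadj_cross: "i \<noteq> j \<Longrightarrow> oadj i x y \<Longrightarrow> oadj i x' y' \<Longrightarrow> oadj j x x' \<Longrightarrow> oadj j y y' \<Longrightarrow>
    oadj j (x \<otimes>\<^sub>i y) (x' \<otimes>\<^sub>i y')"
  using K by (simp add: oadj_def obj.s_c' obj.t_c' obj.c_closed)

lemma triples_Obj: "i \<in> K \<Longrightarrow> (x, y, z) \<in> Obj (triples P K i) \<longleftrightarrow> oadj i x y \<and> oadj i y z"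
  by (auto simp: triples_def sub_cat_def prod_cat_def triple_set_def oadj_def)

lemma triples_Arr: "i \<in> K \<Longrightarrow> (f, g, h) \<in> Arr (triples P K i) \<longleftrightarrow> adj i f g \<and> adj i g h"
  by (auto simp: triples_def sub_cat_def prod_cat_def triple_set_def adj_def)

lemma quads_Obj: "i \<in> K \<Longrightarrow> j \<in> K \<Longrightarrow>
    (x, y, x', y') \<in> Obj (quads P K i j) \<longleftrightarrow> oadj i x y \<and> oadj i x' y' \<and> oadj j x x' \<and> oadj j y y'"
  by (auto simp: quads_def sub_cat_def prod_cat_def quad_set_def oadj_def)

lemma quads_Arr: "i \<in> K \<Longrightarrow> j \<in> K \<Longrightarrow>
    (f, g, f', g') \<in> Arr (quads P K i j) \<longleftrightarrow> adj i f g \<and> adj i f' g' \<and> adj j f f' \<and> adj j g g'"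
  by (auto simp: quads_def sub_cat_def prod_cat_def quad_set_def adj_def)

lemma hom_assoc:
  assumes "oadj i x y" "oadj i y z"
  shows "hom (\<alpha> i x y z) ((x \<otimes>\<^sub>i y) \<otimes>\<^sub>i z) (x \<otimes>\<^sub>i (y \<otimes>\<^sub>i z))" and "iso (\<alpha> i x y z)"
proof -
  have i: "i \<in> K" "(x, y, z) \<in> Obj (triples P K i)"
    using assms oadj_K triples_Obj by blast+
  note nat = assoc_natural[OF K i(1)]
  show "hom (\<alpha> i x y z) ((x \<otimes>\<^sub>i y) \<otimes>\<^sub>i z) (x \<otimes>\<^sub>i (y \<otimes>\<^sub>i z))"
    using natural_iso.component[OF nat i(2)] natural_iso.dom_component[OF nat i(2)]
      natural_iso.cod_component[OF nat i(2)]
    by (simp add: hom_def assoc_left_def assoc_right_def)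
  show "iso (\<alpha> i x y z)"
    using natural_iso.component_iso[OF nat i(2)] by (simp add: iso_def)
qed

lemma hom_intch:
  assumes "i \<noteq> j" "oadj i x y" "oadj i x' y'" "oadj j x x'" "oadj j y y'"
  shows "hom (\<beta> i j x y x' y') ((x \<otimes>\<^sub>i y) \<otimes>\<^sub>j (x' \<otimes>\<^sub>i y')) ((x \<otimes>\<^sub>j x') \<otimes>\<^sub>i (y \<otimes>\<^sub>j y'))"
    and "iso (\<beta> i j x y x' y')"
proof -
  have i: "i \<in> K" "j \<in> K" "(x, y, x', y') \<in> Obj (quads P K i j)"
    using assms oadj_K quads_Obj by blast+
  note nat = intch_natural[OF K i(1,2) assms(1)]
  show "hom (\<beta> i j x y x' y') ((x \<otimes>\<^sub>i y) \<otimes>\<^sub>j (x' \<otimes>\<^sub>i y')) ((x \<otimes>\<^sub>j x') \<otimes>\<^sub>i (y \<otimes>\<^sub>j y'))"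
    using natural_iso.component[OF nat i(3)] natural_iso.dom_component[OF nat i(3)]
      natural_iso.cod_component[OF nat i(3)]
    by (simp add: hom_def intch_left_def intch_right_def)
  show "iso (\<beta> i j x y x' y')"
    using natural_iso.component_iso[OF nat i(3)] by (simp add: iso_def)
qed

lemma intch_swap:
  assumes "i \<noteq> j" "oadj i x y" "oadj i x' y'" "oadj j x x'" "oadj j y y'"
  shows "\<beta> i j x y x' y' \<cdot> \<beta> j i x x' y y' = \<iota> ((x \<otimes>\<^sub>j x') \<otimes>\<^sub>i (y \<otimes>\<^sub>j y'))"
proof -
  have i: "i \<in> K" "j \<in> K" "(x, y, x', y') \<in> Obj (quads P K i j)"
    using assms oadj_K quads_Obj by blast+
  show ?thesis
    using intch_inverse[OF K i(1,2) assms(1) i(3)] hom_intch(1)[OF assms]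
    by (simp add: inverse_arrows_def hom_def)
qed

lemma assoc_nat:
  assumes "hom f x x'" "hom g y y'" "hom h z z'" "adj i f g" "adj i g h"
  shows "\<alpha> i x' y' z' \<cdot> ((f \<odot>\<^sub>i g) \<odot>\<^sub>i h) = (f \<odot>\<^sub>i (g \<odot>\<^sub>i h)) \<cdot> \<alpha> i x y z"
proof -
  have i: "i \<in> K" "(f, g, h) \<in> Arr (triples P K i)"
    using assms adj_K triples_Arr by blast+
  have "Dom (triples P K i) (f, g, h) = (x, y, z)" "Cod (triples P K i) (f, g, h) = (x', y', z')"
    using assms by (simp_all add: triples_def sub_cat_def prod_cat_def hom_def)
  then show ?thesis
    using natural_iso.naturality[OF assoc_natural[OF K i(1)] i(2)]
    by (simp add: assoc_left_def assoc_right_def)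
qed

lemma intch_nat:
  assumes "i \<noteq> j" "hom f x u" "hom g y v" "hom f' x' u'" "hom g' y' v'"
    "adj i f g" "adj i f' g'" "adj j f f'" "adj j g g'"
  shows "\<beta> i j u v u' v' \<cdot> ((f \<odot>\<^sub>i g) \<odot>\<^sub>j (f' \<odot>\<^sub>i g')) = ((f \<odot>\<^sub>j f') \<odot>\<^sub>i (g \<odot>\<^sub>j g')) \<cdot> \<beta> i j x y x' y'"
proof -
  have i: "i \<in> K" "j \<in> K" "(f, g, f', g') \<in> Arr (quads P K i j)"
    using assms adj_K quads_Arr by blast+
  have "Dom (quads P K i j) (f, g, f', g') = (x, y, x', y')" "Cod (quads P K i j) (f, g, f', g') = (u, v, u', v')"
    using assms by (simp_all add: quads_def sub_cat_def prod_cat_def hom_def)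
  then show ?thesis
    using natural_iso.naturality[OF intch_natural[OF K i(1,2) assms(1)] i(3)]
    by (simp add: intch_left_def intch_right_def)
qed

text \<open>Both faces along \<open>l\<close> are the component of the associator of
  \<open>K - {l}\<close> at the common faces of the objects.\<close>

lemma adj_assoc:
  assumes "i \<noteq> l" "oadj i x y" "oadj i y z" "oadj i x' y'" "oadj i y' z'"
    "oadj l x x'" "oadj l y y'" "oadj l z z'"
  shows "adj l (\<alpha> i x y z) (\<alpha> i x' y' z')"
proof -
  have i: "i \<in> K" "l \<in> K" "(x, y, z) \<in> Obj (triples P K i)" "(x', y', z') \<in> Obj (triples P K i)"
    using assms oadj_K triples_Obj by blast+
  show ?thesis
    unfolding adj_def
    using i assms hom_assoc(1)[of i x y z] hom_assoc(1)[of i x' y' z']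
      tgt_assoc[OF K i(1,2) _ i(3)] src_assoc[OF K i(1,2) _ i(4)]
    by (auto simp: hom_def oadj_def)
qed

text \<open>The reason is that of \<open>adj_assoc\<close>. This is the matching that allows
  interchangers to be glued along a third direction, as in the second hexagon.\<close>

lemma adj_intch:
  assumes "i \<noteq> j" "i \<noteq> l" "j \<noteq> l" "oadj i x y" "oadj i x' y'" "oadj j x x'" "oadj j y y'"
    "oadj i u v" "oadj i u' v'" "oadj j u u'" "oadj j v v'"
    "oadj l x u" "oadj l y v" "oadj l x' u'" "oadj l y' v'"
  shows "adj l (\<beta> i j x y x' y') (\<beta> i j u v u' v')"
proof -
  have i: "i \<in> K" "j \<in> K" "l \<in> K" "(x, y, x', y') \<in> Obj (quads P K i j)" "(u, v, u', v') \<in> Obj (quads P K i j)"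
    using assms oadj_K quads_Obj by blast+
  show ?thesis
    unfolding adj_def
    using i assms hom_intch(1)[of i j x y x' y'] hom_intch(1)[of i j u v u' v']
      tgt_intch[OF K i(1,2) _ i(3) _ _ i(4)] src_intch[OF K i(1,2) _ i(3) _ _ i(5)]
    by (auto simp: hom_def oadj_def)
qed

section \<open>Rigid arrows\<close>

text \<open>The face of \<open>f\<close> is an identity, so the faces of \<open>x\<close> and
  \<open>y\<close>, which are its domain and codomain, coincide.\<close>

lemma rigid_cod:
  assumes "rigid i f" "hom f x y"
  shows "so P K i y = so P K i x" "to P K i y = to P K i x"
proof -
  have i: "i \<in> K" and f: "f \<in> Arr M"
    using assms by (auto simp: rigid_def)
  interpret F: category "Mor P (K - {i})"
    by (rule face_category)
  have xy: "x \<in> Ob" "y \<in> Ob"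
    using assms hom_obj by auto
  show "so P K i y = so P K i x"
    using is_functor.cod_on_arr[OF src[OF i] f] is_functor.on_obj[OF src[OF i] xy(1)] assms
    by (simp add: rigid_def hom_def F.cod_idt)
  show "to P K i y = to P K i x"
    using is_functor.cod_on_arr[OF tgt[OF i] f] is_functor.on_obj[OF tgt[OF i] xy(1)] assms
    by (simp add: rigid_def hom_def F.cod_idt)
qed

lemma adj_rigid: "rigid i f \<Longrightarrow> rigid i g \<Longrightarrow> hom f x y \<Longrightarrow> hom g x' y' \<Longrightarrow> oadj i x x' \<Longrightarrow> adj i f g"
  by (simp add: rigid_def adj_def hom_def oadj_def)

lemma rigid_id: "i \<in> K \<Longrightarrow> x \<in> Ob \<Longrightarrow> rigid i (\<iota> x)"
  by (simp add: rigid_def M.idt_arr M.dom_idt is_functor.on_arr_idt[OF src] is_functor.on_arr_idt[OF tgt])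

lemma rigid_cmp:
  assumes "rigid i f" "rigid i g" "hom f x y" "hom g y z"
  shows "rigid i (g \<cdot> f)"
proof -
  have i: "i \<in> K"
    using assms by (auto simp: rigid_def)
  interpret F: category "Mor P (K - {i})"
    by (rule face_category)
  have x: "so P K i x \<in> Obj (Mor P (K - {i}))" "to P K i x \<in> Obj (Mor P (K - {i}))"
    using is_functor.on_obj[OF src[OF i]] is_functor.on_obj[OF tgt[OF i]] hom_obj[OF assms(3)] by auto
  have id: "Cmp (Mor P (K - {i})) (Idt (Mor P (K - {i})) w) (Idt (Mor P (K - {i})) w) = Idt (Mor P (K - {i})) w"
    if "w \<in> Obj (Mor P (K - {i}))" for w
    using F.cmp_idt_left[OF F.idt_arr[OF that]] F.cod_idt[OF that] by simp
  show ?thesis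
    using assms hom_cmp[OF assms(3,4)] ta_cmp[OF i assms(3,4)] sa_cmp[OF i assms(3,4)] rigid_cod[OF assms(1,3)]
    by (simp add: rigid_def hom_def id x)
qed

lemma rigid_glue: "rigid i f \<Longrightarrow> rigid i g \<Longrightarrow> hom f x y \<Longrightarrow> hom g x' y' \<Longrightarrow> oadj i x x' \<Longrightarrow> rigid i (f \<odot>\<^sub>i g)"
  using adj_rigid[of i f g x y x' y'] hom_glue[of f x y g x' y' i] K
  by (simp add: rigid_def adj_def hom_def oadj_def arr.t_c arr.s_c obj.t_c obj.s_c)

text \<open>Functoriality of gluing in the face category. It makes gluing along \<open>j\<close>
  preserve rigidity along another direction \<open>i\<close>.\<close>

lemma face_glue_id:
  assumes "i \<noteq> j" "oadj j x x'" "i \<in> K"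
  shows "ca P (K - {i}) j (Idt (Mor P (K - {i})) (so P K i x)) (Idt (Mor P (K - {i})) (so P K i x'))
      = Idt (Mor P (K - {i})) (so P K i (x \<otimes>\<^sub>j x'))"
    "ca P (K - {i}) j (Idt (Mor P (K - {i})) (to P K i x)) (Idt (Mor P (K - {i})) (to P K i x'))
      = Idt (Mor P (K - {i})) (to P K i (x \<otimes>\<^sub>j x'))"
proof -
  have sq: "j \<in> K - {i}" "K - {i} \<subseteq> {1..n}" "x \<in> Ob" "x' \<in> Ob"
    using assms K by (auto simp: oadj_def)
  note glu_face = glu_functor[OF sq(2,1)]
  \<comment> \<open>The faces of \<open>x\<close> and \<open>x'\<close> along \<open>i\<close> match
    along \<open>j\<close> because iterated faces commute.\<close>
  have st: "so (P) (K - {i}) j (so P K i x') = so P (K - {j}) i (so P K j x')"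
      "so P (K - {i}) j (to P K i x') = to P (K - {j}) i (so P K j x')"
      "to P (K - {i}) j (so P K i x) = so P (K - {j}) i (to P K j x)"
      "to P (K - {i}) j (to P K i x) = to P (K - {j}) i (to P K j x)"
    using assms K sq obj.s_s[of K j i x'] obj.t_s[of K i j x'] obj.t_s[of K j i x] obj.t_t[of K j i x]
    by auto
  have mem: "(so P K i x, so P K i x') \<in> Obj (pairs P (K - {i}) j)"
    "(to P K i x, to P K i x') \<in> Obj (pairs P (K - {i}) j)"
    using assms sq st is_functor.on_obj[OF src[OF assms(3)]] is_functor.on_obj[OF tgt[OF assms(3)]]
    by (auto simp: pairs_def sub_cat_def prod_cat_def pair_set_def oadj_def)
  show "ca P (K - {i}) j (Idt (Mor P (K - {i})) (so P K i x)) (Idt (Mor P (K - {i})) (so P K i x'))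
      = Idt (Mor P (K - {i})) (so P K i (x \<otimes>\<^sub>j x'))"
    "ca P (K - {i}) j (Idt (Mor P (K - {i})) (to P K i x)) (Idt (Mor P (K - {i})) (to P K i x'))
      = Idt (Mor P (K - {i})) (to P K i (x \<otimes>\<^sub>j x'))"
    using is_functor.on_arr_idt[OF glu_face mem(1)] is_functor.on_arr_idt[OF glu_face mem(2)] assms K
    by (auto simp: pairs_def sub_cat_def prod_cat_def oadj_def obj.s_c' obj.t_c')
qed

lemma rigid_cross: "i \<noteq> j \<Longrightarrow> rigid i f \<Longrightarrow> rigid i g \<Longrightarrow> hom f x y \<Longrightarrow> hom g x' y' \<Longrightarrow> adj j f g \<Longrightarrow>
    rigid i (f \<odot>\<^sub>j g)"
  using adj_dom[of j f g x y x' y'] hom_glue[of f x y g x' y' j] face_glue_id[of i j x x'] K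
  by (simp add: rigid_def adj_def hom_def arr.t_c' arr.s_c')

lemma rigid_assoc: "oadj i x y \<Longrightarrow> oadj i y z \<Longrightarrow> rigid i (\<alpha> i x y z)"
  using hom_assoc(1)[of i x y z] src_assoc_same[OF K, of i x y z] tgt_assoc_same[OF K, of i x y z]
  by (auto simp: rigid_def hom_def triples_Obj oadj_K)

lemma rigid_intch:
  assumes "i \<noteq> j" "oadj i x y" "oadj i x' y'" "oadj j x x'" "oadj j y y'" "l = i \<or> l = j"
  shows "rigid l (\<beta> i j x y x' y')"
proof -
  have i: "i \<in> K" "j \<in> K" "l \<in> K" "l \<in> {i, j}" "(x, y, x', y') \<in> Obj (quads P K i j)"
    using assms oadj_K quads_Obj by blast+
  show ?thesis
    using i hom_intch(1)[OF assms(1-5)] src_intch_same[OF K i(1,2) assms(1) i(4,5)]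
      tgt_intch_same[OF K i(1,2) assms(1) i(4,5)]
    by (auto simp: rigid_def hom_def)
qed

section \<open>Isomorphisms and gluing of inverses\<close>

lemma iso_id: "x \<in> Ob \<Longrightarrow> iso (\<iota> x)"
  unfolding iso_def inverse_arrows_def
  using M.cmp_idt_left[of "\<iota> x"] by (intro exI[of _ "\<iota> x"]) (simp add: M.idt_arr M.dom_idt M.cod_idt)

lemma iso_cmp:
  assumes "iso f" "iso g" "hom f x y" "hom g y z"
  shows "iso (g \<cdot> f)"
proof -
  obtain f' g' where f': "hom f' y x" "f' \<cdot> f = \<iota> x" "f \<cdot> f' = \<iota> y"
    and g': "hom g' z y" "g' \<cdot> g = \<iota> y" "g \<cdot> g' = \<iota> z"
    using assms by (auto simp: iso_def inverse_arrows_def hom_def)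
  have "g' \<cdot> g \<cdot> f = f"
    using assoc[OF assms(3,4) g'(1)] g' assms(3) cmp_id_left by simp
  then have 1: "(f' \<cdot> g') \<cdot> g \<cdot> f = \<iota> x"
    using assoc[OF hom_cmp[OF assms(3,4)] g'(1) f'(1)] f' by simp
  have "f \<cdot> f' \<cdot> g' = g'"
    using assoc[OF g'(1) f'(1) assms(3)] f' g' cmp_id_left by simp
  then have 2: "(g \<cdot> f) \<cdot> f' \<cdot> g' = \<iota> z"
    using assoc[OF hom_cmp[OF g'(1) f'(1)] assms(3,4)] g' by simp
  show ?thesis
    unfolding iso_def inverse_arrows_def
    using 1 2 hom_cmp[OF assms(3,4)] hom_cmp[OF g'(1) f'(1)]
    by (intro exI[of _ "f' \<cdot> g'"]) (simp add: hom_def)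
qed

lemma inverse:
  assumes "iso f" "hom f x y"
  shows "inverse_arrows M f (inverse_arr M f)" "hom (inverse_arr M f) y x"
    "inverse_arr M f \<cdot> f = \<iota> x" "f \<cdot> inverse_arr M f = \<iota> y" "iso (inverse_arr M f)"
proof -
  obtain g where g: "inverse_arrows M f g"
    using assms by (auto simp: iso_def)
  then have "inverse_arr M f = g"
    unfolding inverse_arr_def using M.inverse_arrows_unique by blast
  then show inv: "inverse_arrows M f (inverse_arr M f)"
    using g by simp
  then show "hom (inverse_arr M f) y x"
    "inverse_arr M f \<cdot> f = \<iota> x" "f \<cdot> inverse_arr M f = \<iota> y" "iso (inverse_arr M f)"
    using assms(2) by (auto simp: inverse_arrows_def hom_def iso_def)
qed

text \<open>Face functors preserve inverses and inverses are unique, so the inverses of matching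
  isomorphisms match and can be glued.\<close>

lemma iso_glue:
  assumes "iso f" "iso g" "adj i f g"
  shows "adj i (inverse_arr M f) (inverse_arr M g)"
    and "inverse_arrows M (f \<odot>\<^sub>i g) (inverse_arr M f \<odot>\<^sub>i inverse_arr M g)"
    and "iso (f \<odot>\<^sub>i g)"
proof -
  have i: "i \<in> K"
    using assms adj_K by blast
  obtain x y x' y' where fg: "hom f x y" "hom g x' y'"
    using assms(3) by (auto simp: adj_def hom_def)
  note f = inverse[OF assms(1) fg(1)] and g = inverse[OF assms(2) fg(2)]
  show adj: "adj i (inverse_arr M f) (inverse_arr M g)"
    using category.inverse_arrows_unique[OF face_category functor_inverse[OF tgt[OF i] f(1)]]
      functor_inverse[OF src[OF i] g(1)] assms(3) f(2) g(2)
    by (auto simp: adj_def hom_def)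
  show inv: "inverse_arrows M (f \<odot>\<^sub>i g) (inverse_arr M f \<odot>\<^sub>i inverse_arr M g)"
    unfolding inverse_arrows_def
    using hom_glue[OF fg assms(3)] hom_glue[OF f(2) g(2) adj]
      interchange[OF fg(1) f(2) fg(2) g(2) assms(3) adj, symmetric]
      interchange[OF f(2) fg(1) g(2) fg(2) adj assms(3), symmetric]
      glue_id[OF adj_dom[OF assms(3) fg]] glue_id[OF adj_cod[OF assms(3) fg]] f(3,4) g(3,4)
    by (simp add: hom_def)
  then show "iso (f \<odot>\<^sub>i g)"
    by (auto simp: iso_def)
qed

lemma inverse_shift:
  assumes "iso f" "hom f x y" "hom h y z" "h \<cdot> f = k"
  shows "k \<cdot> inverse_arr M f = h"
  using assoc[OF inverse(2)[OF assms(1,2)] assms(2,3)] inverse(4)[OF assms(1,2)] cmp_id_right[OF assms(3)] assms(4)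
  by simp

text \<open>The common shape of the four pasting lemmas: the outer rectangle of a diagram with four cells.\<close>

lemma paste:
  assumes "hom D a b" "hom C b c" "hom B c d" "hom A d w" "hom F b e" "hom E e d"
    "hom N e g" "hom L g h" "hom G h w" "hom X a k" "hom Q k g" "hom U k l" "hom S l h"
    and eqs: "B \<cdot> C = E \<cdot> F" "A \<cdot> E = G \<cdot> L \<cdot> N" "N \<cdot> F \<cdot> D = Q \<cdot> X" "S \<cdot> U = L \<cdot> Q"
  shows "(A \<cdot> B) \<cdot> C \<cdot> D = (G \<cdot> S) \<cdot> U \<cdot> X"
proof -
  have "(A \<cdot> B) \<cdot> C \<cdot> D = A \<cdot> (B \<cdot> C) \<cdot> D"
    using assoc[OF hom_cmp[OF assms(1,2)] assms(3,4)] assoc[OF assms(1-3)] by simp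
  also have "\<dots> = (A \<cdot> E) \<cdot> F \<cdot> D"
    using assoc[OF hom_cmp[OF assms(1,5)] assms(6,4)] assoc[OF assms(1,5,6)] eqs by simp
  also have "\<dots> = G \<cdot> L \<cdot> (N \<cdot> F \<cdot> D)"
    using assoc[OF hom_cmp[OF hom_cmp[OF assms(1,5)] assms(7)] assms(8,9)]
      assoc[OF hom_cmp[OF assms(1,5)] assms(7) hom_cmp[OF assms(8,9)]]
      assoc[OF assms(7-9)] eqs by simp
  also have "\<dots> = G \<cdot> (S \<cdot> U) \<cdot> X"
    using assoc[OF assms(10,11,8)] eqs by simp
  also have "\<dots> = (G \<cdot> S) \<cdot> U \<cdot> X"
    using assoc[OF assms(10,12,13)] assoc[OF hom_cmp[OF assms(10,12)] assms(13,9)] by simp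
  finally show ?thesis .
qed

section \<open>Pasting\<close>

lemma adj_id_left: "rigid i f \<Longrightarrow> hom f x y \<Longrightarrow> oadj i u x \<Longrightarrow> adj i (\<iota> u) f"
  by (rule adj_rigid[OF rigid_id _ hom_id]) (auto simp: oadj_def)

lemma adj_id_right: "rigid i f \<Longrightarrow> hom f x y \<Longrightarrow> oadj i x u \<Longrightarrow> adj i f (\<iota> u)"
  by (rule adj_rigid[OF _ rigid_id _ hom_id]) (auto simp: oadj_def)

lemma whisker_left:
  assumes "hom f x y" "hom g y z" "adj i (\<iota> u) f" "adj i (\<iota> u) g" "u \<in> Ob"
  shows "\<iota> u \<odot>\<^sub>i (g \<cdot> f) = (\<iota> u \<odot>\<^sub>i g) \<cdot> (\<iota> u \<odot>\<^sub>i f)"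
  using interchange[OF hom_id hom_id assms(1,2,3,4)] cmp_id_left[OF hom_id] assms(5) by simp

lemma whisker_right:
  assumes "hom f x y" "hom g y z" "adj i f (\<iota> u)" "adj i g (\<iota> u)" "u \<in> Ob"
  shows "(g \<cdot> f) \<odot>\<^sub>i \<iota> u = (g \<odot>\<^sub>i \<iota> u) \<cdot> (f \<odot>\<^sub>i \<iota> u)"
  using interchange[OF assms(1,2) hom_id hom_id assms(3,4)] cmp_id_left[OF hom_id] assms(5) by simp

text \<open>Here \<open>u\<close> is the first layer, and \<open>eq\<close> is the coherence of the
  remaining slabs \<open>x\<close>, \<open>y\<close>, \<open>z\<close>. The four cells are
  \<open>eq\<close> whiskered with \<open>u\<close>, the pentagon, and the naturality of
  \<open>\<alpha>\<close> in \<open>p\<close> and in \<open>r\<close>.\<close>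

lemma paste_pentagon:
  assumes o: "oadj i u x" "oadj i x y" "oadj i y z"
    and p: "hom p (x \<otimes>\<^sub>i y) v" "rigid i p" and q: "hom q (v \<otimes>\<^sub>i z) w" "rigid i q"
    and r: "hom r (y \<otimes>\<^sub>i z) t" "rigid i r" and s: "hom s (x \<otimes>\<^sub>i t) w" "rigid i s"
    and eq: "q \<cdot> (p \<odot>\<^sub>i \<iota> z) = s \<cdot> (\<iota> x \<odot>\<^sub>i r) \<cdot> \<alpha> i x y z"
  shows "((\<iota> u \<odot>\<^sub>i q) \<cdot> \<alpha> i u v z) \<cdot> (((\<iota> u \<odot>\<^sub>i p) \<cdot> \<alpha> i u x y) \<odot>\<^sub>i \<iota> z) =
    ((\<iota> u \<odot>\<^sub>i s) \<cdot> \<alpha> i u x t) \<cdot> (\<iota> (u \<otimes>\<^sub>i x) \<odot>\<^sub>i r) \<cdot> \<alpha> i (u \<otimes>\<^sub>i x) y z"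
proof -
  have i: "i \<in> K" and ob: "u \<in> Ob" "x \<in> Ob" "y \<in> Ob" "z \<in> Ob"
    using o by (auto simp: oadj_def)
  note o2 = oadj_right[OF o(1,2)] oadj_left[OF o(2,3)] oadj_right[OF o(2,3)] oadj_left[OF o(1,2)]
  have up: "adj i (\<iota> u) p" and pz: "adj i p (\<iota> z)" and xr: "adj i (\<iota> x) r"
    using adj_id_left adj_id_right p r o2 by blast+
  have o3: "oadj i u v" "oadj i v z" "oadj i x t"
    using adj_cod[OF up hom_id[OF ob(1)] p(1)] adj_cod[OF pz p(1) hom_id[OF ob(4)]]
      adj_cod[OF xr hom_id[OF ob(2)] r(1)] .
  have uq: "adj i (\<iota> u) q" and us: "adj i (\<iota> u) s"
    using adj_id_left q s oadj_right[OF o3(1,2)] oadj_right[OF o(1) o3(3)] by blast+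
  note h = hom_id[OF ob(1)] hom_id[OF ob(2)] hom_id[OF ob(4)]
  have ux: "adj i (\<iota> u) (\<iota> x)"
    using adj_id o by blast
  note aD = hom_assoc(1)[OF o(1,2)]
  have aDz: "adj i (\<alpha> i u x y) (\<iota> z)"
    using adj_id_right[OF rigid_assoc[OF o(1,2)] aD] oadj_left[OF o2(4) o(3)] .
  have aN: "adj i (\<iota> u) (\<alpha> i x y z)"
    using adj_id_left[OF rigid_assoc[OF o(2,3)] hom_assoc(1)[OF o(2,3)]] oadj_right[OF o(1) oadj_right[OF o(2,3)]]
      oadj_right[OF oadj_right[OF o(1,2)] o2(2)] by blast
  have L: "hom (\<iota> x \<odot>\<^sub>i r) (x \<otimes>\<^sub>i (y \<otimes>\<^sub>i z)) (x \<otimes>\<^sub>i t)"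
    using hom_glue[OF h(2) r(1) xr] .
  have uL: "adj i (\<iota> u) (\<iota> x \<odot>\<^sub>i r)"
    using adj_right[OF ux xr] .
  have AE: "(\<iota> u \<odot>\<^sub>i q) \<cdot> (\<iota> u \<odot>\<^sub>i (p \<odot>\<^sub>i \<iota> z)) =
      (\<iota> u \<odot>\<^sub>i s) \<cdot> (\<iota> u \<odot>\<^sub>i (\<iota> x \<odot>\<^sub>i r)) \<cdot> (\<iota> u \<odot>\<^sub>i \<alpha> i x y z)"
    using whisker_left[OF hom_glue[OF p(1) h(3) pz] q(1) adj_right[OF up pz] uq ob(1)]
      whisker_left[OF hom_cmp[OF hom_assoc(1)[OF o(2,3)] L] s(1) adj_cmp[OF h(1) h(1) hom_assoc(1)[OF o(2,3)] L aN uL, unfolded cmp_id_left[OF h(1)]] us ob(1)]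
      whisker_left[OF hom_assoc(1)[OF o(2,3)] L aN uL ob(1)] eq
    by simp
  have pent: "(\<iota> u \<odot>\<^sub>i \<alpha> i x y z) \<cdot> \<alpha> i u (x \<otimes>\<^sub>i y) z \<cdot> (\<alpha> i u x y \<odot>\<^sub>i \<iota> z) =
      \<alpha> i u x (y \<otimes>\<^sub>i z) \<cdot> \<alpha> i (u \<otimes>\<^sub>i x) y z"
    using pentagon[OF K i, of u x y z] o i by (simp add: pairs_Obj)
  have BC: "\<alpha> i u v z \<cdot> ((\<iota> u \<odot>\<^sub>i p) \<odot>\<^sub>i \<iota> z) = (\<iota> u \<odot>\<^sub>i (p \<odot>\<^sub>i \<iota> z)) \<cdot> \<alpha> i u (x \<otimes>\<^sub>i y) z"
    using assoc_nat[OF h(1) p(1) h(3) up pz] .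
  have SU: "\<alpha> i u x t \<cdot> (\<iota> (u \<otimes>\<^sub>i x) \<odot>\<^sub>i r) = (\<iota> u \<odot>\<^sub>i (\<iota> x \<odot>\<^sub>i r)) \<cdot> \<alpha> i u x (y \<otimes>\<^sub>i z)"
    using assoc_nat[OF h(1,2) r(1) ux xr] glue_id[OF o(1)] by simp
  have C: "((\<iota> u \<odot>\<^sub>i p) \<cdot> \<alpha> i u x y) \<odot>\<^sub>i \<iota> z = ((\<iota> u \<odot>\<^sub>i p) \<odot>\<^sub>i \<iota> z) \<cdot> (\<alpha> i u x y \<odot>\<^sub>i \<iota> z)"
    using whisker_right[OF aD hom_glue[OF h(1) p(1) up] aDz adj_left[OF up pz] ob(4)] .
  have uxr: "adj i (\<iota> (u \<otimes>\<^sub>i x)) r"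
    using adj_left[OF ux xr] glue_id[OF o(1)] by simp
  show ?thesis
    unfolding C
    by (rule paste[OF hom_glue[OF aD h(3) aDz] hom_glue[OF hom_glue[OF h(1) p(1) up] h(3) adj_left[OF up pz]]
      hom_assoc(1)[OF o3(1,2)] hom_glue[OF h(1) q(1) uq] hom_assoc(1)[OF o2(1,2)]
      hom_glue[OF h(1) hom_glue[OF p(1) h(3) pz] adj_right[OF up pz]]
      hom_glue[OF h(1) hom_assoc(1)[OF o(2,3)] aN] hom_glue[OF h(1) L uL] hom_glue[OF h(1) s(1) us]
      hom_assoc(1)[OF o2(4) o(3)] hom_assoc(1)[OF o(1) o2(3)]
      hom_glue[OF hom_id[OF obj_glue[OF o(1)]] r(1) uxr] hom_assoc(1)[OF o(1) o3(3)] BC AE pent SU])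
qed

text \<open>Moves four invertible edges of a hexagon to the opposite sides by composing with their
  inverses.\<close>

lemma transpose:
  assumes "hom T c d" "hom T' d c" "hom Q d e" "hom Q' e d" "hom N f e" "hom F g f" "hom F' f g"
    "hom D a g" "hom D' g a" "hom R a c"
    and inv: "T \<cdot> T' = \<iota> d" "Q \<cdot> Q' = \<iota> e" "D' \<cdot> D = \<iota> a" "F' \<cdot> F = \<iota> g"
    and eq: "R \<cdot> D' \<cdot> F' = T' \<cdot> Q' \<cdot> N"
  shows "N \<cdot> F \<cdot> D = Q \<cdot> T \<cdot> R"
proof -
  have "R = R \<cdot> D' \<cdot> (F' \<cdot> F) \<cdot> D"
    using assms cmp_id_left cmp_id_right by metis
  also have "\<dots> = (R \<cdot> D' \<cdot> F') \<cdot> F \<cdot> D"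
    using assoc[OF assms(8,6,7)] assoc[OF hom_cmp[OF assms(8,6)] hom_cmp[OF assms(7,9)] assms(10)]
      assoc[OF hom_cmp[OF assms(8,6)] assms(7,9)] by simp
  also have "\<dots> = T' \<cdot> Q' \<cdot> N \<cdot> F \<cdot> D"
    using assoc[OF hom_cmp[OF assms(8,6)] hom_cmp[OF assms(5,4)] assms(2)]
      assoc[OF hom_cmp[OF assms(8,6)] assms(5,4)] eq by simp
  finally have R: "R = T' \<cdot> Q' \<cdot> N \<cdot> F \<cdot> D" .
  note NFD = hom_cmp[OF hom_cmp[OF assms(8,6)] assms(5)]
  have "T \<cdot> R = Q' \<cdot> N \<cdot> F \<cdot> D"
    unfolding R using assoc[OF hom_cmp[OF NFD assms(4)] assms(2,1)] inv cmp_id_left[OF hom_cmp[OF NFD assms(4)]]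
    by simp
  then show ?thesis
    using assoc[OF NFD assms(4,3)] inv cmp_id_left[OF NFD] by simp
qed

text \<open>Unprimed data live on the first layer and primed data on the rest of the box; the two
  are glued along \<open>m\<close>. The four cells are the gluing of both equations
  \<open>eq\<close>, the first hexagon, and the naturality of \<open>\<beta> m i\<close> in
  \<open>p\<close>, \<open>p'\<close> and in \<open>r\<close>, \<open>r'\<close>.\<close>

lemma paste_assoc_intch:
  assumes ne: "i \<noteq> m"
    and o: "oadj i x y" "oadj i y z" "oadj i x' y'" "oadj i y' z'" "oadj m x x'" "oadj m y y'" "oadj m z z'"
    and p: "hom p (x \<otimes>\<^sub>i y) v" "rigid i p" "hom p' (x' \<otimes>\<^sub>i y') v'" "rigid i p'" "adj m p p'"
    and q: "hom q (v \<otimes>\<^sub>i z) w" "hom q' (v' \<otimes>\<^sub>i z') w'" "adj m q q'"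
    and r: "hom r (y \<otimes>\<^sub>i z) t" "rigid i r" "hom r' (y' \<otimes>\<^sub>i z') t'" "rigid i r'" "adj m r r'"
    and s: "hom s (x \<otimes>\<^sub>i t) w" "hom s' (x' \<otimes>\<^sub>i t') w'" "adj m s s'"
    and eq: "q \<cdot> (p \<odot>\<^sub>i \<iota> z) = s \<cdot> (\<iota> x \<odot>\<^sub>i r) \<cdot> \<alpha> i x y z"
      "q' \<cdot> (p' \<odot>\<^sub>i \<iota> z') = s' \<cdot> (\<iota> x' \<odot>\<^sub>i r') \<cdot> \<alpha> i x' y' z'"
  shows "((q \<odot>\<^sub>m q') \<cdot> \<beta> m i v v' z z') \<cdot> (((p \<odot>\<^sub>m p') \<cdot> \<beta> m i x x' y y') \<odot>\<^sub>i \<iota> (z \<otimes>\<^sub>m z')) =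
    ((s \<odot>\<^sub>m s') \<cdot> \<beta> m i x x' t t') \<cdot> (\<iota> (x \<otimes>\<^sub>m x') \<odot>\<^sub>i ((r \<odot>\<^sub>m r') \<cdot> \<beta> m i y y' z z')) \<cdot>
      \<alpha> i (x \<otimes>\<^sub>m x') (y \<otimes>\<^sub>m y') (z \<otimes>\<^sub>m z')"
proof -
  have im: "i \<in> K" "m \<in> K" and ob: "x \<in> Ob" "x' \<in> Ob" "z \<in> Ob" "z' \<in> Ob"
    using o by (auto simp: oadj_def)
  note ne' = ne[symmetric]
  note xx = oadj_cross[OF ne' o(5,6,1,3)] and yy = oadj_cross[OF ne' o(6,7,2,4)]
  have pz: "adj i p (\<iota> z)" "adj i p' (\<iota> z')" and xr: "adj i (\<iota> x) r" "adj i (\<iota> x') r'"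
    using adj_id_right[OF p(2,1) oadj_left[OF o(1,2)]] adj_id_right[OF p(4,3) oadj_left[OF o(3,4)]]
      adj_id_left[OF r(2,1) oadj_right[OF o(1,2)]] adj_id_left[OF r(4,3) oadj_right[OF o(3,4)]] .
  note h = hom_id[OF ob(1)] hom_id[OF ob(2)] hom_id[OF ob(3)] hom_id[OF ob(4)]
  have xx': "adj m (\<iota> x) (\<iota> x')" and zz': "adj m (\<iota> z) (\<iota> z')"
    using adj_id o by blast+
  have o3: "oadj i v z" "oadj i v' z'" "oadj i x t" "oadj i x' t'" "oadj m v v'" "oadj m t t'"
    using adj_cod[OF pz(1) p(1) h(3)] adj_cod[OF pz(2) p(3) h(4)] adj_cod[OF xr(1) h(1) r(1)]
      adj_cod[OF xr(2) h(2) r(3)] adj_cod[OF p(5) p(1,3)] adj_cod[OF r(5) r(1,3)] .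
  note bx = hom_intch(1)[OF ne' o(5,6,1,3)] and bz = hom_intch(1)[OF ne' o(6,7,2,4)]
  have bxz: "adj i (\<beta> m i x x' y y') (\<iota> (z \<otimes>\<^sub>m z'))"
    using adj_id_right[OF rigid_intch[OF ne' o(5,6,1,3)] bx] oadj_left[OF xx yy] by blast
  have xbz: "adj i (\<iota> (x \<otimes>\<^sub>m x')) (\<beta> m i y y' z z')"
    using adj_id_left[OF rigid_intch[OF ne' o(6,7,2,4)] bz] oadj_right[OF xx yy] by blast
  have ppz: "adj i (p \<odot>\<^sub>m p') (\<iota> (z \<otimes>\<^sub>m z'))"
    using adj_cross[OF ne' p(5) zz' pz] glue_id[OF o(7)] by simp
  have xrr: "adj i (\<iota> (x \<otimes>\<^sub>m x')) (r \<odot>\<^sub>m r')"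
    using adj_cross[OF ne' xx' r(5) xr] glue_id[OF o(5)] by simp
  have C: "((p \<odot>\<^sub>m p') \<cdot> \<beta> m i x x' y y') \<odot>\<^sub>i \<iota> (z \<otimes>\<^sub>m z') =
      ((p \<odot>\<^sub>m p') \<odot>\<^sub>i \<iota> (z \<otimes>\<^sub>m z')) \<cdot> (\<beta> m i x x' y y' \<odot>\<^sub>i \<iota> (z \<otimes>\<^sub>m z'))"
    using whisker_right[OF bx hom_glue[OF p(1,3,5)] bxz ppz obj_glue[OF o(7)]] .
  have U: "\<iota> (x \<otimes>\<^sub>m x') \<odot>\<^sub>i ((r \<odot>\<^sub>m r') \<cdot> \<beta> m i y y' z z') =
      (\<iota> (x \<otimes>\<^sub>m x') \<odot>\<^sub>i (r \<odot>\<^sub>m r')) \<cdot> (\<iota> (x \<otimes>\<^sub>m x') \<odot>\<^sub>i \<beta> m i y y' z z')"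
    using whisker_left[OF bz hom_glue[OF r(1,3,5)] xbz xrr obj_glue[OF o(5)]] .
  note hx = hom_id[OF obj_glue[OF o(5)]] and hz = hom_id[OF obj_glue[OF o(7)]]
  have D: "hom (\<beta> m i x x' y y' \<odot>\<^sub>i \<iota> (z \<otimes>\<^sub>m z'))
      (((x \<otimes>\<^sub>m x') \<otimes>\<^sub>i (y \<otimes>\<^sub>m y')) \<otimes>\<^sub>i (z \<otimes>\<^sub>m z')) (((x \<otimes>\<^sub>i y) \<otimes>\<^sub>m (x' \<otimes>\<^sub>i y')) \<otimes>\<^sub>i (z \<otimes>\<^sub>m z'))"
    using hom_glue[OF bx hz bxz] .
  have T: "hom (\<iota> (x \<otimes>\<^sub>m x') \<odot>\<^sub>i \<beta> m i y y' z z')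
      ((x \<otimes>\<^sub>m x') \<otimes>\<^sub>i ((y \<otimes>\<^sub>m y') \<otimes>\<^sub>i (z \<otimes>\<^sub>m z'))) ((x \<otimes>\<^sub>m x') \<otimes>\<^sub>i ((y \<otimes>\<^sub>i z) \<otimes>\<^sub>m (y' \<otimes>\<^sub>i z')))"
    using hom_glue[OF hx bz xbz] .
  have aa: "adj m (\<alpha> i x y z) (\<alpha> i x' y' z')"
    using adj_assoc[OF ne o] .
  note a1 = hom_assoc(1)[OF o(1,2)] and a2 = hom_assoc(1)[OF o(3,4)]
  note ZZ = oadj_cross[OF ne o(1,3,5,6)] oadj_left[OF o(1,2)] oadj_left[OF o(3,4)]
  note YZ = oadj_cross[OF ne o(2,4,6,7)] oadj_right[OF o(1,2)] oadj_right[OF o(3,4)]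
  note F = hom_intch(1)[OF ne' ZZ(1) o(7) ZZ(2,3)] and F' = hom_intch(1)[OF ne ZZ(2,3,1) o(7)]
  note Q = hom_intch(1)[OF ne' o(5) YZ] and Q' = hom_intch(1)[OF ne YZ(2,3) o(5) YZ(1)]
  note R = hom_assoc(1)[OF xx yy]
  note bx' = hom_intch(1)[OF ne o(1,3,5,6)] and bz' = hom_intch(1)[OF ne o(2,4,6,7)]
  have bxz': "adj i (\<beta> i m x y x' y') (\<iota> (z \<otimes>\<^sub>m z'))"
    using adj_id_right[OF rigid_intch[OF ne o(1,3,5,6)] bx'] adj_cod[OF bxz bx hz] by blast
  have xbz': "adj i (\<iota> (x \<otimes>\<^sub>m x')) (\<beta> i m y z y' z')"
    using adj_id_left[OF rigid_intch[OF ne o(2,4,6,7)] bz'] adj_cod[OF xbz hx bz] by blast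
  \<comment> \<open>The axiom \<open>hexagon1\<close> is about \<open>\<beta> i m\<close>, whereas
    \<open>split_iso\<close> is built with the inverse \<open>\<beta> m i\<close>.\<close>
  have hex: "(\<alpha> i x y z \<odot>\<^sub>m \<alpha> i x' y' z') \<cdot> \<beta> m i (x \<otimes>\<^sub>i y) (x' \<otimes>\<^sub>i y') z z' \<cdot> (\<beta> m i x x' y y' \<odot>\<^sub>i \<iota> (z \<otimes>\<^sub>m z')) =
      \<beta> m i x x' (y \<otimes>\<^sub>i z) (y' \<otimes>\<^sub>i z') \<cdot> (\<iota> (x \<otimes>\<^sub>m x') \<odot>\<^sub>i \<beta> m i y y' z z') \<cdot>
      \<alpha> i (x \<otimes>\<^sub>m x') (y \<otimes>\<^sub>m y') (z \<otimes>\<^sub>m z')"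
  proof (rule transpose[OF T hom_glue[OF hx bz' xbz'] Q Q' hom_glue[OF a1 a2 aa] F F' D hom_glue[OF bx' hz bxz'] R])
    show "(\<iota> (x \<otimes>\<^sub>m x') \<odot>\<^sub>i \<beta> m i y y' z z') \<cdot> (\<iota> (x \<otimes>\<^sub>m x') \<odot>\<^sub>i \<beta> i m y z y' z') =
        \<iota> ((x \<otimes>\<^sub>m x') \<otimes>\<^sub>i ((y \<otimes>\<^sub>i z) \<otimes>\<^sub>m (y' \<otimes>\<^sub>i z')))"
      using whisker_left[OF bz' bz xbz' xbz obj_glue[OF o(5)]] intch_swap[OF ne' o(6,7,2,4)]
        glue_id[OF adj_cod[OF xbz hx bz]] by simp
    show "(\<beta> i m x y x' y' \<odot>\<^sub>i \<iota> (z \<otimes>\<^sub>m z')) \<cdot> (\<beta> m i x x' y y' \<odot>\<^sub>i \<iota> (z \<otimes>\<^sub>m z')) =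
        \<iota> (((x \<otimes>\<^sub>m x') \<otimes>\<^sub>i (y \<otimes>\<^sub>m y')) \<otimes>\<^sub>i (z \<otimes>\<^sub>m z'))"
      using whisker_right[OF bx bx' bxz bxz' obj_glue[OF o(7)]] intch_swap[OF ne o(1,3,5,6)]
        glue_id[OF adj_dom[OF bxz bx hz]] by simp
    show "\<alpha> i (x \<otimes>\<^sub>m x') (y \<otimes>\<^sub>m y') (z \<otimes>\<^sub>m z') \<cdot> (\<beta> i m x y x' y' \<odot>\<^sub>i \<iota> (z \<otimes>\<^sub>m z')) \<cdot>
        \<beta> i m (x \<otimes>\<^sub>i y) z (x' \<otimes>\<^sub>i y') z' =
        (\<iota> (x \<otimes>\<^sub>m x') \<odot>\<^sub>i \<beta> i m y z y' z') \<cdot> \<beta> i m x (y \<otimes>\<^sub>i z) x' (y' \<otimes>\<^sub>i z') \<cdot> (\<alpha> i x y z \<odot>\<^sub>m \<alpha> i x' y' z')"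
      using hexagon1[OF K im ne, of x y z x' y' z'] o im by (simp add: pairs_Obj)
  qed (rule intch_swap[OF ne' o(5) YZ] intch_swap[OF ne ZZ(2,3,1) o(7)])+
  have BC: "\<beta> m i v v' z z' \<cdot> ((p \<odot>\<^sub>m p') \<odot>\<^sub>i \<iota> (z \<otimes>\<^sub>m z')) =
      ((p \<odot>\<^sub>i \<iota> z) \<odot>\<^sub>m (p' \<odot>\<^sub>i \<iota> z')) \<cdot> \<beta> m i (x \<otimes>\<^sub>i y) (x' \<otimes>\<^sub>i y') z z'"
    using intch_nat[OF ne' p(1,3) h(3,4) p(5) zz' pz] glue_id[OF o(7)] by simp
  have SU: "\<beta> m i x x' t t' \<cdot> (\<iota> (x \<otimes>\<^sub>m x') \<odot>\<^sub>i (r \<odot>\<^sub>m r')) =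
      ((\<iota> x \<odot>\<^sub>i r) \<odot>\<^sub>m (\<iota> x' \<odot>\<^sub>i r')) \<cdot> \<beta> m i x x' (y \<otimes>\<^sub>i z) (y' \<otimes>\<^sub>i z')"
    using intch_nat[OF ne' h(1,2) r(1,3) xx' r(5) xr] glue_id[OF o(5)] by simp
  have E: "adj m (p \<odot>\<^sub>i \<iota> z) (p' \<odot>\<^sub>i \<iota> z')" and L: "adj m (\<iota> x \<odot>\<^sub>i r) (\<iota> x' \<odot>\<^sub>i r')"
    using adj_cross[OF ne pz p(5) zz'] adj_cross[OF ne xr xx' r(5)] .
  note hE = hom_glue[OF p(1) h(3) pz(1)] hom_glue[OF p(3) h(4) pz(2)]
  note hL = hom_glue[OF h(1) r(1) xr(1)] hom_glue[OF h(2) r(3) xr(2)]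
  have AE: "(q \<odot>\<^sub>m q') \<cdot> ((p \<odot>\<^sub>i \<iota> z) \<odot>\<^sub>m (p' \<odot>\<^sub>i \<iota> z')) =
      (s \<odot>\<^sub>m s') \<cdot> ((\<iota> x \<odot>\<^sub>i r) \<odot>\<^sub>m (\<iota> x' \<odot>\<^sub>i r')) \<cdot> (\<alpha> i x y z \<odot>\<^sub>m \<alpha> i x' y' z')"
    using interchange[OF hE(1) q(1) hE(2) q(2) E q(3)] interchange[OF a1 hL(1) a2 hL(2) aa L]
      interchange[OF hom_cmp[OF a1 hL(1)] s(1) hom_cmp[OF a2 hL(2)] s(2) adj_cmp[OF a1 hL(1) a2 hL(2) aa L] s(3)] eq
    by simp
  have "((q \<odot>\<^sub>m q') \<cdot> \<beta> m i v v' z z') \<cdot> ((p \<odot>\<^sub>m p') \<odot>\<^sub>i \<iota> (z \<otimes>\<^sub>m z')) \<cdot> (\<beta> m i x x' y y' \<odot>\<^sub>i \<iota> (z \<otimes>\<^sub>m z')) =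
    ((s \<odot>\<^sub>m s') \<cdot> \<beta> m i x x' t t') \<cdot> (\<iota> (x \<otimes>\<^sub>m x') \<odot>\<^sub>i (r \<odot>\<^sub>m r')) \<cdot> (\<iota> (x \<otimes>\<^sub>m x') \<odot>\<^sub>i \<beta> m i y y' z z') \<cdot>
      \<alpha> i (x \<otimes>\<^sub>m x') (y \<otimes>\<^sub>m y') (z \<otimes>\<^sub>m z')"
    by (rule paste[OF D hom_glue[OF hom_glue[OF p(1,3,5)] hz ppz] hom_intch(1)[OF ne' o3(5) o(7) o3(1,2)]
        hom_glue[OF q] F hom_glue[OF hE E] hom_glue[OF a1 a2 aa] hom_glue[OF hL L] hom_glue[OF s]
        hom_cmp[OF R T] Q hom_glue[OF hx hom_glue[OF r(1,3,5)] xrr] hom_intch(1)[OF ne' o(5) o3(6,3,4)] BC AE hex SU])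
  then show ?thesis
    unfolding C U
    using assoc[OF R T hom_glue[OF hx hom_glue[OF r(1,3,5)] xrr]] by simp
qed

text \<open>Here \<open>i\<close> is the leading direction: \<open>u\<close>, \<open>u'\<close> form
  the first layer, and \<open>eq\<close> is the coherence of the rest. The arrows \<open>a\<close>,
  \<open>b\<close>, \<open>c\<close> merge the two halves of each slab along \<open>j\<close>. In
  this case the first hexagon has the right orientation from the start.\<close>

lemma paste_intch_assoc:
  assumes ne: "i \<noteq> j"
    and o: "oadj i u x" "oadj i x y" "oadj i u' x'" "oadj i x' y'" "oadj j u u'" "oadj j x x'" "oadj j y y'"
    and p: "hom p (x \<otimes>\<^sub>i y) v" "rigid i p" "hom p' (x' \<otimes>\<^sub>i y') v'" "rigid i p'" "adj j p p'"
    and a: "hom a (u \<otimes>\<^sub>j u') U" and b: "hom b (x \<otimes>\<^sub>j x') X" and c: "hom c (y \<otimes>\<^sub>j y') Y"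
    and abc: "adj i a b" "adj i b c"
    and q: "hom q (v \<otimes>\<^sub>j v') W" "adj i a q" and r: "hom r (X \<otimes>\<^sub>i Y) W" "rigid i r"
    and eq: "q \<cdot> (p \<odot>\<^sub>j p') = r \<cdot> (b \<odot>\<^sub>i c) \<cdot> \<beta> i j x y x' y'"
  shows "((a \<odot>\<^sub>i q) \<cdot> \<beta> i j u v u' v') \<cdot> (((\<iota> u \<odot>\<^sub>i p) \<cdot> \<alpha> i u x y) \<odot>\<^sub>j ((\<iota> u' \<odot>\<^sub>i p') \<cdot> \<alpha> i u' x' y')) =
    ((\<iota> U \<odot>\<^sub>i r) \<cdot> \<alpha> i U X Y) \<cdot> (((a \<odot>\<^sub>i b) \<cdot> \<beta> i j u x u' x') \<odot>\<^sub>i c) \<cdot> \<beta> i j (u \<otimes>\<^sub>i x) y (u' \<otimes>\<^sub>i x') y'"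
proof -
  have ij: "i \<in> K" "j \<in> K" and ob: "u \<in> Ob" "u' \<in> Ob" "U \<in> Ob"
    using o hom_obj[OF a] by (auto simp: oadj_def)
  note h = hom_id[OF ob(1)] hom_id[OF ob(2)] hom_id[OF ob(3)]
  have up: "adj i (\<iota> u) p" "adj i (\<iota> u') p'"
    using adj_id_left[OF p(2,1) oadj_right[OF o(1,2)]] adj_id_left[OF p(4,3) oadj_right[OF o(3,4)]] .
  have uu: "adj j (\<iota> u) (\<iota> u')"
    using adj_id[OF o(5)] .
  have oUX: "oadj i U X" "oadj i X Y"
    using adj_cod[OF abc(1) a b] adj_cod[OF abc(2) b c] .
  have Ur: "adj i (\<iota> U) r"
    using adj_id_left[OF r(2,1) oadj_right[OF oUX]] .
  have ov: "oadj i u v" "oadj i u' v'" "oadj j v v'"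
    using adj_cod[OF up(1) h(1) p(1)] adj_cod[OF up(2) h(2) p(3)] adj_cod[OF p(5) p(1,3)] .
  note a1 = hom_assoc(1)[OF o(1,2)] and a2 = hom_assoc(1)[OF o(3,4)]
  have aa: "adj j (\<alpha> i u x y) (\<alpha> i u' x' y')"
    using adj_assoc[OF ne o] .
  note hC = hom_glue[OF h(1) p(1) up(1)] hom_glue[OF h(2) p(3) up(2)]
  have C: "adj j (\<iota> u \<odot>\<^sub>i p) (\<iota> u' \<odot>\<^sub>i p')"
    using adj_cross[OF ne up uu p(5)] .
  have CD: "((\<iota> u \<odot>\<^sub>i p) \<cdot> \<alpha> i u x y) \<odot>\<^sub>j ((\<iota> u' \<odot>\<^sub>i p') \<cdot> \<alpha> i u' x' y') =
      ((\<iota> u \<odot>\<^sub>i p) \<odot>\<^sub>j (\<iota> u' \<odot>\<^sub>i p')) \<cdot> (\<alpha> i u x y \<odot>\<^sub>j \<alpha> i u' x' y')"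
    using interchange[OF a1 hC(1) a2 hC(2) aa C] .
  note bu = hom_intch(1)[OF ne o(1,3,5,6)] and bx = hom_intch(1)[OF ne o(2,4,6,7)]
  note ou = oadj_cross[OF ne[symmetric] o(5,6,1,3)] and ox = oadj_cross[OF ne[symmetric] o(6,7,2,4)]
  have oy: "y \<otimes>\<^sub>j y' \<in> Ob"
    using obj_glue[OF o(7)] .
  have buy: "adj i (\<beta> i j u x u' x') (\<iota> (y \<otimes>\<^sub>j y'))"
    using adj_id_right[OF rigid_intch[OF ne o(1,3,5,6)] bu] oadj_left[OF adj_dom[OF abc(1) a b] adj_dom[OF abc(2) b c]]
      rigid_cod[OF rigid_intch[OF ne o(1,3,5,6)] bu] hom_obj[OF bu] by (auto simp: oadj_def)
  have abcc: "adj i (a \<odot>\<^sub>i b) c"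
    using adj_left[OF abc] .
  have U: "((a \<odot>\<^sub>i b) \<cdot> \<beta> i j u x u' x') \<odot>\<^sub>i c =
      ((a \<odot>\<^sub>i b) \<odot>\<^sub>i c) \<cdot> (\<beta> i j u x u' x' \<odot>\<^sub>i \<iota> (y \<otimes>\<^sub>j y'))"
    using interchange[OF bu hom_glue[OF a b abc(1)] hom_id[OF oy] c buy abcc] cmp_id_right[OF c] by simp
  have xb: "adj i (\<iota> (u \<otimes>\<^sub>j u')) (\<beta> i j x y x' y')"
    using adj_id_left[OF rigid_intch[OF ne o(2,4,6,7)] bx]
      oadj_cross[OF ne[symmetric] o(5) oadj_cross[OF ne o(2,4,6,7)] oadj_right[OF o(1,2)] oadj_right[OF o(3,4)]] by blast
  note hu = hom_id[OF obj_glue[OF o(5)]]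
  note T = hom_glue[OF bu hom_id[OF oy] buy]
  note XX = oadj_left[OF o(1,2)] oadj_left[OF o(3,4)] oadj_cross[OF ne o(1,3,5,6)]
  note YY = oadj_right[OF o(1,2)] oadj_right[OF o(3,4)] oadj_cross[OF ne o(2,4,6,7)]
  note R = hom_intch(1)[OF ne XX o(7)] and F = hom_intch(1)[OF ne YY(1,2) o(5) YY(3)]
  have hex: "(\<iota> (u \<otimes>\<^sub>j u') \<odot>\<^sub>i \<beta> i j x y x' y') \<cdot> \<beta> i j u (x \<otimes>\<^sub>i y) u' (x' \<otimes>\<^sub>i y') \<cdot> (\<alpha> i u x y \<odot>\<^sub>j \<alpha> i u' x' y') =
      \<alpha> i (u \<otimes>\<^sub>j u') (x \<otimes>\<^sub>j x') (y \<otimes>\<^sub>j y') \<cdot> (\<beta> i j u x u' x' \<odot>\<^sub>i \<iota> (y \<otimes>\<^sub>j y')) \<cdot>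
        \<beta> i j (u \<otimes>\<^sub>i x) y (u' \<otimes>\<^sub>i x') y'"
    using hexagon1[OF K ij ne, of u x y u' x' y'] o ij by (simp add: pairs_Obj)
  have BC: "\<beta> i j u v u' v' \<cdot> ((\<iota> u \<odot>\<^sub>i p) \<odot>\<^sub>j (\<iota> u' \<odot>\<^sub>i p')) =
      (\<iota> (u \<otimes>\<^sub>j u') \<odot>\<^sub>i (p \<odot>\<^sub>j p')) \<cdot> \<beta> i j u (x \<otimes>\<^sub>i y) u' (x' \<otimes>\<^sub>i y')"
    using intch_nat[OF ne h(1) p(1) h(2) p(3) up uu p(5)] glue_id[OF o(5)] by simp
  have SU: "\<alpha> i U X Y \<cdot> ((a \<odot>\<^sub>i b) \<odot>\<^sub>i c) = (a \<odot>\<^sub>i (b \<odot>\<^sub>i c)) \<cdot> \<alpha> i (u \<otimes>\<^sub>j u') (x \<otimes>\<^sub>j x') (y \<otimes>\<^sub>j y')"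
    using assoc_nat[OF a b c abc] .
  have upp: "adj i (\<iota> (u \<otimes>\<^sub>j u')) (p \<odot>\<^sub>j p')"
    using adj_cross[OF ne[symmetric] uu p(5) up] glue_id[OF o(5)] by simp
  have abc': "adj i a (b \<odot>\<^sub>i c)"
    using adj_right[OF abc] .
  note bc = hom_glue[OF b c abc(2)]
  have AE: "(a \<odot>\<^sub>i q) \<cdot> (\<iota> (u \<otimes>\<^sub>j u') \<odot>\<^sub>i (p \<odot>\<^sub>j p')) =
      (\<iota> U \<odot>\<^sub>i r) \<cdot> (a \<odot>\<^sub>i (b \<odot>\<^sub>i c)) \<cdot> (\<iota> (u \<otimes>\<^sub>j u') \<odot>\<^sub>i \<beta> i j x y x' y')"
    using interchange[OF hu a hom_glue[OF p(1,3,5)] q(1) upp q(2)] interchange[OF hu a bx bc xb abc']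
      interchange[OF a h(3) hom_cmp[OF bx bc] r(1) adj_cmp[OF hu a bx bc xb abc', unfolded cmp_id_right[OF a]] Ur]
      cmp_id_right[OF a] cmp_id_left[OF a] eq
    by simp
  have "((a \<odot>\<^sub>i q) \<cdot> \<beta> i j u v u' v') \<cdot> ((\<iota> u \<odot>\<^sub>i p) \<odot>\<^sub>j (\<iota> u' \<odot>\<^sub>i p')) \<cdot> (\<alpha> i u x y \<odot>\<^sub>j \<alpha> i u' x' y') =
    ((\<iota> U \<odot>\<^sub>i r) \<cdot> \<alpha> i U X Y) \<cdot> ((a \<odot>\<^sub>i b) \<odot>\<^sub>i c) \<cdot> (\<beta> i j u x u' x' \<odot>\<^sub>i \<iota> (y \<otimes>\<^sub>j y')) \<cdot>
        \<beta> i j (u \<otimes>\<^sub>i x) y (u' \<otimes>\<^sub>i x') y'"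
    by (rule paste[OF hom_glue[OF a1 a2 aa] hom_glue[OF hC C] hom_intch(1)[OF ne ov(1,2) o(5) ov(3)]
        hom_glue[OF a q] F hom_glue[OF hu hom_glue[OF p(1,3,5)] upp] hom_glue[OF hu bx xb]
        hom_glue[OF a bc abc'] hom_glue[OF h(3) r(1) Ur] hom_cmp[OF R T] hom_assoc(1)[OF ou ox]
        hom_glue[OF hom_glue[OF a b abc(1)] c abcc] hom_assoc(1)[OF oUX] BC AE hex SU])
  then show ?thesis
    unfolding CD U
    using assoc[OF R T hom_glue[OF hom_glue[OF a b abc(1)] c abcc]] by simp
qed

text \<open>The \<open>x\<close> objects form the first layer and the \<open>y\<close> objects the
  rest, glued along \<open>m\<close>; each equation in \<open>eq\<close> is the coherence of one of
  them. The four cells are the gluing of both equations, the second hexagon, and the naturality of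
  \<open>\<beta> m j\<close> and \<open>\<beta> m i\<close>.\<close>

lemma paste_intch_intch:
  assumes ne: "i \<noteq> j" "m \<noteq> i" "m \<noteq> j"
    and o: "oadj i x1 x2" "oadj i x3 x4" "oadj j x1 x3" "oadj j x2 x4"
      "oadj i y1 y2" "oadj i y3 y4" "oadj j y1 y3" "oadj j y2 y4"
      "oadj m x1 y1" "oadj m x2 y2" "oadj m x3 y3" "oadj m x4 y4"
    and f: "hom f (x1 \<otimes>\<^sub>i x2) x12" "hom f' (x3 \<otimes>\<^sub>i x4) x34" "hom F (y1 \<otimes>\<^sub>i y2) y12" "hom F' (y3 \<otimes>\<^sub>i y4) y34"
      "adj j f f'" "adj j F F'" "adj m f F" "adj m f' F'"
    and g: "hom g (x1 \<otimes>\<^sub>j x3) x13" "hom g' (x2 \<otimes>\<^sub>j x4) x24" "hom G (y1 \<otimes>\<^sub>j y3) y13" "hom G' (y2 \<otimes>\<^sub>j y4) y24"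
      "adj i g g'" "adj i G G'" "adj m g G" "adj m g' G'"
    and h: "hom h (x12 \<otimes>\<^sub>j x34) x" "hom H (y12 \<otimes>\<^sub>j y34) y" "adj m h H"
    and k: "hom k (x13 \<otimes>\<^sub>i x24) x" "hom L (y13 \<otimes>\<^sub>i y24) y" "adj m k L"
    and eq: "h \<cdot> (f \<odot>\<^sub>j f') = k \<cdot> (g \<odot>\<^sub>i g') \<cdot> \<beta> i j x1 x2 x3 x4"
      "H \<cdot> (F \<odot>\<^sub>j F') = L \<cdot> (G \<odot>\<^sub>i G') \<cdot> \<beta> i j y1 y2 y3 y4"
  shows "((h \<odot>\<^sub>m H) \<cdot> \<beta> m j x12 y12 x34 y34) \<cdot>
      (((f \<odot>\<^sub>m F) \<cdot> \<beta> m i x1 y1 x2 y2) \<odot>\<^sub>j ((f' \<odot>\<^sub>m F') \<cdot> \<beta> m i x3 y3 x4 y4)) =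
    ((k \<odot>\<^sub>m L) \<cdot> \<beta> m i x13 y13 x24 y24) \<cdot>
      (((g \<odot>\<^sub>m G) \<cdot> \<beta> m j x1 y1 x3 y3) \<odot>\<^sub>i ((g' \<odot>\<^sub>m G') \<cdot> \<beta> m j x2 y2 x4 y4)) \<cdot>
      \<beta> i j (x1 \<otimes>\<^sub>m y1) (x2 \<otimes>\<^sub>m y2) (x3 \<otimes>\<^sub>m y3) (x4 \<otimes>\<^sub>m y4)"
proof -
  have ijm: "i \<in> K" "j \<in> K" "m \<in> K"
    using o by (auto simp: oadj_def)
  note ne' = ne[symmetric]
  note D1 = hom_intch(1)[OF ne(2) o(9,10,1,5)] and D2 = hom_intch(1)[OF ne(2) o(11,12,2,6)]
  note T1 = hom_intch(1)[OF ne(3) o(9,11,3,7)] and T2 = hom_intch(1)[OF ne(3) o(10,12,4,8)]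
  note N1 = hom_intch(1)[OF ne(1) o(1-4)] and N2 = hom_intch(1)[OF ne(1) o(5-8)]
  have aD: "adj j (\<beta> m i x1 y1 x2 y2) (\<beta> m i x3 y3 x4 y4)"
    using adj_intch[OF ne(2,3,1) o(9,10,1,5,11,12,2,6,3,7,4,8)] .
  have aT: "adj i (\<beta> m j x1 y1 x3 y3) (\<beta> m j x2 y2 x4 y4)"
    using adj_intch[OF ne(3,2) ne'(1) o(9,11,3,7,10,12,4,8,1,5,2,6)] .
  have aN: "adj m (\<beta> i j x1 x2 x3 x4) (\<beta> i j y1 y2 y3 y4)"
    using adj_intch[OF ne(1) ne'(2,3) o(1-12)] .
  note f12 = hom_glue[OF f(1,3,7)] hom_glue[OF f(2,4,8)]
  note g12 = hom_glue[OF g(1,3,7)] hom_glue[OF g(2,4,8)]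
  have aC: "adj j (f \<odot>\<^sub>m F) (f' \<odot>\<^sub>m F')"
    using adj_cross[OF ne(3) f(7,8,5,6)] .
  have aU: "adj i (g \<odot>\<^sub>m G) (g' \<odot>\<^sub>m G')"
    using adj_cross[OF ne(2) g(7,8,5,6)] .
  have aE: "adj m (f \<odot>\<^sub>j f') (F \<odot>\<^sub>j F')"
    using adj_cross[OF ne'(3) f(5-8)] .
  have aL: "adj m (g \<odot>\<^sub>i g') (G \<odot>\<^sub>i G')"
    using adj_cross[OF ne'(2) g(5-8)] .
  have CD: "((f \<odot>\<^sub>m F) \<cdot> \<beta> m i x1 y1 x2 y2) \<odot>\<^sub>j ((f' \<odot>\<^sub>m F') \<cdot> \<beta> m i x3 y3 x4 y4) =
      ((f \<odot>\<^sub>m F) \<odot>\<^sub>j (f' \<odot>\<^sub>m F')) \<cdot> (\<beta> m i x1 y1 x2 y2 \<odot>\<^sub>j \<beta> m i x3 y3 x4 y4)"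
    using interchange[OF D1 f12(1) D2 f12(2) aD aC] .
  have UT: "((g \<odot>\<^sub>m G) \<cdot> \<beta> m j x1 y1 x3 y3) \<odot>\<^sub>i ((g' \<odot>\<^sub>m G') \<cdot> \<beta> m j x2 y2 x4 y4) =
      ((g \<odot>\<^sub>m G) \<odot>\<^sub>i (g' \<odot>\<^sub>m G')) \<cdot> (\<beta> m j x1 y1 x3 y3 \<odot>\<^sub>i \<beta> m j x2 y2 x4 y4)"
    using interchange[OF T1 g12(1) T2 g12(2) aT aU] .
  note E12 = hom_glue[OF f(1,2,5)] hom_glue[OF f(3,4,6)]
  note L12 = hom_glue[OF g(1,2,5)] hom_glue[OF g(3,4,6)]
  have AE: "(h \<odot>\<^sub>m H) \<cdot> ((f \<odot>\<^sub>j f') \<odot>\<^sub>m (F \<odot>\<^sub>j F')) =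
      (k \<odot>\<^sub>m L) \<cdot> ((g \<odot>\<^sub>i g') \<odot>\<^sub>m (G \<odot>\<^sub>i G')) \<cdot> (\<beta> i j x1 x2 x3 x4 \<odot>\<^sub>m \<beta> i j y1 y2 y3 y4)"
    using interchange[OF E12(1) h(1) E12(2) h(2) aE h(3)] interchange[OF N1 L12(1) N2 L12(2) aN aL]
      interchange[OF hom_cmp[OF N1 L12(1)] k(1) hom_cmp[OF N2 L12(2)] k(2) adj_cmp[OF N1 L12(1) N2 L12(2) aN aL] k(3)] eq
    by simp
  have BC: "\<beta> m j x12 y12 x34 y34 \<cdot> ((f \<odot>\<^sub>m F) \<odot>\<^sub>j (f' \<odot>\<^sub>m F')) =
      ((f \<odot>\<^sub>j f') \<odot>\<^sub>m (F \<odot>\<^sub>j F')) \<cdot> \<beta> m j (x1 \<otimes>\<^sub>i x2) (y1 \<otimes>\<^sub>i y2) (x3 \<otimes>\<^sub>i x4) (y3 \<otimes>\<^sub>i y4)"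
    using intch_nat[OF ne(3) f(1,3,2,4,7,8,5,6)] .
  have SU: "\<beta> m i x13 y13 x24 y24 \<cdot> ((g \<odot>\<^sub>m G) \<odot>\<^sub>i (g' \<odot>\<^sub>m G')) =
      ((g \<odot>\<^sub>i g') \<odot>\<^sub>m (G \<odot>\<^sub>i G')) \<cdot> \<beta> m i (x1 \<otimes>\<^sub>j x3) (y1 \<otimes>\<^sub>j y3) (x2 \<otimes>\<^sub>j x4) (y2 \<otimes>\<^sub>j y4)"
    using intch_nat[OF ne(2) g(1,3,2,4,7,8,5,6)] .
  have hex: "(\<beta> i j x1 x2 x3 x4 \<odot>\<^sub>m \<beta> i j y1 y2 y3 y4) \<cdot>
        \<beta> m j (x1 \<otimes>\<^sub>i x2) (y1 \<otimes>\<^sub>i y2) (x3 \<otimes>\<^sub>i x4) (y3 \<otimes>\<^sub>i y4) \<cdot>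
        (\<beta> m i x1 y1 x2 y2 \<odot>\<^sub>j \<beta> m i x3 y3 x4 y4) =
      \<beta> m i (x1 \<otimes>\<^sub>j x3) (y1 \<otimes>\<^sub>j y3) (x2 \<otimes>\<^sub>j x4) (y2 \<otimes>\<^sub>j y4) \<cdot>
        (\<beta> m j x1 y1 x3 y3 \<odot>\<^sub>i \<beta> m j x2 y2 x4 y4) \<cdot>
        \<beta> i j (x1 \<otimes>\<^sub>m y1) (x2 \<otimes>\<^sub>m y2) (x3 \<otimes>\<^sub>m y3) (x4 \<otimes>\<^sub>m y4)"
    using hexagon2[OF K ijm(3,1,2) ne(2,3,1), of x1 y1 x2 y2 x3 y3 x4 y4] o ijm by (simp add: pairs_Obj)
  note oC = adj_cod[OF f(5) f(1,2)] adj_cod[OF f(6) f(3,4)] adj_cod[OF f(7) f(1,3)] adj_cod[OF f(8) f(2,4)]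
  note oU = adj_cod[OF g(5) g(1,2)] adj_cod[OF g(6) g(3,4)] adj_cod[OF g(7) g(1,3)] adj_cod[OF g(8) g(2,4)]
  note oF = adj_dom[OF f(5) f(1,2)] adj_dom[OF f(6) f(3,4)] adj_dom[OF f(7) f(1,3)] adj_dom[OF f(8) f(2,4)]
  note oQ = adj_dom[OF g(5) g(1,2)] adj_dom[OF g(6) g(3,4)] adj_dom[OF g(7) g(1,3)] adj_dom[OF g(8) g(2,4)]
  have R: "hom (\<beta> i j (x1 \<otimes>\<^sub>m y1) (x2 \<otimes>\<^sub>m y2) (x3 \<otimes>\<^sub>m y3) (x4 \<otimes>\<^sub>m y4))
      (((x1 \<otimes>\<^sub>m y1) \<otimes>\<^sub>i (x2 \<otimes>\<^sub>m y2)) \<otimes>\<^sub>j ((x3 \<otimes>\<^sub>m y3) \<otimes>\<^sub>i (x4 \<otimes>\<^sub>m y4)))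
      (((x1 \<otimes>\<^sub>m y1) \<otimes>\<^sub>j (x3 \<otimes>\<^sub>m y3)) \<otimes>\<^sub>i ((x2 \<otimes>\<^sub>m y2) \<otimes>\<^sub>j (x4 \<otimes>\<^sub>m y4)))"
    using hom_intch(1)[OF ne(1) oadj_cross[OF ne(2) o(9,10,1,5)] oadj_cross[OF ne(2) o(11,12,2,6)]
      oadj_cross[OF ne(3) o(9,11,3,7)] oadj_cross[OF ne(3) o(10,12,4,8)]] .
  note T = hom_glue[OF T1 T2 aT]
  have "((h \<odot>\<^sub>m H) \<cdot> \<beta> m j x12 y12 x34 y34) \<cdot>
      ((f \<odot>\<^sub>m F) \<odot>\<^sub>j (f' \<odot>\<^sub>m F')) \<cdot> (\<beta> m i x1 y1 x2 y2 \<odot>\<^sub>j \<beta> m i x3 y3 x4 y4) =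
    ((k \<odot>\<^sub>m L) \<cdot> \<beta> m i x13 y13 x24 y24) \<cdot>
      ((g \<odot>\<^sub>m G) \<odot>\<^sub>i (g' \<odot>\<^sub>m G')) \<cdot> (\<beta> m j x1 y1 x3 y3 \<odot>\<^sub>i \<beta> m j x2 y2 x4 y4) \<cdot>
      \<beta> i j (x1 \<otimes>\<^sub>m y1) (x2 \<otimes>\<^sub>m y2) (x3 \<otimes>\<^sub>m y3) (x4 \<otimes>\<^sub>m y4)"
    by (rule paste[OF hom_glue[OF D1 D2 aD] hom_glue[OF f12 aC] hom_intch(1)[OF ne(3) oC(3,4,1,2)]
        hom_glue[OF h] hom_intch(1)[OF ne(3) oF(3,4,1,2)] hom_glue[OF E12 aE] hom_glue[OF N1 N2 aN]
        hom_glue[OF L12 aL] hom_glue[OF k] hom_cmp[OF R T] hom_intch(1)[OF ne(2) oQ(3,4,1,2)]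
        hom_glue[OF g12 aU] hom_intch(1)[OF ne(2) oU(3,4,1,2)] BC AE hex SU])
  then show ?thesis
    unfolding CD UT using assoc[OF R T hom_glue[OF g12 aU]] by simp
qed

section \<open>The isomorphisms to the normal form\<close>

text \<open>Along \<open>l\<close> the arrow \<open>f\<close> has an identity face, so precomposing
  with it leaves the face of \<open>g\<close> unchanged.\<close>

lemma adj_cmp_rigid_left:
  assumes "adj l g h" "rigid l f" "hom f x y" "hom g y z"
  shows "adj l (g \<cdot> f) h"
proof -
  obtain x' y' where h: "hom h x' y'"
    using assms(1) by (auto simp: adj_def hom_def)
  have "oadj l x x'"
    using adj_dom[OF assms(1,4) h] rigid_cod[OF assms(2,3)] hom_obj[OF assms(3)] by (simp add: oadj_def)
  then have "adj l f (\<iota> x')"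
    using adj_id_right[OF assms(2,3)] by blast
  then show ?thesis
    using adj_cmp[OF assms(3,4) hom_id h _ assms(1)] hom_obj[OF h] cmp_id_right[OF h] by simp
qed

lemma adj_cmp_rigid_right:
  assumes "adj l h g" "rigid l f" "hom f x y" "hom g y z"
  shows "adj l h (g \<cdot> f)"
proof -
  obtain x' y' where h: "hom h x' y'"
    using assms(1) by (auto simp: adj_def hom_def)
  have "oadj l x' x"
    using adj_dom[OF assms(1) h assms(4)] rigid_cod[OF assms(2,3)] hom_obj[OF assms(3)] by (simp add: oadj_def)
  then have "adj l (\<iota> x') f"
    using adj_id_left[OF assms(2,3)] by blast
  then show ?thesis
    using adj_cmp[OF hom_id h assms(3,4) _ assms(1)] hom_obj[OF h] cmp_id_right[OF h] by simp
qed

section \<open>Values of normal forms and the splitting isomorphisms\<close>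

context
  fixes X :: "block \<Rightarrow> 'o"
begin

abbreviation "fits lo hi \<equiv> grid K Ob (so P K) (to P K) lo hi X"

text \<open>Components are taken at a fixed tuple \<open>X\<close>; naturality is established
  separately, for \<open>built_iso\<close>, in \<open>built_iso_natural\<close>.\<close>

definition val :: "block \<Rightarrow> block \<Rightarrow> 'o" where
  "val lo hi = eval (co P K) (normal lo hi) X"

lemma fits_finite: "fits lo hi \<Longrightarrow> finite (thick lo hi)"
  by (rule finite_thick[OF finite_K[OF K] grid_bounds])

lemma fits_K:
  assumes "fits lo hi" "lo i < a" "a < hi i"
  shows "i \<in> K"
proof -
  have "Suc (lo i) < hi i"
    using assms(2,3) by linarith
  then show ?thesis
    using bounds_thick[OF grid_bounds[OF assms(1)]] by blast
qed

lemma fits_hi: "fits lo hi \<Longrightarrow> lo i < a \<Longrightarrow> a < hi i \<Longrightarrow> fits lo (hi(i := a))"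
  using grid_hi fits_K by blast

lemma fits_lo: "fits lo hi \<Longrightarrow> lo i < a \<Longrightarrow> a < hi i \<Longrightarrow> fits (lo(i := a)) hi"
  using grid_lo fits_K by blast

lemma val_ob: "fits lo hi \<Longrightarrow> val lo hi \<in> Ob"
  unfolding val_def using obj.eval_tiling(1)[OF K normal_tiling[OF finite_K[OF K]]] grid_bounds by blast

lemma val_adj:
  assumes "fits lo hi" "lo i < a" "a < hi i"
  shows "oadj i (val lo (hi(i := a))) (val (lo(i := a)) hi)"
  unfolding oadj_def
  using val_ob[OF fits_hi[OF assms]] val_ob[OF fits_lo[OF assms]] fits_K[OF assms]
    obj.eval_tiling(2)[OF K normal_tiling[OF finite_K[OF K]] normal_tiling[OF finite_K[OF K]] _ _ _ _ normal_face_eq,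
      OF grid_bounds[OF fits_hi[OF assms]] grid_bounds[OF fits_lo[OF assms]] grid_bounds[OF assms(1)] _ assms(2,3,1)]
  by (simp add: val_def)

lemma val_adj3:
  assumes "fits lo hi" "lo i < a" "a < b" "b < hi i"
  shows "oadj i (val lo (hi(i := a))) (val (lo(i := a)) (hi(i := b)))"
    and "oadj i (val (lo(i := a)) (hi(i := b))) (val (lo(i := b)) hi)"
  using val_adj[OF fits_hi[of lo hi i b], of i a] val_adj[OF fits_lo[of lo hi i a], of i b] assms by auto

text \<open>Updates in \<open>i\<close> and \<open>j\<close> commute, but not for the simplifier: here \<open>j\<close> always comes first.\<close>

lemma val_adj4:
  assumes "fits lo hi" "i \<noteq> j" "lo i < a" "a < hi i" "lo j < b" "b < hi j"
  shows "oadj i (val lo (hi(j := b, i := a))) (val (lo(i := a)) (hi(j := b)))"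
    and "oadj i (val (lo(j := b)) (hi(i := a))) (val (lo(j := b, i := a)) hi)"
    and "oadj j (val lo (hi(j := b, i := a))) (val (lo(j := b)) (hi(i := a)))"
    and "oadj j (val (lo(i := a)) (hi(j := b))) (val (lo(j := b, i := a)) hi)"
proof -
  have tw: "hi(j := b, i := a) = hi(i := a, j := b)" "lo(j := b, i := a) = lo(i := a, j := b)"
    using assms(2) by (simp_all add: fun_upd_twist)
  show "oadj i (val lo (hi(j := b, i := a))) (val (lo(i := a)) (hi(j := b)))"
    "oadj i (val (lo(j := b)) (hi(i := a))) (val (lo(j := b, i := a)) hi)"
    using val_adj[OF fits_hi[OF assms(1,5,6)], of i a] val_adj[OF fits_lo[OF assms(1,5,6)], of i a] assms by simp_all
  show "oadj j (val lo (hi(j := b, i := a))) (val (lo(j := b)) (hi(i := a)))"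
    "oadj j (val (lo(i := a)) (hi(j := b))) (val (lo(j := b, i := a)) hi)"
    unfolding tw
    using val_adj[OF fits_hi[OF assms(1,3,4)], of j b] val_adj[OF fits_lo[OF assms(1,3,4)], of j b] assms by simp_all
qed

lemma val_lead:
  assumes "fits lo hi" "lead lo hi m"
  shows "val lo hi = val lo (hi(m := Suc (lo m))) \<otimes>\<^sub>m val (lo(m := Suc (lo m))) hi"
  using normal_lead[OF fits_finite[OF assms(1)] assms(2)] by (simp add: val_def)

text \<open>
  \<open>split_iso i a lo hi\<close> is the isomorphism \<open>\<sigma>\<^sub>i\<^sub>,\<^sub>a\<close> of the introduction, for the box from \<open>lo\<close> to \<open>hi\<close>;
  it is meaningful for \<open>lo i < a < hi i\<close> only.
\<close>

function split_iso :: "nat \<Rightarrow> nat \<Rightarrow> block \<Rightarrow> block \<Rightarrow> 'a" where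
  "split_iso i a lo hi = (if finite (thick lo hi) \<and> thick lo hi \<noteq> {} then
     let m = LEAST j. Suc (lo j) < hi j in
     if i \<noteq> m then
       (split_iso i a lo (hi(m := Suc (lo m))) \<odot>\<^sub>m split_iso i a (lo(m := Suc (lo m))) hi) \<cdot>
         \<beta> m i (val lo (hi(m := Suc (lo m), i := a))) (val (lo(m := Suc (lo m))) (hi(i := a)))
           (val (lo(i := a)) (hi(m := Suc (lo m)))) (val (lo(m := Suc (lo m), i := a)) hi)
     else if a = Suc (lo m) then \<iota> (val lo hi)
     else (\<iota> (val lo (hi(m := Suc (lo m)))) \<odot>\<^sub>m split_iso m a (lo(m := Suc (lo m))) hi) \<cdot>
         \<alpha> m (val lo (hi(m := Suc (lo m)))) (val (lo(m := Suc (lo m))) (hi(m := a))) (val (lo(m := a)) hi)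
     else undefined)"
  by auto
termination
  by (relation "measure (\<lambda>(i, a, lo, hi). bulk lo hi)") (auto simp: bulk_lead)

declare split_iso.simps[simp del]

lemma split_iso_lead:
  assumes "fits lo hi" "lead lo hi m"
  shows "i \<noteq> m \<Longrightarrow> split_iso i a lo hi =
       (split_iso i a lo (hi(m := Suc (lo m))) \<odot>\<^sub>m split_iso i a (lo(m := Suc (lo m))) hi) \<cdot>
         \<beta> m i (val lo (hi(m := Suc (lo m), i := a))) (val (lo(m := Suc (lo m))) (hi(i := a)))
           (val (lo(i := a)) (hi(m := Suc (lo m)))) (val (lo(m := Suc (lo m), i := a)) hi)"
    and "split_iso m (Suc (lo m)) lo hi = \<iota> (val lo hi)"
    and "a \<noteq> Suc (lo m) \<Longrightarrow> split_iso m a lo hi =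
      (\<iota> (val lo (hi(m := Suc (lo m)))) \<odot>\<^sub>m split_iso m a (lo(m := Suc (lo m))) hi) \<cdot>
         \<alpha> m (val lo (hi(m := Suc (lo m)))) (val (lo(m := Suc (lo m))) (hi(m := a))) (val (lo(m := a)) hi)"
proof -
  have *: "finite (thick lo hi) \<and> thick lo hi \<noteq> {}" "(LEAST j. Suc (lo j) < hi j) = m"
    using fits_finite[OF assms(1)] lead_Least[OF assms(2)] assms(2) by (auto simp: lead_def thick_def)
  show "i \<noteq> m \<Longrightarrow> split_iso i a lo hi =
       (split_iso i a lo (hi(m := Suc (lo m))) \<odot>\<^sub>m split_iso i a (lo(m := Suc (lo m))) hi) \<cdot>
         \<beta> m i (val lo (hi(m := Suc (lo m), i := a))) (val (lo(m := Suc (lo m))) (hi(i := a)))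
           (val (lo(i := a)) (hi(m := Suc (lo m)))) (val (lo(m := Suc (lo m), i := a)) hi)"
    using * by (subst split_iso.simps) (simp only: Let_def if_True simp_thms)
  show "split_iso m (Suc (lo m)) lo hi = \<iota> (val lo hi)"
    using * by (subst split_iso.simps) (simp only: Let_def if_True if_False simp_thms)
  show "a \<noteq> Suc (lo m) \<Longrightarrow> split_iso m a lo hi =
      (\<iota> (val lo (hi(m := Suc (lo m)))) \<odot>\<^sub>m split_iso m a (lo(m := Suc (lo m))) hi) \<cdot>
         \<alpha> m (val lo (hi(m := Suc (lo m)))) (val (lo(m := Suc (lo m))) (hi(m := a))) (val (lo(m := a)) hi)"
    using * by (subst split_iso.simps) (simp only: Let_def if_True if_False simp_thms)
qed

section \<open>Typing and matching of \<open>split_iso\<close>\<close>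

text \<open>Bundles the side conditions of the induction hypotheses below and is inherited by the
  parts of a box.\<close>

definition part :: "nat \<Rightarrow> block \<Rightarrow> block \<Rightarrow> bool" where
  "part N lo hi \<longleftrightarrow> fits lo hi \<and> bulk lo hi < N"

lemma part_hi: "part N lo hi \<Longrightarrow> lo i < a \<Longrightarrow> a < hi i \<Longrightarrow> part N lo (hi(i := a))"
  using bulk_hi[OF fits_finite] fits_hi by (fastforce simp: part_def)

lemma part_lo: "part N lo hi \<Longrightarrow> lo i < a \<Longrightarrow> a < hi i \<Longrightarrow> part N (lo(i := a)) hi"
  using bulk_lo[OF fits_finite] fits_lo by (fastforce simp: part_def)

lemma part_split:
  "fits lo hi \<Longrightarrow> lo i < a \<Longrightarrow> a < hi i \<Longrightarrow> part (bulk lo hi) lo (hi(i := a))"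
  "fits lo hi \<Longrightarrow> lo i < a \<Longrightarrow> a < hi i \<Longrightarrow> part (bulk lo hi) (lo(i := a)) hi"
  using bulk_hi[OF fits_finite] bulk_lo[OF fits_finite] fits_hi fits_lo by (auto simp: part_def)

lemma leadD: "lead lo hi m \<Longrightarrow> lo m < Suc (lo m)" "lead lo hi m \<Longrightarrow> Suc (lo m) < hi m"
  by (simp_all add: lead_def)

text \<open>The inductive step of \<open>split_iso_typing\<close> for \<open>i = m\<close>. Rigidity
  of the smaller isomorphism along \<open>m\<close> is what allows it to be whiskered with the first
  layer.\<close>

lemma split_assoc_step:
  assumes f: "fits lo hi" and m: "lead lo hi m" and a: "Suc (lo m) < a" "a < hi m"
    and h: "hom (split_iso m a (lo(m := Suc (lo m))) hi)
        (val (lo(m := Suc (lo m))) (hi(m := a)) \<otimes>\<^sub>m val (lo(m := a)) hi) (val (lo(m := Suc (lo m))) hi)"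
    and r: "rigid m (split_iso m a (lo(m := Suc (lo m))) hi)"
  shows "adj m (\<iota> (val lo (hi(m := Suc (lo m))))) (split_iso m a (lo(m := Suc (lo m))) hi)" (is ?adj)
    and "hom (\<iota> (val lo (hi(m := Suc (lo m)))) \<odot>\<^sub>m split_iso m a (lo(m := Suc (lo m))) hi)
      (val lo (hi(m := Suc (lo m))) \<otimes>\<^sub>m (val (lo(m := Suc (lo m))) (hi(m := a)) \<otimes>\<^sub>m val (lo(m := a)) hi)) (val lo hi)" (is ?hom)
    and "hom (split_iso m a lo hi) (val lo (hi(m := a)) \<otimes>\<^sub>m val (lo(m := a)) hi) (val lo hi)" (is ?hom')
    and "rigid m (split_iso m a lo hi)" (is ?rigid)
    and "iso (split_iso m a (lo(m := Suc (lo m))) hi) \<Longrightarrow> iso (split_iso m a lo hi)" (is "_ \<Longrightarrow> ?iso")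
proof -
  note o = val_adj3[OF f leadD(1)[OF m] a]
  have v1: "val lo (hi(m := Suc (lo m))) \<in> Ob" "m \<in> K"
    using o(1) by (auto simp: oadj_def)
  show adj: ?adj
    using adj_id_left[OF r h oadj_right[OF o]] .
  show hom: ?hom
    using hom_glue[OF hom_id[OF v1(1)] h adj] val_lead[OF f m] by simp
  have eq: "split_iso m a lo hi =
      (\<iota> (val lo (hi(m := Suc (lo m)))) \<odot>\<^sub>m split_iso m a (lo(m := Suc (lo m))) hi) \<cdot>
         \<alpha> m (val lo (hi(m := Suc (lo m)))) (val (lo(m := Suc (lo m))) (hi(m := a))) (val (lo(m := a)) hi)"
    using split_iso_lead(3)[OF f m] a by simp
  \<comment> \<open>The cut \<open>a\<close> lies beyond the first layer, so the half below it is
    still thick in direction \<open>m\<close>.\<close>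
  have "lead lo (hi(m := a)) m"
    using m a by (auto simp: lead_def)
  from val_lead[OF fits_hi[OF f] this] have va: "val lo (hi(m := a)) = val lo (hi(m := Suc (lo m))) \<otimes>\<^sub>m val (lo(m := Suc (lo m))) (hi(m := a))"
    using a by simp
  show ?hom'
    unfolding eq va using hom_cmp[OF hom_assoc(1)[OF o] hom] .
  show ?rigid
    unfolding eq using rigid_cmp[OF rigid_assoc[OF o] rigid_glue[OF rigid_id[OF v1(2,1)] r hom_id[OF v1(1)] h oadj_right[OF o]] hom_assoc(1)[OF o] hom] .
  show ?iso if "iso (split_iso m a (lo(m := Suc (lo m))) hi)"
    unfolding eq using iso_cmp[OF hom_assoc(2)[OF o] iso_glue(3)[OF iso_id[OF v1(1)] that adj] hom_assoc(1)[OF o] hom] .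
qed

text \<open>The inductive step of \<open>split_iso_typing\<close> for \<open>i \<noteq> m\<close>.
  The hypothesis \<open>adj\<close> is an instance of the matching half of that lemma.\<close>

lemma split_intch_step:
  assumes f: "fits lo hi" and m: "lead lo hi m" and a: "lo i < a" "a < hi i" and ne: "i \<noteq> m"
    and h: "hom (split_iso i a lo (hi(m := Suc (lo m))))
        (val lo (hi(m := Suc (lo m), i := a)) \<otimes>\<^sub>i val (lo(i := a)) (hi(m := Suc (lo m)))) (val lo (hi(m := Suc (lo m))))"
      "hom (split_iso i a (lo(m := Suc (lo m))) hi)
        (val (lo(m := Suc (lo m))) (hi(i := a)) \<otimes>\<^sub>i val (lo(m := Suc (lo m), i := a)) hi) (val (lo(m := Suc (lo m))) hi)"
    and adj: "adj m (split_iso i a lo (hi(m := Suc (lo m)))) (split_iso i a (lo(m := Suc (lo m))) hi)"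
  shows "hom (\<beta> m i (val lo (hi(m := Suc (lo m), i := a))) (val (lo(m := Suc (lo m))) (hi(i := a)))
           (val (lo(i := a)) (hi(m := Suc (lo m)))) (val (lo(m := Suc (lo m), i := a)) hi))
         (val lo (hi(i := a)) \<otimes>\<^sub>i val (lo(i := a)) hi)
         ((val lo (hi(m := Suc (lo m), i := a)) \<otimes>\<^sub>i val (lo(i := a)) (hi(m := Suc (lo m)))) \<otimes>\<^sub>m
          (val (lo(m := Suc (lo m))) (hi(i := a)) \<otimes>\<^sub>i val (lo(m := Suc (lo m), i := a)) hi))" (is ?beta)
    and "hom (split_iso i a lo (hi(m := Suc (lo m))) \<odot>\<^sub>m split_iso i a (lo(m := Suc (lo m))) hi)
         ((val lo (hi(m := Suc (lo m), i := a)) \<otimes>\<^sub>i val (lo(i := a)) (hi(m := Suc (lo m)))) \<otimes>\<^sub>m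
          (val (lo(m := Suc (lo m))) (hi(i := a)) \<otimes>\<^sub>i val (lo(m := Suc (lo m), i := a)) hi)) (val lo hi)" (is ?hom)
    and "hom (split_iso i a lo hi) (val lo (hi(i := a)) \<otimes>\<^sub>i val (lo(i := a)) hi) (val lo hi)" (is ?hom')
    and "rigid m (\<beta> m i (val lo (hi(m := Suc (lo m), i := a))) (val (lo(m := Suc (lo m))) (hi(i := a)))
           (val (lo(i := a)) (hi(m := Suc (lo m)))) (val (lo(m := Suc (lo m), i := a)) hi))" (is ?rigid)
    and "rigid i (split_iso i a lo (hi(m := Suc (lo m)))) \<Longrightarrow> rigid i (split_iso i a (lo(m := Suc (lo m))) hi) \<Longrightarrow>
      rigid i (split_iso i a lo hi)" (is "_ \<Longrightarrow> _ \<Longrightarrow> ?rigid'")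
    and "iso (split_iso i a lo (hi(m := Suc (lo m)))) \<Longrightarrow> iso (split_iso i a (lo(m := Suc (lo m))) hi) \<Longrightarrow>
      iso (split_iso i a lo hi)" (is "_ \<Longrightarrow> _ \<Longrightarrow> ?iso")
proof -
  note o = val_adj4(3,4,1,2)[OF f ne a leadD[OF m]]
  note ne' = ne[symmetric]
  \<comment> \<open>The direction \<open>i\<close> is thick as well. Since it comes after
    \<open>m\<close>, cutting along it leaves \<open>m\<close> the first thick direction of both
    halves.\<close>
  have "m < i"
    using lead_less[OF m _ ne] a by linarith
  then have "lead lo (hi(i := a)) m" "lead (lo(i := a)) hi m"
    using m by (auto simp: lead_def)
  then have v: "val lo (hi(i := a)) = val lo (hi(m := Suc (lo m), i := a)) \<otimes>\<^sub>m val (lo(m := Suc (lo m))) (hi(i := a))"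
    "val (lo(i := a)) hi = val (lo(i := a)) (hi(m := Suc (lo m))) \<otimes>\<^sub>m val (lo(m := Suc (lo m), i := a)) hi"
    using val_lead[OF fits_hi[OF f a], of m] val_lead[OF fits_lo[OF f a], of m] ne by (simp_all add: fun_upd_twist[OF ne])
  show beta: ?beta
    unfolding v using hom_intch(1)[OF ne' o] .
  show hom: ?hom
    unfolding val_lead[OF f m] using hom_glue[OF h adj] .
  note eq = split_iso_lead(1)[OF f m ne, of a]
  show ?hom'
    unfolding eq using hom_cmp[OF beta hom] .
  show ?rigid
    using rigid_intch[OF ne' o] by simp
  show ?rigid' if "rigid i (split_iso i a lo (hi(m := Suc (lo m))))" "rigid i (split_iso i a (lo(m := Suc (lo m))) hi)"
    unfolding eq using rigid_cmp[OF rigid_intch[OF ne' o, of i] rigid_cross[OF ne that h adj] beta hom] by simp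
  show ?iso if "iso (split_iso i a lo (hi(m := Suc (lo m))))" "iso (split_iso i a (lo(m := Suc (lo m))) hi)"
    unfolding eq using iso_cmp[OF hom_intch(2)[OF ne' o] iso_glue(3)[OF that adj] beta hom] .
qed

text \<open>The typing on a box glues two smaller isomorphisms along \<open>m\<close> and so needs
  that these match; the matching along \<open>l\<close> in turn unfolds the isomorphisms of both
  halves and needs their typing. Hence one induction for both.\<close>

lemma split_iso_typing:
  "fits lo hi \<Longrightarrow>
    (\<forall>i a. lo i < a \<and> a < hi i \<longrightarrow>
      hom (split_iso i a lo hi) (val lo (hi(i := a)) \<otimes>\<^sub>i val (lo(i := a)) hi) (val lo hi) \<and>
      rigid i (split_iso i a lo hi) \<and> iso (split_iso i a lo hi)) \<and>
    (\<forall>i a l b. i \<noteq> l \<and> lo i < a \<and> a < hi i \<and> lo l < b \<and> b < hi l \<longrightarrow>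
      adj l (split_iso i a lo (hi(l := b))) (split_iso i a (lo(l := b)) hi))"
proof (induction "bulk lo hi" arbitrary: lo hi rule: less_induct)
  case less
  note f = less.prems
  have IHh: "hom (split_iso i a lo' hi') (val lo' (hi'(i := a)) \<otimes>\<^sub>i val (lo'(i := a)) hi') (val lo' hi')"
    and IHr: "rigid i (split_iso i a lo' hi')" and IHi: "iso (split_iso i a lo' hi')"
    if "part (bulk lo hi) lo' hi'" "lo' i < a" "a < hi' i" for lo' hi' i a
    using less.hyps[of lo' hi'] that by (auto simp: part_def)
  have IHa: "adj l (split_iso i a lo' (hi'(l := b))) (split_iso i a (lo'(l := b)) hi')"
    if "part (bulk lo hi) lo' hi'" "i \<noteq> l" "lo' i < a" "a < hi' i" "lo' l < b" "b < hi' l" for lo' hi' i a l b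
    using less.hyps[of lo' hi'] that by (auto simp: part_def)
  have IHh4: "hom (split_iso i a lo' (hi'(m := s)))
        (val lo' (hi'(m := s, i := a)) \<otimes>\<^sub>i val (lo'(i := a)) (hi'(m := s))) (val lo' (hi'(m := s)))"
      "hom (split_iso i a (lo'(m := s)) hi')
        (val (lo'(m := s)) (hi'(i := a)) \<otimes>\<^sub>i val (lo'(m := s, i := a)) hi') (val (lo'(m := s)) hi')"
    if "part (bulk lo hi) lo' (hi'(m := s))" "part (bulk lo hi) (lo'(m := s)) hi'" "lo' i < a" "a < hi' i" "i \<noteq> m"
    for lo' hi' i a m s
    using IHh[OF that(1), of i a] IHh[OF that(2), of i a] that by simp_all
  have adjS: "adj l (split_iso i a lo (hi(l := b))) (split_iso i a (lo(l := b)) hi)"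
    if il: "i \<noteq> l" and a: "lo i < a" "a < hi i" and b: "lo l < b" "b < hi l" for i a l b
  proof -
    let ?L = "hi(l := b)" and ?R = "lo(l := b)"
    note pL = part_split(1)[OF f b] and pR = part_split(2)[OF f b]
    have fL: "fits lo ?L" and fR: "fits ?R hi"
      using pL pR by (auto simp: part_def)
    have aL: "lo i < a" "a < ?L i" and aR: "?R i < a" "a < hi i"
      using a il by auto
    \<comment> \<open>The lower half has a leading direction because \<open>i\<close> is thick in
      it. If this is not \<open>l\<close>, and the upper half does not lead with \<open>l\<close>
      either, both lead with the same \<open>m\<close>: apart from \<open>l\<close> they have the
      same thick directions.\<close>
    consider (left) "lead lo ?L l" | (right) "lead ?R hi l" | (both) m where "lead lo ?L m" "lead ?R hi m" "m \<noteq> l"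
    proof -
      have "i \<in> thick lo ?L"
        using aL by (auto simp: thick_def)
      then obtain m where m: "lead lo ?L m"
        using lead_exists by blast
      show ?thesis
      proof (cases "m = l \<or> lead ?R hi l")
        case False
        have "lead ?R hi m"
          unfolding lead_def
        proof (intro conjI allI impI notI)
          show "Suc (?R m) < hi m"
            using m False by (auto simp: lead_def)
          fix j assume j: "j < m" "Suc (?R j) < hi j"
          have thin: "\<not> Suc (lo k) < hi k" if "k < m" "k \<noteq> l" for k
            using m that unfolding lead_def by (metis fun_upd_other)
          have "j = l"
            using thin[of j] j by (cases "j = l") auto
          then have "lead ?R hi l"
            using j thin less_trans[of _ l m] by (auto simp: lead_def)
          then show False
            using False by blast
        qed
        then show ?thesis
          using m False both by blast
      qed (use m left right in blast)
    qed
    then show ?thesis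
    proof cases
      case left
      let ?s = "Suc (lo l)"
      note s = leadD[OF left]
      have s': "?s < b" "?s < hi l"
        using s b by auto
      \<comment> \<open>The lower half unfolds along \<open>l\<close> itself. Its
        \<open>\<beta>\<close> is rigid along \<open>l\<close>, so only the piece next to the cut
        has to match the upper half.\<close>
      have 1: "adj l (split_iso i a lo (?L(l := ?s))) (split_iso i a (lo(l := ?s)) ?L)"
        using IHa[OF pL il aL s] .
      have 2: "adj l (split_iso i a (lo(l := ?s)) ?L) (split_iso i a ?R hi)"
        using IHa[OF part_split(2)[OF f s(1) s'(2)] il, of a b] s' b a il by simp
      note st = split_intch_step[OF fL left aL il IHh4[OF part_hi[OF pL s] part_lo[OF pL s] aL il] 1]
      show ?thesis
        unfolding split_iso_lead(1)[OF fL left il] using adj_cmp_rigid_left[OF adj_left[OF 1 2] st(4,1,2)] .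
    next
      case right
      let ?s = "Suc (?R l)"
      note s = leadD[OF right]
      have s': "lo l < ?s" "b < ?s" "?s < hi l"
        using s b by auto
      have 1: "adj l (split_iso i a ?R (hi(l := ?s))) (split_iso i a (?R(l := ?s)) hi)"
        using IHa[OF pR il aR s] .
      have 2: "adj l (split_iso i a lo ?L) (split_iso i a ?R (hi(l := ?s)))"
        using IHa[OF part_split(1)[OF f s'(1,3)] il, of a b] s' b a il by simp
      note st = split_intch_step[OF fR right aR il IHh4[OF part_hi[OF pR s] part_lo[OF pR s] aR il] 1]
      show ?thesis
        unfolding split_iso_lead(1)[OF fR right il] using adj_cmp_rigid_right[OF adj_right[OF 2 1] st(4,1,2)] .
    next
      case (both m)
      note ml = both(3)
      let ?s = "Suc (lo m)"
      have Rm: "?R m = lo m" "?L m = hi m"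
        using ml by simp_all
      note sL = leadD[OF both(1)] and sR = leadD[OF both(2)]
      have s: "lo m < ?s" "?s < hi m"
        using sL Rm by auto
      have twL: "hi(l := b, m := c) = hi(m := c, l := b)" and twR: "lo(l := b, m := c) = lo(m := c, l := b)" for c
        using ml by (simp_all add: fun_upd_twist)
      note pU = part_split(1)[OF f s] and pV = part_split(2)[OF f s]
      have fU: "fits lo (hi(m := ?s))" and fV: "fits (lo(m := ?s)) hi"
        using pU pV by (auto simp: part_def)
      have bU: "lo l < b" "b < (hi(m := ?s)) l"
        using b ml by auto
      \<comment> \<open>Both recursions unfold along the same \<open>m\<close>. The associators or
        interchangers of the two halves match along \<open>l\<close>, because \<open>l\<close> is
        none of their directions.\<close>
      show ?thesis
      proof (cases "i = m")
        case im: True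
        show ?thesis
        proof (cases "a = ?s")
          case True
          then show ?thesis
            using split_iso_lead(2)[OF fL both(1)] split_iso_lead(2)[OF fR both(2)] im Rm adj_id[OF val_adj[OF f b]] by simp
        next
          case False
          then have a': "?s < a" "a < hi m" "a < ?L m"
            using a im Rm by auto
          let ?l = "split_iso m a (lo(m := ?s)) ?L" and ?r = "split_iso m a (?R(m := ?s)) hi"
          have pL': "part (bulk lo hi) (lo(m := ?s)) ?L" and pR': "part (bulk lo hi) (?R(m := ?s)) hi"
            using part_lo[OF pL sL] part_lo[OF pR sR] Rm by simp_all
          have hl: "hom ?l (val (lo(m := ?s)) (?L(m := a)) \<otimes>\<^sub>m val (lo(m := a)) ?L) (val (lo(m := ?s)) ?L)" "rigid m ?l"
            using IHh[OF pL', of m a] IHr[OF pL', of m a] a' by simp_all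
          have hr: "hom ?r (val (?R(m := ?s)) (hi(m := a)) \<otimes>\<^sub>m val (?R(m := a)) hi) (val (?R(m := ?s)) hi)" "rigid m ?r"
            using IHh[OF pR', of m a] IHr[OF pR', of m a] a' by simp_all
          note stl = split_assoc_step[OF fL both(1) a'(1,3) hl]
          note str = split_assoc_step[OF fR both(2), unfolded Rm, OF a'(1,2) hr]
          have 1: "adj l ?l ?r"
            using IHa[OF pV, of m l a b] ml a' b by (simp add: twR)
          have 2: "oadj l (val lo (?L(m := ?s))) (val ?R (hi(m := ?s)))"
            using val_adj[OF fU bU] by (simp add: twL)
          have 3: "oadj l (val (lo(m := ?s)) (?L(m := a))) (val (?R(m := ?s)) (hi(m := a)))"
            using val_adj[OF fits_hi[OF fV, of m a], of l b] a' b ml by (simp add: twL twR)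
          have 4: "oadj l (val (lo(m := a)) ?L) (val (?R(m := a)) hi)"
            using val_adj[OF fits_lo[OF f, of m a], of l b] a' b ml by (simp add: twR)
          note oL = val_adj3[OF fL sL(1) a'(1,3)] and oR = val_adj3[OF fR sR(1), unfolded Rm, OF a'(1,2)]
          have 5: "adj l (\<alpha> m (val lo (?L(m := ?s))) (val (lo(m := ?s)) (?L(m := a))) (val (lo(m := a)) ?L))
              (\<alpha> m (val ?R (hi(m := ?s))) (val (?R(m := ?s)) (hi(m := a))) (val (?R(m := a)) hi))"
            using adj_assoc[OF ml oL oR 2 3 4] .
          have 6: "adj l (\<iota> (val lo (?L(m := ?s))) \<odot>\<^sub>m ?l) (\<iota> (val ?R (hi(m := ?s))) \<odot>\<^sub>m ?r)"
            using adj_cross[OF ml stl(1) str(1) adj_id[OF 2] 1] .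
          show ?thesis
            using adj_cmp[OF hom_assoc(1)[OF oL] stl(2) hom_assoc(1)[OF oR] str(2) 5 6]
              split_iso_lead(3)[OF fL both(1)] split_iso_lead(3)[OF fR both(2)] im Rm False by simp
        qed
      next
        case im: False
        let ?l1 = "split_iso i a lo (?L(m := ?s))" and ?l2 = "split_iso i a (lo(m := ?s)) ?L"
        let ?r1 = "split_iso i a ?R (hi(m := ?s))" and ?r2 = "split_iso i a (?R(m := ?s)) hi"
        have l12: "adj m ?l1 ?l2"
          using IHa[OF pL im aL sL] .
        have r12: "adj m ?r1 ?r2"
          using IHa[OF pR im aR sR] Rm by simp
        have lr1: "adj l ?l1 ?r1"
          using IHa[OF pU il, of a b] a b im ml by (simp add: twL)
        have lr2: "adj l ?l2 ?r2"
          using IHa[OF pV il, of a b] a b im ml by (simp add: twR)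
        note stl = split_intch_step[OF fL both(1) aL im IHh4[OF part_hi[OF pL sL] part_lo[OF pL sL] aL im] l12]
        note str = split_intch_step[OF fR both(2), unfolded Rm, OF aR im
            IHh4[OF part_hi[OF pR sR, unfolded Rm] part_lo[OF pR sR, unfolded Rm] aR im] r12]
        have 1: "adj l (?l1 \<odot>\<^sub>m ?l2) (?r1 \<odot>\<^sub>m ?r2)"
          using adj_cross[OF ml l12 r12 lr1 lr2] .
        note oL = val_adj4(3,4,1,2)[OF fL im aL sL] and oR = val_adj4(3,4,1,2)[OF fR im aR sR, unfolded Rm]
        have tw3: "g(l := b, i := a) = g(i := a, l := b)" for g :: block
          using il by (simp add: fun_upd_twist)
        have fU': "fits lo (hi(m := ?s, i := a))" "fits (lo(i := a)) (hi(m := ?s))"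
          using fits_hi[OF fU, of i a] fits_lo[OF fU, of i a] a im by simp_all
        have fV': "fits (lo(m := ?s)) (hi(i := a))" "fits (lo(m := ?s, i := a)) hi"
          using fits_hi[OF fV, of i a] fits_lo[OF fV, of i a] a im by simp_all
        have o4: "oadj l (val lo (?L(m := ?s, i := a))) (val ?R (hi(m := ?s, i := a)))"
          "oadj l (val (lo(m := ?s)) (?L(i := a))) (val (?R(m := ?s)) (hi(i := a)))"
          "oadj l (val (lo(i := a)) (?L(m := ?s))) (val (?R(i := a)) (hi(m := ?s)))"
          "oadj l (val (lo(m := ?s, i := a)) ?L) (val (?R(m := ?s, i := a)) hi)"
          using val_adj[OF fU'(1), of l b] val_adj[OF fV'(1), of l b] val_adj[OF fU'(2), of l b] val_adj[OF fV'(2), of l b]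
            b ml il by (simp_all add: tw3 twL twR)
        have 2: "adj l (\<beta> m i (val lo (?L(m := ?s, i := a))) (val (lo(m := ?s)) (?L(i := a)))
              (val (lo(i := a)) (?L(m := ?s))) (val (lo(m := ?s, i := a)) ?L))
            (\<beta> m i (val ?R (hi(m := ?s, i := a))) (val (?R(m := ?s)) (hi(i := a)))
              (val (?R(i := a)) (hi(m := ?s))) (val (?R(m := ?s, i := a)) hi))"
          using adj_intch[OF im[symmetric] ml il oL oR o4] .
        show ?thesis
          unfolding split_iso_lead(1)[OF fL both(1) im] split_iso_lead(1)[OF fR both(2) im] Rm
          using adj_cmp[OF stl(1,2) str(1,2) 2 1] .
      qed
    qed
  qed
  have "hom (split_iso i a lo hi) (val lo (hi(i := a)) \<otimes>\<^sub>i val (lo(i := a)) hi) (val lo hi) \<and>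
      rigid i (split_iso i a lo hi) \<and> iso (split_iso i a lo hi)" if a: "lo i < a" "a < hi i" for i a
  proof -
    have "i \<in> thick lo hi"
      using a by (auto simp: thick_def)
    then obtain m where m: "lead lo hi m"
      using lead_exists by blast
    note s = leadD[OF m]
    note p = part_split[OF f s]
    show ?thesis
    proof (cases "i = m")
      case im: True
      show ?thesis
      proof (cases "a = Suc (lo m)")
        case True
        then show ?thesis
          using split_iso_lead(2)[OF f m] im val_lead[OF f m] val_ob[OF f] fits_K[OF f a] hom_id[of "val lo hi"] rigid_id iso_id
          by simp
      next
        case False
        then have a': "Suc (lo m) < a" "a < hi m"
          using a im by auto
        show ?thesis
          using split_assoc_step[OF f m a'] IHh[OF p(2), of m a] IHr[OF p(2), of m a] IHi[OF p(2), of m a] a' im by simp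
      qed
    next
      case im: False
      note st = split_intch_step[OF f m a im IHh4[OF p a im] adjS[OF im a s]]
      show ?thesis
        using st(3,5,6) IHr[OF p(1), of i a] IHr[OF p(2), of i a] IHi[OF p(1), of i a] IHi[OF p(2), of i a] a im by simp
    qed
  qed
  then show ?case
    using adjS by blast
qed

lemma split_hom:
  assumes "fits lo hi" "lo i < a" "a < hi i"
  shows "hom (split_iso i a lo hi) (val lo (hi(i := a)) \<otimes>\<^sub>i val (lo(i := a)) hi) (val lo hi)"
    and "rigid i (split_iso i a lo hi)" and "iso (split_iso i a lo hi)"
  using split_iso_typing[OF assms(1)] assms(2,3) by blast+

lemma split_adj: "fits lo hi \<Longrightarrow> i \<noteq> l \<Longrightarrow> lo i < a \<Longrightarrow> a < hi i \<Longrightarrow> lo l < b \<Longrightarrow> b < hi l \<Longrightarrow>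
    adj l (split_iso i a lo (hi(l := b))) (split_iso i a (lo(l := b)) hi)"
  using split_iso_typing by blast

section \<open>Coherence of \<open>split_iso\<close> with associators\<close>

lemma split_coherence_assoc:
  assumes "fits lo hi" "lo i < a" "a < b" "b < hi i"
  shows "split_iso i b lo hi \<cdot> (split_iso i a lo (hi(i := b)) \<odot>\<^sub>i \<iota> (val (lo(i := b)) hi)) =
    split_iso i a lo hi \<cdot> (\<iota> (val lo (hi(i := a))) \<odot>\<^sub>i split_iso i b (lo(i := a)) hi) \<cdot>
      \<alpha> i (val lo (hi(i := a))) (val (lo(i := a)) (hi(i := b))) (val (lo(i := b)) hi)"
  using assms
proof (induction "bulk lo hi" arbitrary: lo hi rule: less_induct)
  case less
  note f = less.prems(1) and ab = less.prems(2-4)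
  note a = ab(1) less_trans[OF ab(2,3)] and b = less_trans[OF ab(1,2)] ab(3)
  have "i \<in> thick lo hi"
    using ab by (auto simp: thick_def)
  then obtain m where m: "lead lo hi m"
    using lead_exists by blast
  note s = leadD[OF m]
  note p = part_split[OF f s]
  let ?s = "Suc (lo m)"
  note fits_b = fits_hi[OF f b] and fits_a = fits_lo[OF f a] and fV = fits_lo[OF f s] and fU = fits_hi[OF f s]
  show ?case
  proof (cases "i = m")
    case im: True
    have mb: "lead lo (hi(i := b)) m"
      using m ab im by (auto simp: lead_def)
    note o3 = val_adj3[OF f ab]
    show ?thesis
    proof (cases "a = ?s")
      case True
      \<comment> \<open>The first slab is a single layer: both isomorphisms with cut
        \<open>a\<close> are identities, and the claim is the recursion equation of
        \<open>split_iso m b lo hi\<close>.\<close>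
      have "?s \<noteq> b"
        using ab True by simp
      then have eq: "split_iso m b lo hi = (\<iota> (val lo (hi(m := ?s))) \<odot>\<^sub>m split_iso m b (lo(m := ?s)) hi) \<cdot>
         \<alpha> m (val lo (hi(m := ?s))) (val (lo(m := ?s)) (hi(m := b))) (val (lo(m := b)) hi)"
        using split_iso_lead(3)[OF f m] by simp
      have e1: "split_iso i a lo (hi(i := b)) \<odot>\<^sub>i \<iota> (val (lo(i := b)) hi) = \<iota> (val lo (hi(i := b)) \<otimes>\<^sub>i val (lo(i := b)) hi)"
        using split_iso_lead(2)[OF fits_b mb] glue_id[OF val_adj[OF f b]] True im by simp
      have e2: "split_iso i a lo hi = \<iota> (val lo hi)"
        using split_iso_lead(2)[OF f m] True im by simp
      have "hom (\<iota> (val lo (hi(i := a))) \<odot>\<^sub>i split_iso i b (lo(i := a)) hi)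
        (val lo (hi(i := a)) \<otimes>\<^sub>i (val (lo(i := a)) (hi(i := b)) \<otimes>\<^sub>i val (lo(i := b)) hi)) (val lo hi)"
        using split_assoc_step(2)[OF f m, of b] split_hom[OF fV, of m b] ab im True by simp
      note h = hom_cmp[OF hom_assoc(1)[OF o3] this]
      show ?thesis
        unfolding e1 e2 using cmp_id_right[OF split_hom(1)[OF f b]] cmp_id_left[OF h] eq im True by simp
    next
      case False
      then have sa: "?s < a" "?s < b"
        using ab im by auto
      \<comment> \<open>The first slab has several layers: the induction hypothesis is used for the
        box above the first of them, and that layer is the \<open>u\<close> of
        \<open>paste_pentagon\<close>.\<close>
      have IH: "split_iso m b (lo(m := ?s)) hi \<cdot> (split_iso m a (lo(m := ?s)) (hi(m := b)) \<odot>\<^sub>m \<iota> (val (lo(m := b)) hi)) =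
        split_iso m a (lo(m := ?s)) hi \<cdot> (\<iota> (val (lo(m := ?s)) (hi(m := a))) \<odot>\<^sub>m split_iso m b (lo(m := a)) hi) \<cdot>
        \<alpha> m (val (lo(m := ?s)) (hi(m := a))) (val (lo(m := a)) (hi(m := b))) (val (lo(m := b)) hi)"
        using less.hyps[of "lo(m := ?s)" hi] p sa ab im fV by (simp add: part_def)
      have hp: "hom (split_iso m a (lo(m := ?s)) (hi(m := b))) (val (lo(m := ?s)) (hi(m := a)) \<otimes>\<^sub>m val (lo(m := a)) (hi(m := b)))
          (val (lo(m := ?s)) (hi(m := b)))" "rigid m (split_iso m a (lo(m := ?s)) (hi(m := b)))"
        using split_hom[OF fits_hi[OF fV, of m b], of m a] sa ab im by simp_all
      have hq: "hom (split_iso m b (lo(m := ?s)) hi) (val (lo(m := ?s)) (hi(m := b)) \<otimes>\<^sub>m val (lo(m := b)) hi)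
          (val (lo(m := ?s)) hi)" "rigid m (split_iso m b (lo(m := ?s)) hi)"
        using split_hom[OF fV, of m b] sa ab im by simp_all
      have hr: "hom (split_iso m b (lo(m := a)) hi) (val (lo(m := a)) (hi(m := b)) \<otimes>\<^sub>m val (lo(m := b)) hi)
          (val (lo(m := a)) hi)" "rigid m (split_iso m b (lo(m := a)) hi)"
        using split_hom[OF fits_a, of m b] ab im by simp_all
      have hs: "hom (split_iso m a (lo(m := ?s)) hi) (val (lo(m := ?s)) (hi(m := a)) \<otimes>\<^sub>m val (lo(m := a)) hi)
          (val (lo(m := ?s)) hi)" "rigid m (split_iso m a (lo(m := ?s)) hi)"
        using split_hom[OF fV, of m a] sa ab im by simp_all
      have o: "oadj m (val lo (hi(m := ?s))) (val (lo(m := ?s)) (hi(m := a)))"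
        "oadj m (val (lo(m := ?s)) (hi(m := a))) (val (lo(m := a)) (hi(m := b)))"
        "oadj m (val (lo(m := a)) (hi(m := b))) (val (lo(m := b)) hi)"
        using val_adj3(1)[OF f s(1) sa(1), of] val_adj3[OF fV, of m a b] sa ab im by simp_all
      note paste_pentagon[OF o hp hq hr hs IH]
      moreover have "split_iso m b lo hi = (\<iota> (val lo (hi(m := ?s))) \<odot>\<^sub>m split_iso m b (lo(m := ?s)) hi) \<cdot>
         \<alpha> m (val lo (hi(m := ?s))) (val (lo(m := ?s)) (hi(m := b))) (val (lo(m := b)) hi)"
        using split_iso_lead(3)[OF f m] sa by simp
      moreover have "split_iso m a lo hi = (\<iota> (val lo (hi(m := ?s))) \<odot>\<^sub>m split_iso m a (lo(m := ?s)) hi) \<cdot>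
         \<alpha> m (val lo (hi(m := ?s))) (val (lo(m := ?s)) (hi(m := a))) (val (lo(m := a)) hi)"
        using split_iso_lead(3)[OF f m] sa by simp
      moreover have "split_iso m a lo (hi(m := b)) = (\<iota> (val lo (hi(m := ?s))) \<odot>\<^sub>m split_iso m a (lo(m := ?s)) (hi(m := b))) \<cdot>
         \<alpha> m (val lo (hi(m := ?s))) (val (lo(m := ?s)) (hi(m := a))) (val (lo(m := a)) (hi(m := b)))"
        using split_iso_lead(3)[OF fits_b mb, of a] sa im by simp
      moreover have "lead lo (hi(m := a)) m"
        using m sa by (auto simp: lead_def)
      then have "val lo (hi(m := a)) = val lo (hi(m := ?s)) \<otimes>\<^sub>m val (lo(m := ?s)) (hi(m := a))"
        using val_lead[OF fits_hi[OF f a], of m] im by simp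
      ultimately show ?thesis
        using im by simp
    qed
  next
    case im: False
    let ?U = "hi(m := ?s)" and ?V = "lo(m := ?s)"
    \<comment> \<open>The slabs and their unions all keep \<open>m\<close> as leading direction, so
      every isomorphism and value in the claim unfolds along \<open>m\<close>.\<close>
    have "m < i"
      using lead_less[OF m _ im] ab by linarith
    then have mb: "lead lo (hi(i := b)) m" and ma: "lead (lo(i := a)) hi m"
      and mz: "lead (lo(i := b)) hi m" and mx: "lead lo (hi(i := a)) m" and my: "lead (lo(i := a)) (hi(i := b)) m"
      using m by (auto simp: lead_def)
    have twh: "hi(i := c, m := ?s) = ?U(i := c)" and twl: "lo(i := c, m := ?s) = ?V(i := c)" for c
      using im by (simp_all add: fun_upd_twist)
    have abU: "lo i < a" "a < b" "b < ?U i" and abV: "?V i < a" "a < b" "b < hi i"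
      using ab im by auto
    note aU = abU(1) less_trans[OF abU(2,3)] and bU = less_trans[OF abU(1,2)] abU(3)
    note aV = abV(1) less_trans[OF abV(2,3)] and bV = less_trans[OF abV(1,2)] abV(3)
    note IHU = less.hyps[of lo ?U, OF _ fU abU] and IHV = less.hyps[of ?V hi, OF _ fV abV]
    have sm: "bulk lo ?U < bulk lo hi" "bulk ?V hi < bulk lo hi"
      using p by (simp_all add: part_def)
    note oU = val_adj3[OF fU abU] and oV = val_adj3[OF fV abV]
    note fits_z = fits_lo[OF f b] and fits_x = fits_hi[OF f a]
    have fits_y: "fits (lo(i := a)) (hi(i := b))"
      using fits_hi[OF fits_a, of i b] ab by simp
    have ox: "oadj m (val lo (?U(i := a))) (val ?V (hi(i := a)))"
      using val_adj[OF fits_x, of m ?s] im s by (simp add: twh)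
    have oy: "oadj m (val (lo(i := a)) (?U(i := b))) (val (?V(i := a)) (hi(i := b)))"
      using val_adj[OF fits_y, of m ?s] im s by (simp add: twh twl)
    have oz: "oadj m (val (lo(i := b)) ?U) (val (?V(i := b)) hi)"
      using val_adj[OF fits_z, of m ?s] im s by (simp add: twl)
    note hpU = split_hom[OF fits_hi[OF fU bU], of i a] and hpV = split_hom[OF fits_hi[OF fV bV], of i a]
    note hrU = split_hom[OF fits_lo[OF fU aU], of i b] and hrV = split_hom[OF fits_lo[OF fV aV], of i b]
    have hp: "hom (split_iso i a lo (?U(i := b))) (val lo (?U(i := a)) \<otimes>\<^sub>i val (lo(i := a)) (?U(i := b))) (val lo (?U(i := b)))"
      "rigid i (split_iso i a lo (?U(i := b)))"
      "hom (split_iso i a ?V (hi(i := b))) (val ?V (hi(i := a)) \<otimes>\<^sub>i val (?V(i := a)) (hi(i := b))) (val ?V (hi(i := b)))"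
      "rigid i (split_iso i a ?V (hi(i := b)))"
      using hpU hpV ab im by simp_all
    have pp: "adj m (split_iso i a lo (?U(i := b))) (split_iso i a ?V (hi(i := b)))"
      using split_adj[OF fits_b im, of a ?s] ab s im by (simp add: twh)
    have hr: "hom (split_iso i b (lo(i := a)) ?U) (val (lo(i := a)) (?U(i := b)) \<otimes>\<^sub>i val (lo(i := b)) ?U) (val (lo(i := a)) ?U)"
      "rigid i (split_iso i b (lo(i := a)) ?U)"
      "hom (split_iso i b (?V(i := a)) hi) (val (?V(i := a)) (hi(i := b)) \<otimes>\<^sub>i val (?V(i := b)) hi) (val (?V(i := a)) hi)"
      "rigid i (split_iso i b (?V(i := a)) hi)"
      using hrU hrV ab im by simp_all
    have rr: "adj m (split_iso i b (lo(i := a)) ?U) (split_iso i b (?V(i := a)) hi)"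
      using split_adj[OF fits_a im, of b ?s] ab s im by (simp add: twl)
    note hq = split_hom(1)[OF fU bU] split_hom(1)[OF fV bV] split_adj[OF f im b s]
    note hs = split_hom(1)[OF fU aU] split_hom(1)[OF fV aV] split_adj[OF f im a s]
    note P = paste_assoc_intch[OF im oU(1,2) oV(1,2) ox oy oz hp pp hq hr rr hs IHU[OF sm(1)] IHV[OF sm(2)]]
    have v: "val (lo(i := b)) hi = val (lo(i := b)) ?U \<otimes>\<^sub>m val (?V(i := b)) hi"
      "val lo (hi(i := a)) = val lo (?U(i := a)) \<otimes>\<^sub>m val ?V (hi(i := a))"
      "val (lo(i := a)) (hi(i := b)) = val (lo(i := a)) (?U(i := b)) \<otimes>\<^sub>m val (?V(i := a)) (hi(i := b))"
      using val_lead[OF fits_z mz] val_lead[OF fits_x mx] val_lead[OF fits_y my] im by (simp_all add: twh twl)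
    have e1: "split_iso i a lo (hi(i := b)) = (split_iso i a lo (?U(i := b)) \<odot>\<^sub>m split_iso i a ?V (hi(i := b))) \<cdot>
        \<beta> m i (val lo (?U(i := a))) (val ?V (hi(i := a))) (val (lo(i := a)) (?U(i := b))) (val (?V(i := a)) (hi(i := b)))"
      using split_iso_lead(1)[OF fits_b mb im, of a] im by (simp add: twh)
    have e2: "split_iso i b (lo(i := a)) hi = (split_iso i b (lo(i := a)) ?U \<odot>\<^sub>m split_iso i b (?V(i := a)) hi) \<cdot>
        \<beta> m i (val (lo(i := a)) (?U(i := b))) (val (?V(i := a)) (hi(i := b))) (val (lo(i := b)) ?U) (val (?V(i := b)) hi)"
      using split_iso_lead(1)[OF fits_a ma im, of b] im by (simp add: twl)
    show ?thesis
      unfolding e1 e2 v split_iso_lead(1)[OF f m im] using P .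
  qed
qed

section \<open>Coherence of \<open>split_iso\<close> with interchangers\<close>

text \<open>The square comparing two ways to merge four boxes, along \<open>i\<close> first or along
  \<open>j\<close> first. It gets a name because its symmetry in the two cuts halves the case
  analysis.\<close>

definition intch_coherent :: "nat \<Rightarrow> nat \<Rightarrow> nat \<Rightarrow> nat \<Rightarrow> block \<Rightarrow> block \<Rightarrow> bool" where
  "intch_coherent i a j b lo hi \<longleftrightarrow>
    split_iso j b lo hi \<cdot> (split_iso i a lo (hi(j := b)) \<odot>\<^sub>j split_iso i a (lo(j := b)) hi) =
    split_iso i a lo hi \<cdot> (split_iso j b lo (hi(i := a)) \<odot>\<^sub>i split_iso j b (lo(i := a)) hi) \<cdot>
      \<beta> i j (val lo (hi(j := b, i := a))) (val (lo(i := a)) (hi(j := b)))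
        (val (lo(j := b)) (hi(i := a))) (val (lo(j := b, i := a)) hi)"

lemma split_hom2:
  assumes "fits lo hi" "i \<noteq> j" "lo i < a" "a < hi i" "lo j < b" "b < hi j"
  shows "hom (split_iso i a lo (hi(j := b))) (val lo (hi(j := b, i := a)) \<otimes>\<^sub>i val (lo(i := a)) (hi(j := b))) (val lo (hi(j := b)))"
    and "hom (split_iso i a (lo(j := b)) hi) (val (lo(j := b)) (hi(i := a)) \<otimes>\<^sub>i val (lo(j := b, i := a)) hi) (val (lo(j := b)) hi)"
    and "rigid i (split_iso i a lo (hi(j := b)))" and "rigid i (split_iso i a (lo(j := b)) hi)"
  using split_hom[OF fits_hi[OF assms(1,5,6)], of i a] split_hom[OF fits_lo[OF assms(1,5,6)], of i a] assms by simp_all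

text \<open>The interchangers \<open>\<beta> i j\<close> and \<open>\<beta> j i\<close> are inverse
  to each other; composing the square with the latter exchanges the two cuts.\<close>

lemma intch_coherent_swap:
  assumes "fits lo hi" "i \<noteq> j" "lo i < a" "a < hi i" "lo j < b" "b < hi j" "intch_coherent i a j b lo hi"
  shows "intch_coherent j b i a lo hi"
proof -
  have tw: "g(j := c, i := d) = g(i := d, j := c)" for g :: block and c d
    using assms(2) by (simp add: fun_upd_twist)
  note ij = assms(3-6) and ji = assms(5,6,3,4) and ne = assms(2) assms(2)[symmetric] and f = assms(1)
  note o = val_adj4[OF f ne(1) ij]
  let ?b = "\<beta> i j (val lo (hi(j := b, i := a))) (val (lo(i := a)) (hi(j := b)))
        (val (lo(j := b)) (hi(i := a))) (val (lo(j := b, i := a)) hi)"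
  let ?b' = "\<beta> j i (val lo (hi(j := b, i := a))) (val (lo(j := b)) (hi(i := a)))
        (val (lo(i := a)) (hi(j := b))) (val (lo(j := b, i := a)) hi)"
  let ?A = "split_iso j b lo hi" and ?B = "split_iso i a lo (hi(j := b)) \<odot>\<^sub>j split_iso i a (lo(j := b)) hi"
  let ?C = "split_iso i a lo hi" and ?D = "split_iso j b lo (hi(i := a)) \<odot>\<^sub>i split_iso j b (lo(i := a)) hi"
  note hb = hom_intch(1)[OF ne(1) o(1-4)]
  note hb' = hom_intch(1)[OF ne(2) o(3,4,1,2)]
  note hB = hom_glue[OF split_hom2(1,2)[OF f ne(1) ij] split_adj[OF f ne(1) ij]]
  have hD: "hom ?D ((val lo (hi(j := b, i := a)) \<otimes>\<^sub>j val (lo(j := b)) (hi(i := a))) \<otimes>\<^sub>i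
     (val (lo(i := a)) (hi(j := b)) \<otimes>\<^sub>j val (lo(j := b, i := a)) hi)) (val lo (hi(i := a)) \<otimes>\<^sub>i val (lo(i := a)) hi)"
    using hom_glue[OF split_hom2(1,2)[OF f ne(2) ji] split_adj[OF f ne(2) ji]] by (simp add: tw)
  note hC = split_hom(1)[OF f ij(1,2)] and hA = split_hom(1)[OF f ij(3,4)]
  have "?A \<cdot> ?B \<cdot> ?b' = (?C \<cdot> ?D \<cdot> ?b) \<cdot> ?b'"
    using assms(7) assoc[OF hb' hB hA] by (simp add: intch_coherent_def)
  also have "\<dots> = ?C \<cdot> ?D"
    using assoc[OF hb' hom_cmp[OF hb hD] hC] assoc[OF hb' hb hD] intch_swap[OF ne(1) o(1-4)] cmp_id_right[OF hD] by simp
  finally show ?thesis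
    unfolding intch_coherent_def by (simp add: tw)
qed

lemma split_coherence_intch:
  assumes "fits lo hi" "i \<noteq> j" "lo i < a" "a < hi i" "lo j < b" "b < hi j"
  shows "intch_coherent i a j b lo hi"
  using assms
proof (induction "bulk lo hi" arbitrary: lo hi i a j b rule: less_induct)
  case less
  note f = less.prems(1)
  have "i \<in> thick lo hi"
    using less.prems by (auto simp: thick_def)
  then obtain m where m: "lead lo hi m"
    using lead_exists by blast
  note s = leadD[OF m]
  let ?s = "Suc (lo m)"
  let ?U = "hi(m := ?s)" and ?V = "lo(m := ?s)"
  note fV = fits_lo[OF f s] and fU = fits_hi[OF f s]
  have small: "bulk lo ?U < bulk lo hi" "bulk ?V hi < bulk lo hi"
    using part_split[OF f s] by (simp_all add: part_def)
  \<comment> \<open>At most one of the two directions is \<open>m\<close>, so up to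
    \<open>intch_coherent_swap\<close> the direction \<open>j\<close> may be taken different from
    \<open>m\<close>.\<close>
  have core: "intch_coherent i a j b lo hi"
    if ne: "i \<noteq> j" "j \<noteq> m" and a: "lo i < a" "a < hi i" and b: "lo j < b" "b < hi j" for i a j b
  proof -
    have mj: "m < j"
      using lead_less[OF m _ ne(2)] b by linarith
    then have mb: "lead lo (hi(j := b)) m" "lead (lo(j := b)) hi m"
      using m by (auto simp: lead_def)
    note fb = fits_hi[OF f b] fits_lo[OF f b] and fa = fits_hi[OF f a] fits_lo[OF f a]
    show ?thesis
    proof (cases "i = m")
      case im: True
      have tw: "g(j := c, m := d) = g(m := d, j := c)" for g :: block and c d
        using ne by (simp add: fun_upd_twist)
      show ?thesis
      proof (cases "a = ?s")
        case True
        \<comment> \<open>The cut along \<open>m\<close> comes right after the first layer: all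
          isomorphisms along \<open>m\<close> are identities, and the square is the recursion
          equation of \<open>split_iso j b lo hi\<close>.\<close>
        have 1: "split_iso i a lo hi = \<iota> (val lo hi)" "split_iso i a lo (hi(j := b)) = \<iota> (val lo (hi(j := b)))"
          "split_iso i a (lo(j := b)) hi = \<iota> (val (lo(j := b)) hi)"
          using split_iso_lead(2)[OF f m] split_iso_lead(2)[OF fb(1) mb(1)] split_iso_lead(2)[OF fb(2) mb(2)] im ne True
          by simp_all
        have 2: "split_iso j b lo hi = (split_iso j b lo (hi(m := ?s)) \<odot>\<^sub>m split_iso j b (lo(m := ?s)) hi) \<cdot>
         \<beta> m j (val lo (hi(j := b, m := ?s))) (val (lo(m := ?s)) (hi(j := b)))
           (val (lo(j := b)) (hi(m := ?s))) (val (lo(j := b, m := ?s)) hi)"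
          using split_iso_lead(1)[OF f m ne(2)] by (simp add: tw)
        show ?thesis
          unfolding intch_coherent_def 1 glue_id[OF val_adj[OF f b]] cmp_id_right[OF split_hom(1)[OF f b]]
          using 2 cmp_id_left[OF split_hom(1)[OF f b]] im True by simp
      next
        case False
        then have sa: "?s < a" "a < hi m"
          using a im by auto
        have am: "lo m < a"
          using a im by simp
        have bU: "lo j < b" "b < ?U j" and bV: "?V j < b" "b < hi j"
          using b ne by auto
        have fX: "fits ?V (hi(m := a))" "fits (lo(m := a)) hi"
          using fits_hi[OF fV, of m a] fits_lo[OF f, of m a] sa am by simp_all
        have Vm: "?V m < a" "a < hi m"
          using sa by auto
        have mjn: "m \<noteq> j"
          using ne by simp
        \<comment> \<open>The induction hypothesis is used for the box above the first layer; the
          two halves of that layer are the \<open>u\<close> and \<open>u'\<close> of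
          \<open>paste_intch_assoc\<close>.\<close>
        have IH: "split_iso j b ?V hi \<cdot> (split_iso m a ?V (hi(j := b)) \<odot>\<^sub>j split_iso m a (?V(j := b)) hi) =
            split_iso m a ?V hi \<cdot> (split_iso j b ?V (hi(m := a)) \<odot>\<^sub>m split_iso j b (lo(m := a)) hi) \<cdot>
            \<beta> m j (val ?V (hi(m := a, j := b))) (val (lo(m := a)) (hi(j := b)))
              (val (?V(j := b)) (hi(m := a))) (val (lo(m := a, j := b)) hi)"
          using less.hyps[OF small(2) fV mjn Vm bV] by (simp add: intch_coherent_def tw)
        note oV = val_adj4[OF fV mjn Vm bV]
        have o1: "oadj m (val lo (hi(m := ?s, j := b))) (val ?V (hi(m := a, j := b)))"
          using val_adj3(1)[OF fb(1), of m ?s a] sa ne by (simp add: tw)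
        have o2: "oadj m (val (lo(j := b)) (hi(m := ?s))) (val (?V(j := b)) (hi(m := a)))"
          using val_adj3(1)[OF fb(2), of m ?s a] sa ne by (simp add: tw)
        have o3: "oadj m (val ?V (hi(m := a, j := b))) (val (lo(m := a)) (hi(j := b)))"
          "oadj m (val (?V(j := b)) (hi(m := a))) (val (lo(m := a, j := b)) hi)"
          "oadj j (val ?V (hi(m := a, j := b))) (val (?V(j := b)) (hi(m := a)))"
          "oadj j (val (lo(m := a)) (hi(j := b))) (val (lo(m := a, j := b)) hi)"
          using oV by (simp_all add: tw)
        have o4: "oadj j (val lo (hi(m := ?s, j := b))) (val (lo(j := b)) (hi(m := ?s)))"
          using val_adj[OF fU bU] .
        have p: "hom (split_iso m a ?V (hi(j := b))) (val ?V (hi(m := a, j := b)) \<otimes>\<^sub>m val (lo(m := a)) (hi(j := b))) (val ?V (hi(j := b)))"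
          "rigid m (split_iso m a ?V (hi(j := b)))"
          "hom (split_iso m a (?V(j := b)) hi) (val (?V(j := b)) (hi(m := a)) \<otimes>\<^sub>m val (lo(m := a, j := b)) hi) (val (?V(j := b)) hi)"
          "rigid m (split_iso m a (?V(j := b)) hi)"
          using split_hom2[OF fV mjn Vm bV] by (simp_all add: tw)
        note pp = split_adj[OF fV mjn Vm bV]
        note ha = split_hom(1)[OF fU bU]
        have hb: "hom (split_iso j b ?V (hi(m := a))) (val ?V (hi(m := a, j := b)) \<otimes>\<^sub>j val (?V(j := b)) (hi(m := a))) (val ?V (hi(m := a)))"
          using split_hom(1)[OF fX(1), of j b] b ne by simp
        have hc: "hom (split_iso j b (lo(m := a)) hi) (val (lo(m := a)) (hi(j := b)) \<otimes>\<^sub>j val (lo(m := a, j := b)) hi) (val (lo(m := a)) hi)"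
          using split_hom(1)[OF fX(2), of j b] b ne by simp
        have ab: "adj m (split_iso j b lo ?U) (split_iso j b ?V (hi(m := a)))"
          using split_adj[OF fits_hi[OF f am sa(2)] ne(2), of b ?s] b ne sa by simp
        have bc: "adj m (split_iso j b ?V (hi(m := a))) (split_iso j b (lo(m := a)) hi)"
          using split_adj[OF fV ne(2), of b a] b ne sa by simp
        note q = split_hom(1)[OF fV bV] split_adj[OF f ne(2) b s]
        have r: "hom (split_iso m a ?V hi) (val ?V (hi(m := a)) \<otimes>\<^sub>m val (lo(m := a)) hi) (val ?V hi)" "rigid m (split_iso m a ?V hi)"
          using split_hom[OF fV Vm] by simp_all
        note P = paste_intch_assoc[OF mjn o1 o3(1) o2 o3(2) o4 o3(3,4) p pp ha hb hc ab bc q r IH]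
        have e: "split_iso j b lo hi = (split_iso j b lo ?U \<odot>\<^sub>m split_iso j b ?V hi) \<cdot>
            \<beta> m j (val lo (hi(m := ?s, j := b))) (val ?V (hi(j := b))) (val (lo(j := b)) ?U) (val (?V(j := b)) hi)"
          using split_iso_lead(1)[OF f m ne(2)] .
        have e1: "split_iso m a lo (hi(j := b)) = (\<iota> (val lo (hi(m := ?s, j := b))) \<odot>\<^sub>m split_iso m a ?V (hi(j := b))) \<cdot>
            \<alpha> m (val lo (hi(m := ?s, j := b))) (val ?V (hi(m := a, j := b))) (val (lo(m := a)) (hi(j := b)))"
          using split_iso_lead(3)[OF fb(1) mb(1)] False by (simp add: tw)
        have e2: "split_iso m a (lo(j := b)) hi = (\<iota> (val (lo(j := b)) ?U) \<odot>\<^sub>m split_iso m a (?V(j := b)) hi) \<cdot>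
            \<alpha> m (val (lo(j := b)) ?U) (val (?V(j := b)) (hi(m := a))) (val (lo(m := a, j := b)) hi)"
          using split_iso_lead(3)[OF fb(2) mb(2)] False ne by (simp add: tw)
        have e3: "split_iso m a lo hi = (\<iota> (val lo ?U) \<odot>\<^sub>m split_iso m a ?V hi) \<cdot>
            \<alpha> m (val lo ?U) (val ?V (hi(m := a))) (val (lo(m := a)) hi)"
          using split_iso_lead(3)[OF f m False] .
        have lb: "lead lo (hi(m := a)) m" "lead lo (hi(m := a, j := b)) m" "lead (lo(j := b)) (hi(m := a)) m"
          using m sa mj by (auto simp: lead_def)
        have e4: "split_iso j b lo (hi(m := a)) = (split_iso j b lo ?U \<odot>\<^sub>m split_iso j b ?V (hi(m := a))) \<cdot>
            \<beta> m j (val lo (hi(m := ?s, j := b))) (val ?V (hi(m := a, j := b))) (val (lo(j := b)) ?U) (val (?V(j := b)) (hi(m := a)))"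
          using split_iso_lead(1)[OF fits_hi[OF f am sa(2)] lb(1) ne(2), of b] by simp
        have fam: "fits lo (hi(m := a, j := b))" "fits (lo(j := b)) (hi(m := a))"
          using fits_hi[OF fb(1), of m a] fits_hi[OF fb(2), of m a] am sa ne by (simp_all add: tw)
        have v: "val lo (hi(m := a, j := b)) = val lo (hi(m := ?s, j := b)) \<otimes>\<^sub>m val ?V (hi(m := a, j := b))"
          "val (lo(j := b)) (hi(m := a)) = val (lo(j := b)) ?U \<otimes>\<^sub>m val (?V(j := b)) (hi(m := a))"
          using val_lead[OF fam(1) lb(2)] val_lead[OF fam(2) lb(3)] ne by (simp_all add: tw)
        show ?thesis
          unfolding intch_coherent_def im tw e e1 e2 e3 e4 v using P .
      qed
    next
      case im: False
      have ma: "lead lo (hi(i := a)) m" "lead (lo(i := a)) hi m"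
        using m lead_less[OF m _ im] a by (auto simp: lead_def)
      have tw: "g(j := c, m := d) = g(m := d, j := c)" "g(i := c, m := d) = g(m := d, i := c)"
        "g(i := c, j := d) = g(j := d, i := c)" for g :: block and c d
        using ne im by (simp_all add: fun_upd_twist)
      have aU: "lo i < a" "a < ?U i" and aV: "?V i < a" "a < hi i" and bU: "lo j < b" "b < ?U j" and bV: "?V j < b" "b < hi j"
        using a b ne im by auto
      \<comment> \<open>Neither direction leads: the induction hypothesis is used for the first
        layer and for the rest, and both squares are then glued along \<open>m\<close>.\<close>
      note IHU = less.hyps[OF small(1) fU ne(1) aU bU, unfolded intch_coherent_def]
      note IHV = less.hyps[OF small(2) fV ne(1) aV bV, unfolded intch_coherent_def]
      note oU = val_adj4[OF fU ne(1) aU bU] and oV = val_adj4[OF fV ne(1) aV bV]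
      have ab: "(hi(j := b)) i = hi i" "(lo(j := b)) i = lo i" "(hi(i := a)) j = hi j" "(lo(i := a)) j = lo j"
        using ne by auto
      have fab: "fits lo (hi(j := b, i := a))" "fits (lo(i := a)) (hi(j := b))"
        "fits (lo(j := b)) (hi(i := a))" "fits (lo(j := b, i := a)) hi"
        using fits_hi[OF fb(1), of i a] fits_lo[OF fb(1), of i a] fits_hi[OF fb(2), of i a] fits_lo[OF fb(2), of i a] a ab
        by simp_all
      have lab: "lead lo (hi(j := b, i := a)) m" "lead (lo(i := a)) (hi(j := b)) m"
        "lead (lo(j := b)) (hi(i := a)) m" "lead (lo(j := b, i := a)) hi m"
        using m mj lead_less[OF m _ im] a by (auto simp: lead_def)
      have om: "oadj m (val lo (?U(j := b, i := a))) (val ?V (hi(j := b, i := a)))"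
        "oadj m (val (lo(i := a)) (?U(j := b))) (val (?V(i := a)) (hi(j := b)))"
        "oadj m (val (lo(j := b)) (?U(i := a))) (val (?V(j := b)) (hi(i := a)))"
        "oadj m (val (lo(j := b, i := a)) ?U) (val (?V(j := b, i := a)) hi)"
        using val_adj[OF fab(1), of m ?s] val_adj[OF fab(2), of m ?s] val_adj[OF fab(3), of m ?s] val_adj[OF fab(4), of m ?s]
          s ne im by (simp_all add: tw)
      note hf = split_hom2(1,2)[OF fU ne(1) aU bU] split_hom2(1,2)[OF fV ne(1) aV bV]
        split_adj[OF fU ne(1) aU bU] split_adj[OF fV ne(1) aV bV]
      have hfm: "adj m (split_iso i a lo (?U(j := b))) (split_iso i a ?V (hi(j := b)))"
        "adj m (split_iso i a (lo(j := b)) ?U) (split_iso i a (?V(j := b)) hi)"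
        using split_adj[OF fb(1) im, of a ?s] split_adj[OF fb(2) im, of a ?s] a s ne im by (simp_all add: tw)
      note ji = ne(1)[symmetric]
      have hg: "hom (split_iso j b lo (?U(i := a))) (val lo (?U(j := b, i := a)) \<otimes>\<^sub>j val (lo(j := b)) (?U(i := a))) (val lo (?U(i := a)))"
        "hom (split_iso j b (lo(i := a)) ?U) (val (lo(i := a)) (?U(j := b)) \<otimes>\<^sub>j val (lo(j := b, i := a)) ?U) (val (lo(i := a)) ?U)"
        "hom (split_iso j b ?V (hi(i := a))) (val ?V (hi(j := b, i := a)) \<otimes>\<^sub>j val (?V(j := b)) (hi(i := a))) (val ?V (hi(i := a)))"
        "hom (split_iso j b (?V(i := a)) hi) (val (?V(i := a)) (hi(j := b)) \<otimes>\<^sub>j val (?V(j := b, i := a)) hi) (val (?V(i := a)) hi)"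
        using split_hom2(1,2)[OF fU ji bU aU] split_hom2(1,2)[OF fV ji bV aV] by (simp_all add: tw)
      note hgi = split_adj[OF fU ji bU aU] split_adj[OF fV ji bV aV]
      have hgm: "adj m (split_iso j b lo (?U(i := a))) (split_iso j b ?V (hi(i := a)))"
        "adj m (split_iso j b (lo(i := a)) ?U) (split_iso j b (?V(i := a)) hi)"
        using split_adj[OF fa(1) ne(2), of b ?s] split_adj[OF fa(2) ne(2), of b ?s] b s ne im by (simp_all add: tw)
      note hh = split_hom(1)[OF fU bU] split_hom(1)[OF fV bV] split_adj[OF f ne(2) b s]
      note hk = split_hom(1)[OF fU aU] split_hom(1)[OF fV aV] split_adj[OF f im a s]
      note P = paste_intch_intch[OF ne(1) im[symmetric] ne(2)[symmetric] oU oV om hf hfm hg hgi hgm hh hk IHU IHV]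
      have v: "val lo (hi(j := b, i := a)) = val lo (?U(j := b, i := a)) \<otimes>\<^sub>m val ?V (hi(j := b, i := a))"
        "val (lo(i := a)) (hi(j := b)) = val (lo(i := a)) (?U(j := b)) \<otimes>\<^sub>m val (?V(i := a)) (hi(j := b))"
        "val (lo(j := b)) (hi(i := a)) = val (lo(j := b)) (?U(i := a)) \<otimes>\<^sub>m val (?V(j := b)) (hi(i := a))"
        "val (lo(j := b, i := a)) hi = val (lo(j := b, i := a)) ?U \<otimes>\<^sub>m val (?V(j := b, i := a)) hi"
        using val_lead[OF fab(1) lab(1)] val_lead[OF fab(2) lab(2)] val_lead[OF fab(3) lab(3)] val_lead[OF fab(4) lab(4)] ne im
        by (simp_all add: tw)
      have e: "split_iso i a lo (hi(j := b)) = (split_iso i a lo (?U(j := b)) \<odot>\<^sub>m split_iso i a ?V (hi(j := b))) \<cdot>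
          \<beta> m i (val lo (?U(j := b, i := a))) (val ?V (hi(j := b, i := a))) (val (lo(i := a)) (?U(j := b))) (val (?V(i := a)) (hi(j := b)))"
        "split_iso i a (lo(j := b)) hi = (split_iso i a (lo(j := b)) ?U \<odot>\<^sub>m split_iso i a (?V(j := b)) hi) \<cdot>
          \<beta> m i (val (lo(j := b)) (?U(i := a))) (val (?V(j := b)) (hi(i := a))) (val (lo(j := b, i := a)) ?U) (val (?V(j := b, i := a)) hi)"
        "split_iso j b lo (hi(i := a)) = (split_iso j b lo (?U(i := a)) \<odot>\<^sub>m split_iso j b ?V (hi(i := a))) \<cdot>
          \<beta> m j (val lo (?U(j := b, i := a))) (val ?V (hi(j := b, i := a))) (val (lo(j := b)) (?U(i := a))) (val (?V(j := b)) (hi(i := a)))"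
        "split_iso j b (lo(i := a)) hi = (split_iso j b (lo(i := a)) ?U \<odot>\<^sub>m split_iso j b (?V(i := a)) hi) \<cdot>
          \<beta> m j (val (lo(i := a)) (?U(j := b))) (val (?V(i := a)) (hi(j := b))) (val (lo(j := b, i := a)) ?U) (val (?V(j := b, i := a)) hi)"
        using split_iso_lead(1)[OF fb(1) mb(1) im, of a] split_iso_lead(1)[OF fb(2) mb(2) im, of a]
          split_iso_lead(1)[OF fa(1) ma(1) ne(2), of b] split_iso_lead(1)[OF fa(2) ma(2) ne(2), of b] ne im
        by (simp_all add: tw)
      show ?thesis
        unfolding intch_coherent_def e v split_iso_lead(1)[OF f m im] split_iso_lead(1)[OF f m ne(2)] using P .
    qed
  qed
  show ?case
  proof (cases "j = m")
    case True
    then have "intch_coherent j b i a lo hi"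
      using core[of j i b a] less.prems by simp
    then show ?thesis
      using intch_coherent_swap[OF f, of j i b a] less.prems by simp
  qed (use core less.prems in simp)
qed

end

section \<open>The isomorphism from a scheme to its normal form\<close>

text \<open>The cut and the corners are read off from the scheme, so no box has to be carried along
  in the recursion. The result is meaningful for tilings only.\<close>

primrec normalize :: "(block \<Rightarrow> 'o) \<Rightarrow> scheme \<Rightarrow> 'a" where
  "normalize X (Block b) = \<iota> (X b)"
| "normalize X (Glue i F G) =
     split_iso X i (lo_of G i) (lo_of F) (hi_of K G) \<cdot> (normalize X F \<odot>\<^sub>i normalize X G)"

abbreviation "ev \<equiv> eval (co P K)"
abbreviation "eva \<equiv> eval (ca P K)"

lemma val_thin:
  assumes "bounds K lo hi" "\<forall>i\<in>K. hi i = Suc (lo i)"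
  shows "val X lo hi = X lo"
proof -
  have "thick lo hi = {}"
    using assms bounds_thick[OF assms(1)] by (fastforce simp: thick_def)
  then show ?thesis
    by (simp add: val_def normal_thin)
qed

lemma normalize_Glue:
  assumes "tiling K lo (hi(i := a)) F" "tiling K (lo(i := a)) hi G"
  shows "normalize X (Glue i F G) = split_iso X i a lo hi \<cdot> (normalize X F \<odot>\<^sub>i normalize X G)"
  using tiling_lo_of[OF assms(1)] tiling_lo_of[OF assms(2)] tiling_hi_of[OF assms(2)] by simp

text \<open>The matching part holds because a face of \<open>normalize X T\<close> depends only on
  the face of \<open>T\<close>: splitting isomorphisms along \<open>l\<close> are rigid there, and
  those along other directions match by \<open>split_adj\<close>.\<close>

lemma normalize_typing:
  shows "tiling K lo hi T \<Longrightarrow> fits X lo hi \<Longrightarrow> hom (normalize X T) (ev T X) (val X lo hi) \<and> iso (normalize X T)"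
    and "\<lbrakk>tiling K lo (hi(l := b)) F; tiling K (lo(l := b)) hi G; bounds K lo hi; l \<in> K; lo l < b; b < hi l;
      tgt_face l F = src_face l G; fits X lo hi\<rbrakk> \<Longrightarrow> adj l (normalize X F) (normalize X G)"
proof -
  let ?P = "\<lambda>lo hi T. fits X lo hi \<longrightarrow> hom (normalize X T) (ev T X) (val X lo hi) \<and> iso (normalize X T)"
  let ?Q = "\<lambda>l b lo hi F G. fits X lo hi \<longrightarrow> adj l (normalize X F) (normalize X G)"
  have Block: "?P lo hi (Block lo)" if "bounds K lo hi" "\<forall>i\<in>K. hi i = Suc (lo i)" for lo hi
  proof
    assume f: "fits X lo hi"
    then have "X lo \<in> Ob"
      using val_ob[OF f] val_thin[OF that] by simp
    then show "hom (normalize X (Block lo)) (ev (Block lo) X) (val X lo hi) \<and> iso (normalize X (Block lo))"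
      using val_thin[OF that, of X] by (simp add: hom_id iso_id)
  qed
  have Glue: "?P lo hi (Glue i F G)" if t: "lo i < a" "a < hi i"
    "tiling K lo (hi(i := a)) F" "tiling K (lo(i := a)) hi G"
    "?P lo (hi(i := a)) F" "?P (lo(i := a)) hi G" "?Q i a lo hi F G" for lo hi i a F G
  proof
    assume f: "fits X lo hi"
    have h: "hom (normalize X F) (ev F X) (val X lo (hi(i := a)))" "iso (normalize X F)"
      "hom (normalize X G) (ev G X) (val X (lo(i := a)) hi)" "iso (normalize X G)"
      using t(5,6) fits_hi[OF f t(1,2)] fits_lo[OF f t(1,2)] by blast+
    have a: "adj i (normalize X F) (normalize X G)"
      using t f by blast
    note s = split_hom[OF f t(1,2)]
    show "hom (normalize X (Glue i F G)) (ev (Glue i F G) X) (val X lo hi) \<and> iso (normalize X (Glue i F G))"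
      unfolding normalize_Glue[OF t(3,4)]
      using hom_cmp[OF hom_glue[OF h(1,3) a] s(1)] iso_cmp[OF iso_glue(3)[OF h(2,4) a] s(3) hom_glue[OF h(1,3) a] s(1)]
      by simp
  qed
  have QBlock: "?Q l (Suc (lo l)) lo hi (Block lo) (Block (lo(l := Suc (lo l))))"
    if "bounds K lo hi" "l \<in> K" "hi l = Suc (Suc (lo l))" "\<forall>i\<in>K - {l}. hi i = Suc (lo i)" for lo hi l
  proof
    assume f: "fits X lo hi"
    have "lo l < Suc (lo l)" "Suc (lo l) < hi l"
      using that by auto
    note c = this val_adj[OF f this]
    have "val X lo (hi(l := Suc (lo l))) = X lo"
      using that c by (intro val_thin bounds_hi) (auto simp: fun_upd_apply)
    moreover have "val X (lo(l := Suc (lo l))) hi = X (lo(l := Suc (lo l)))"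
      using that c by (intro val_thin bounds_lo) (auto simp: fun_upd_apply)
    ultimately show "adj l (normalize X (Block lo)) (normalize X (Block (lo(l := Suc (lo l)))))"
      using adj_id[OF c(3)] by simp
  qed
  have QLeft: "?Q l b lo hi (Glue l F F') G"
    if t: "lo l < a" "a < b" "b < hi l"
      "tiling K lo (hi(l := a)) F" "tiling K (lo(l := a)) (hi(l := b)) F'" "tiling K (lo(l := b)) hi G"
      "?P lo (hi(l := a)) F" "?P (lo(l := a)) (hi(l := b)) F'" "?P (lo(l := b)) hi G"
      "?Q l a lo (hi(l := b)) F F'" "?Q l b (lo(l := a)) hi F' G" for lo hi l a b F F' G
  proof
    assume f: "fits X lo hi"
    note a = t(1) less_trans[OF t(2,3)] and b = less_trans[OF t(1,2)] t(3)
    have a': "a < (hi(l := b)) l" and b': "(lo(l := a)) l < b"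
      using t by auto
    note fb = fits_hi[OF f b] and fa = fits_lo[OF f a] and fG = fits_lo[OF f b]
    have f2: "fits X lo (hi(l := a))" "fits X (lo(l := a)) (hi(l := b))"
      using fits_hi[OF f a] fits_hi[OF fa b' b(2)] .
    have h: "hom (normalize X F) (ev F X) (val X lo (hi(l := a)))"
      "hom (normalize X F') (ev F' X) (val X (lo(l := a)) (hi(l := b)))"
      "hom (normalize X G) (ev G X) (val X (lo(l := b)) hi)"
      using t f2 fG by blast+
    have adj: "adj l (normalize X F) (normalize X F')" "adj l (normalize X F') (normalize X G)"
      using t fb fa by blast+
    note adj' = adj_left[OF adj]
    note hFF = hom_glue[OF h(1,2) adj(1)]
    have s: "hom (split_iso X l a lo (hi(l := b))) (val X lo (hi(l := a)) \<otimes>\<^sub>l val X (lo(l := a)) (hi(l := b))) (val X lo (hi(l := b)))"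
      "rigid l (split_iso X l a lo (hi(l := b)))"
      using split_hom[OF fb a(1) a'] by simp_all
    \<comment> \<open>The isomorphism \<open>split_iso X l a\<close> is rigid along
      \<open>l\<close>, so it matches an identity on the other side, and only \<open>F'\<close>
      meets the face of \<open>G\<close>.\<close>
    have eq: "normalize X (Glue l F F') = split_iso X l a lo (hi(l := b)) \<cdot> (normalize X F \<odot>\<^sub>l normalize X F')"
      using normalize_Glue[of lo "hi(l := b)" l a F F'] t by simp
    show "adj l (normalize X (Glue l F F')) (normalize X G)"
      unfolding eq
      using adj_cmp[OF hFF s(1) h(3) hom_id[OF hom_obj(2)[OF h(3)]] adj' adj_id_right[OF s(2,1) adj_cod[OF adj' hFF h(3)]]]
        cmp_id_left[OF h(3)] by simp
  qed
  have QRight: "?Q l b lo hi F (Glue l G G')"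
    if t: "lo l < b" "b < a" "a < hi l"
      "tiling K lo (hi(l := b)) F" "tiling K (lo(l := b)) (hi(l := a)) G" "tiling K (lo(l := a)) hi G'"
      "?P lo (hi(l := b)) F" "?P (lo(l := b)) (hi(l := a)) G" "?P (lo(l := a)) hi G'"
      "?Q l b lo (hi(l := a)) F G" "?Q l a (lo(l := b)) hi G G'" for lo hi l a b F G G'
  proof
    assume f: "fits X lo hi"
    note b = t(1) less_trans[OF t(2,3)] and a = less_trans[OF t(1,2)] t(3)
    have b': "(lo(l := b)) l < a"
      using t by auto
    note fa = fits_hi[OF f a] and fb = fits_lo[OF f b]
    have f2: "fits X lo (hi(l := b))" "fits X (lo(l := b)) (hi(l := a))" "fits X (lo(l := a)) hi"
      using fits_hi[OF f b] fits_hi[OF fb b' a(2)] fits_lo[OF f a] .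
    have h: "hom (normalize X F) (ev F X) (val X lo (hi(l := b)))"
      "hom (normalize X G) (ev G X) (val X (lo(l := b)) (hi(l := a)))"
      "hom (normalize X G') (ev G' X) (val X (lo(l := a)) hi)"
      using t f2 by blast+
    have adj: "adj l (normalize X F) (normalize X G)" "adj l (normalize X G) (normalize X G')"
      using t fb fa by blast+
    note adj' = adj_right[OF adj]
    note hGG = hom_glue[OF h(2,3) adj(2)]
    have s: "hom (split_iso X l a (lo(l := b)) hi) (val X (lo(l := b)) (hi(l := a)) \<otimes>\<^sub>l val X (lo(l := a)) hi) (val X (lo(l := b)) hi)"
      "rigid l (split_iso X l a (lo(l := b)) hi)"
      using split_hom[OF fb b' a(2)] by simp_all
    have eq: "normalize X (Glue l G G') = split_iso X l a (lo(l := b)) hi \<cdot> (normalize X G \<odot>\<^sub>l normalize X G')"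
      using normalize_Glue[of "lo(l := b)" hi l a G G'] t by simp
    show "adj l (normalize X F) (normalize X (Glue l G G'))"
      unfolding eq
      using adj_cmp[OF h(1) hom_id[OF hom_obj(2)[OF h(1)]] hGG s(1) adj' adj_id_left[OF s(2,1) adj_cod[OF adj' h(1) hGG]]]
        cmp_id_left[OF h(1)] by simp
  qed
  have QCross: "?Q l b lo hi (Glue j F F') (Glue j G G')"
    if b: "lo l < b" "b < hi l" and jl: "j \<noteq> l" and a: "lo j < a" "a < hi j" and
      t: "tiling K lo (hi(l := b, j := a)) F" "tiling K (lo(j := a)) (hi(l := b)) F'"
      "tiling K (lo(l := b)) (hi(j := a)) G" "tiling K (lo(l := b, j := a)) hi G'" and
      p: "?P lo (hi(l := b, j := a)) F" "?P (lo(j := a)) (hi(l := b)) F'"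
      "?P (lo(l := b)) (hi(j := a)) G" "?P (lo(l := b, j := a)) hi G'" and
      q: "?Q j a lo (hi(l := b)) F F'" "?Q j a (lo(l := b)) hi G G'"
      "?Q l b lo (hi(j := a)) F G" "?Q l b (lo(j := a)) hi F' G'" for lo hi l b j a F F' G G'
  proof
    assume f: "fits X lo hi"
    note fb = fits_hi[OF f b] fits_lo[OF f b] and fa = fits_hi[OF f a] fits_lo[OF f a]
    have a2: "a < (hi(l := b)) j" "(lo(l := b)) j < a"
      using a jl by auto
    note f4 = fits_hi[OF fb(1) a(1) a2(1)] fits_lo[OF fb(1) a(1) a2(1)] fits_hi[OF fb(2) a2(2) a(2)] fits_lo[OF fb(2) a2(2) a(2)]
    have h: "hom (normalize X F) (ev F X) (val X lo (hi(l := b, j := a)))"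
      "hom (normalize X F') (ev F' X) (val X (lo(j := a)) (hi(l := b)))"
      "hom (normalize X G) (ev G X) (val X (lo(l := b)) (hi(j := a)))"
      "hom (normalize X G') (ev G' X) (val X (lo(l := b, j := a)) hi)"
      using p f4 by blast+
    have adj: "adj j (normalize X F) (normalize X F')" "adj j (normalize X G) (normalize X G')"
      "adj l (normalize X F) (normalize X G)" "adj l (normalize X F') (normalize X G')"
      using q fb fa by blast+
    show "adj l (normalize X (Glue j F F')) (normalize X (Glue j G G'))"
      unfolding normalize_Glue[OF t(1,2)] normalize_Glue[OF t(3,4)]
      using adj_cmp[OF hom_glue[OF h(1,2) adj(1)] split_hom(1)[OF fb(1) a(1) a2(1)]
          hom_glue[OF h(3,4) adj(2)] split_hom(1)[OF fb(2) a2(2) a(2)] adj_cross[OF jl adj] split_adj[OF f jl a b]] .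
  qed
  show "hom (normalize X T) (ev T X) (val X lo hi) \<and> iso (normalize X T)" if "tiling K lo hi T" "fits X lo hi"
  proof -
    have "?P lo hi T"
      by (rule tiling_pair_induct(1)[of K ?P ?Q], (rule Block; assumption), (rule Glue; assumption),
        (rule QBlock; assumption), (rule QLeft; assumption), (rule QRight; assumption),
        (rule QCross; assumption), (rule that)+)
    then show ?thesis
      using that by blast
  qed
  show "adj l (normalize X F) (normalize X G)"
    if "tiling K lo (hi(l := b)) F" "tiling K (lo(l := b)) hi G" "bounds K lo hi" "l \<in> K" "lo l < b"
      "b < hi l" "tgt_face l F = src_face l G" "fits X lo hi"
  proof -
    have "?Q l b lo hi F G"
      by (rule tiling_pair_induct(2)[of K ?P ?Q], (rule Block; assumption), (rule Glue; assumption),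
        (rule QBlock; assumption), (rule QLeft; assumption), (rule QRight; assumption),
        (rule QCross; assumption), (rule that)+)
    then show ?thesis
      using that by blast
  qed
qed

lemma normalize_hom:
  assumes "tiling K lo hi T" "fits X lo hi"
  shows "hom (normalize X T) (ev T X) (val X lo hi)" and "iso (normalize X T)"
  using normalize_typing(1)[OF assms] by blast+

lemma normalize_adj:
  assumes "tiling K lo (hi(i := a)) F" "tiling K (lo(i := a)) hi G" "lo i < a" "a < hi i" "fits X lo hi"
    "tgt_face i F = src_face i G"
  shows "adj i (normalize X F) (normalize X G)"
  using normalize_typing(2)[OF assms(1,2) grid_bounds[OF assms(5)] fits_K[OF assms(5,3,4)] assms(3,4,6,5)] .

text \<open>Naturality of \<open>\<alpha>\<close> moves the normalizations of the three factors past
  the associator; what remains is \<open>split_coherence_assoc\<close> for their normal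
  forms.\<close>

lemma normalize_assoc:
  assumes T: "tiling K lo (hi(i := a)) F" "tiling K (lo(i := a)) (hi(i := b)) G" "tiling K (lo(i := b)) hi H"
    and faces: "tgt_face i F = src_face i G" "tgt_face i G = src_face i H"
    and ab: "lo i < a" "a < b" "b < hi i" and f: "fits X lo hi"
  shows "normalize X (Glue i F (Glue i G H)) \<cdot> \<alpha> i (ev F X) (ev G X) (ev H X) = normalize X (Glue i (Glue i F G) H)"
    and "oadj i (ev F X) (ev G X)" and "oadj i (ev G X) (ev H X)"
proof -
  note a = ab(1) less_trans[OF ab(2,3)] and b = less_trans[OF ab(1,2)] ab(3)
  note fb = fits_hi[OF f b] and fa = fits_lo[OF f a]
  have f3: "fits X (lo(i := a)) (hi(i := b))"
    using fits_hi[OF fa, of i b] ab by simp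
  note F = normalize_hom[OF T(1) fits_hi[OF f a]] and G = normalize_hom[OF T(2) f3]
    and H = normalize_hom[OF T(3) fits_lo[OF f b]]
  have FG: "adj i (normalize X F) (normalize X G)"
    using normalize_adj[of lo "hi(i := b)" i a F G] T faces ab fb by simp
  have GH: "adj i (normalize X G) (normalize X H)"
    using normalize_adj[of "lo(i := a)" hi i b G H] T faces ab fa by simp
  show o: "oadj i (ev F X) (ev G X)" "oadj i (ev G X) (ev H X)"
    using adj_dom[OF FG F(1) G(1)] adj_dom[OF GH G(1) H(1)] .
  note v = val_adj3[OF f ab]
  have sa: "hom (split_iso X i a lo (hi(i := b))) (val X lo (hi(i := a)) \<otimes>\<^sub>i val X (lo(i := a)) (hi(i := b))) (val X lo (hi(i := b)))"
    "rigid i (split_iso X i a lo (hi(i := b)))"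
    using split_hom[OF fb, of i a] ab by simp_all
  have sb: "hom (split_iso X i b (lo(i := a)) hi) (val X (lo(i := a)) (hi(i := b)) \<otimes>\<^sub>i val X (lo(i := b)) hi) (val X (lo(i := a)) hi)"
    "rigid i (split_iso X i b (lo(i := a)) hi)"
    using split_hom[OF fa, of i b] ab by simp_all
  note SA = split_hom(1)[OF f a] and SB = split_hom(1)[OF f b]
  \<comment> \<open>Rigidity along \<open>i\<close> permits gluing with identities along
    \<open>i\<close>, so each normalization of a pair factors into a normalization of its factors
    and a splitting isomorphism.\<close>
  have saH: "adj i (split_iso X i a lo (hi(i := b))) (\<iota> (val X (lo(i := b)) hi))"
    using adj_id_right[OF sa(2,1) oadj_left[OF v]] .
  have Fsb: "adj i (\<iota> (val X lo (hi(i := a)))) (split_iso X i b (lo(i := a)) hi)"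
    using adj_id_left[OF sb(2,1) oadj_right[OF v]] .
  have eq1: "normalize X (Glue i (Glue i F G) H) =
      split_iso X i b lo hi \<cdot> ((split_iso X i a lo (hi(i := b)) \<cdot> (normalize X F \<odot>\<^sub>i normalize X G)) \<odot>\<^sub>i normalize X H)"
    using T tiling_lo_of tiling_hi_of by simp
  have eq2: "normalize X (Glue i F (Glue i G H)) =
      split_iso X i a lo hi \<cdot> (normalize X F \<odot>\<^sub>i (split_iso X i b (lo(i := a)) hi \<cdot> (normalize X G \<odot>\<^sub>i normalize X H)))"
    using T tiling_lo_of tiling_hi_of by simp
  note hFG = hom_glue[OF F(1) G(1) FG] and hGH = hom_glue[OF G(1) H(1) GH]
  note FGH = adj_left[OF FG GH] and FGH' = adj_right[OF FG GH]
  have e1: "(split_iso X i a lo (hi(i := b)) \<cdot> (normalize X F \<odot>\<^sub>i normalize X G)) \<odot>\<^sub>i normalize X H =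
      (split_iso X i a lo (hi(i := b)) \<odot>\<^sub>i \<iota> (val X (lo(i := b)) hi)) \<cdot> ((normalize X F \<odot>\<^sub>i normalize X G) \<odot>\<^sub>i normalize X H)"
    using interchange[OF hFG sa(1) H(1) hom_id[OF hom_obj(2)[OF H(1)]] FGH saH] cmp_id_left[OF H(1)] by simp
  have e2: "normalize X F \<odot>\<^sub>i (split_iso X i b (lo(i := a)) hi \<cdot> (normalize X G \<odot>\<^sub>i normalize X H)) =
      (\<iota> (val X lo (hi(i := a))) \<odot>\<^sub>i split_iso X i b (lo(i := a)) hi) \<cdot> (normalize X F \<odot>\<^sub>i (normalize X G \<odot>\<^sub>i normalize X H))"
    using interchange[OF F(1) hom_id[OF hom_obj(2)[OF F(1)]] hGH sb(1) FGH' Fsb] cmp_id_left[OF F(1)] by simp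
  note hA = hom_glue[OF sa(1) hom_id[OF hom_obj(2)[OF H(1)]] saH] and hB = hom_glue[OF hom_id[OF hom_obj(2)[OF F(1)]] sb(1) Fsb]
  note h1 = hom_glue[OF hFG H(1) FGH] and h2 = hom_glue[OF F(1) hGH FGH']
  have "normalize X (Glue i F (Glue i G H)) \<cdot> \<alpha> i (ev F X) (ev G X) (ev H X) =
      split_iso X i a lo hi \<cdot> (\<iota> (val X lo (hi(i := a))) \<odot>\<^sub>i split_iso X i b (lo(i := a)) hi) \<cdot>
      (normalize X F \<odot>\<^sub>i (normalize X G \<odot>\<^sub>i normalize X H)) \<cdot> \<alpha> i (ev F X) (ev G X) (ev H X)"
    unfolding eq2 e2 using assoc[OF hom_assoc(1)[OF o] hom_cmp[OF h2 hB] SA] assoc[OF hom_assoc(1)[OF o] h2 hB] by simp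
  also have "(normalize X F \<odot>\<^sub>i (normalize X G \<odot>\<^sub>i normalize X H)) \<cdot> \<alpha> i (ev F X) (ev G X) (ev H X) =
      \<alpha> i (val X lo (hi(i := a))) (val X (lo(i := a)) (hi(i := b))) (val X (lo(i := b)) hi) \<cdot>
      ((normalize X F \<odot>\<^sub>i normalize X G) \<odot>\<^sub>i normalize X H)"
    using assoc_nat[OF F(1) G(1) H(1) FG GH] by simp
  also have "split_iso X i a lo hi \<cdot> (\<iota> (val X lo (hi(i := a))) \<odot>\<^sub>i split_iso X i b (lo(i := a)) hi) \<cdot> \<dots> =
      (split_iso X i b lo hi \<cdot> (split_iso X i a lo (hi(i := b)) \<odot>\<^sub>i \<iota> (val X (lo(i := b)) hi))) \<cdot>
      ((normalize X F \<odot>\<^sub>i normalize X G) \<odot>\<^sub>i normalize X H)"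
    unfolding split_coherence_assoc[OF f ab]
    using assoc[OF h1 hom_cmp[OF hom_assoc(1)[OF v] hB] SA] assoc[OF h1 hom_assoc(1)[OF v] hB] by simp
  also have "\<dots> = normalize X (Glue i (Glue i F G) H)"
    unfolding eq1 e1 using assoc[OF h1 hA SB] .
  finally show "normalize X (Glue i F (Glue i G H)) \<cdot> \<alpha> i (ev F X) (ev G X) (ev H X) = normalize X (Glue i (Glue i F G) H)" .
qed

text \<open>Naturality of \<open>\<beta>\<close> moves the four normalizations past the
  interchanger; what remains is \<open>split_coherence_intch\<close>.\<close>

lemma normalize_intch:
  assumes ij: "i \<noteq> j"
    and T: "tiling K lo (hi(j := b, i := a)) F" "tiling K (lo(i := a)) (hi(j := b)) G"
      "tiling K (lo(j := b)) (hi(i := a)) F'" "tiling K (lo(j := b, i := a)) hi G'"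
    and faces: "tgt_face i F = src_face i G" "tgt_face i F' = src_face i G'" "tgt_face j F = src_face j F'"
      "tgt_face j G = src_face j G'"
    and a: "lo i < a" "a < hi i" and b: "lo j < b" "b < hi j" and f: "fits X lo hi"
  shows "normalize X (Glue i (Glue j F F') (Glue j G G')) \<cdot> \<beta> i j (ev F X) (ev G X) (ev F' X) (ev G' X) =
      normalize X (Glue j (Glue i F G) (Glue i F' G'))"
    and "oadj i (ev F X) (ev G X)" and "oadj i (ev F' X) (ev G' X)" and "oadj j (ev F X) (ev F' X)" and "oadj j (ev G X) (ev G' X)"
proof -
  have tw: "g(i := c, j := d) = g(j := d, i := c)" for g :: block and c d
    using ij by (simp add: fun_upd_twist)
  note fb = fits_hi[OF f b] fits_lo[OF f b] and fa = fits_hi[OF f a] fits_lo[OF f a]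
  have a': "lo i < a" "a < (hi(j := b)) i" "(lo(j := b)) i < a" "a < hi i"
    and b': "lo j < b" "b < (hi(i := a)) j" "(lo(i := a)) j < b" "b < hi j"
    using a b ij by auto
  note n = normalize_hom(1)[OF T(1) fits_hi[OF fb(1) a'(1,2)]] normalize_hom(1)[OF T(2) fits_lo[OF fb(1) a'(1,2)]]
    normalize_hom(1)[OF T(3) fits_hi[OF fb(2) a'(3,4)]] normalize_hom(1)[OF T(4) fits_lo[OF fb(2) a'(3,4)]]
  have adj: "adj i (normalize X F) (normalize X G)" "adj i (normalize X F') (normalize X G')"
    using normalize_adj[OF T(1,2) a'(1,2) fb(1) faces(1)] normalize_adj[OF T(3,4) a'(3,4) fb(2) faces(2)] .
  have adj': "adj j (normalize X F) (normalize X F')" "adj j (normalize X G) (normalize X G')"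
    using normalize_adj[of lo "hi(i := a)" j b F F'] normalize_adj[of "lo(i := a)" hi j b G G'] T b' fa faces
    by (simp_all add: tw)
  show o: "oadj i (ev F X) (ev G X)" "oadj i (ev F' X) (ev G' X)" "oadj j (ev F X) (ev F' X)" "oadj j (ev G X) (ev G' X)"
    using adj_dom[OF adj(1) n(1,2)] adj_dom[OF adj(2) n(3,4)] adj_dom[OF adj'(1) n(1,3)] adj_dom[OF adj'(2) n(2,4)] .
  note v = val_adj4[OF f ij a b]
  note s = split_hom2(1,2)[OF f ij a b] and sadj = split_adj[OF f ij a b]
  have r: "hom (split_iso X j b lo (hi(i := a))) (val X lo (hi(j := b, i := a)) \<otimes>\<^sub>j val X (lo(j := b)) (hi(i := a))) (val X lo (hi(i := a)))"
    "hom (split_iso X j b (lo(i := a)) hi) (val X (lo(i := a)) (hi(j := b)) \<otimes>\<^sub>j val X (lo(j := b, i := a)) hi) (val X (lo(i := a)) hi)"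
    using split_hom2(1,2)[OF f ij[symmetric] b a] by (simp_all add: tw)
  note radj = split_adj[OF f ij[symmetric] b a]
  note A = split_hom(1)[OF f a] and B = split_hom(1)[OF f b]
  note h1 = hom_glue[OF n(1,2) adj(1)] hom_glue[OF n(3,4) adj(2)] and h2 = hom_glue[OF n(1,3) adj'(1)] hom_glue[OF n(2,4) adj'(2)]
  have c1: "adj j (normalize X F \<odot>\<^sub>i normalize X G) (normalize X F' \<odot>\<^sub>i normalize X G')"
    using adj_cross[OF ij adj adj'] .
  have c2: "adj i (normalize X F \<odot>\<^sub>j normalize X F') (normalize X G \<odot>\<^sub>j normalize X G')"
    using adj_cross[OF ij[symmetric] adj' adj] .
  have eq1: "normalize X (Glue j (Glue i F G) (Glue i F' G')) = split_iso X j b lo hi \<cdot>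
      ((split_iso X i a lo (hi(j := b)) \<cdot> (normalize X F \<odot>\<^sub>i normalize X G)) \<odot>\<^sub>j
       (split_iso X i a (lo(j := b)) hi \<cdot> (normalize X F' \<odot>\<^sub>i normalize X G')))"
    using T tiling_lo_of tiling_hi_of ij by simp
  have eq2: "normalize X (Glue i (Glue j F F') (Glue j G G')) = split_iso X i a lo hi \<cdot>
      ((split_iso X j b lo (hi(i := a)) \<cdot> (normalize X F \<odot>\<^sub>j normalize X F')) \<odot>\<^sub>i
       (split_iso X j b (lo(i := a)) hi \<cdot> (normalize X G \<odot>\<^sub>j normalize X G')))"
    using T tiling_lo_of tiling_hi_of ij by simp
  note e1 = interchange[OF h1(1) s(1) h1(2) s(2) c1 sadj] and e2 = interchange[OF h2(1) r(1) h2(2) r(2) c2 radj]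
  note be = hom_intch(1)[OF ij o] and bv = hom_intch(1)[OF ij v]
  note H1 = hom_glue[OF h1 c1] and H2 = hom_glue[OF h2 c2] and S = hom_glue[OF s sadj] and R = hom_glue[OF r radj]
  have "normalize X (Glue i (Glue j F F') (Glue j G G')) \<cdot> \<beta> i j (ev F X) (ev G X) (ev F' X) (ev G' X) =
      split_iso X i a lo hi \<cdot> (split_iso X j b lo (hi(i := a)) \<odot>\<^sub>i split_iso X j b (lo(i := a)) hi) \<cdot>
      ((normalize X F \<odot>\<^sub>j normalize X F') \<odot>\<^sub>i (normalize X G \<odot>\<^sub>j normalize X G')) \<cdot> \<beta> i j (ev F X) (ev G X) (ev F' X) (ev G' X)"
    unfolding eq2 e2 using assoc[OF be hom_cmp[OF H2 R] A] assoc[OF be H2 R] by simp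
  also have "((normalize X F \<odot>\<^sub>j normalize X F') \<odot>\<^sub>i (normalize X G \<odot>\<^sub>j normalize X G')) \<cdot> \<beta> i j (ev F X) (ev G X) (ev F' X) (ev G' X) =
      \<beta> i j (val X lo (hi(j := b, i := a))) (val X (lo(i := a)) (hi(j := b))) (val X (lo(j := b)) (hi(i := a))) (val X (lo(j := b, i := a)) hi) \<cdot>
      ((normalize X F \<odot>\<^sub>i normalize X G) \<odot>\<^sub>j (normalize X F' \<odot>\<^sub>i normalize X G'))"
    using intch_nat[OF ij n adj adj'] by simp
  also have "split_iso X i a lo hi \<cdot> (split_iso X j b lo (hi(i := a)) \<odot>\<^sub>i split_iso X j b (lo(i := a)) hi) \<cdot> \<dots> =
      (split_iso X j b lo hi \<cdot> (split_iso X i a lo (hi(j := b)) \<odot>\<^sub>j split_iso X i a (lo(j := b)) hi)) \<cdot>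
      ((normalize X F \<odot>\<^sub>i normalize X G) \<odot>\<^sub>j (normalize X F' \<odot>\<^sub>i normalize X G'))"
    unfolding split_coherence_intch[OF f ij a b, unfolded intch_coherent_def]
    using assoc[OF H1 hom_cmp[OF bv R] A] assoc[OF H1 bv R] by simp
  also have "\<dots> = normalize X (Glue j (Glue i F G) (Glue i F' G'))"
    unfolding eq1 e1 using assoc[OF H1 S B] .
  finally show "normalize X (Glue i (Glue j F F') (Glue j G G')) \<cdot> \<beta> i j (ev F X) (ev G X) (ev F' X) (ev G' X) =
      normalize X (Glue j (Glue i F G) (Glue i F' G'))" .
qed

section \<open>Natural isomorphisms built from associators and interchangers\<close>

lemma val_cong:
  assumes "bounds K lo hi" "\<And>b. b \<in> box K lo hi \<Longrightarrow> X b = Y b"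
  shows "val X lo hi = val Y lo hi"
  using tiling_blocks[OF normal_tiling[OF finite_K[OF K] assms(1)]] assms(2)
  unfolding val_def by (intro eval_cong) simp

lemma agree_hi: "(\<forall>b\<in>box K lo hi. X b = Y b) \<Longrightarrow> fits X lo hi \<Longrightarrow> lo i < a \<Longrightarrow> a < hi i \<Longrightarrow>
    \<forall>b\<in>box K lo (hi(i := a)). X b = Y b"
  using box_below[of i K a hi lo] fits_K by auto

lemma agree_lo: "(\<forall>b\<in>box K lo hi. X b = Y b) \<Longrightarrow> fits X lo hi \<Longrightarrow> lo i < a \<Longrightarrow> a < hi i \<Longrightarrow>
    \<forall>b\<in>box K (lo(i := a)) hi. X b = Y b"
  using box_above[of i K lo a hi] fits_K by auto

lemma split_cong:
  "fits X lo hi \<Longrightarrow> \<forall>b\<in>box K lo hi. X b = Y b \<Longrightarrow> lo i < a \<Longrightarrow> a < hi i \<Longrightarrow> split_iso X i a lo hi = split_iso Y i a lo hi"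
proof (induction "bulk lo hi" arbitrary: lo hi rule: less_induct)
  case less
  note f = less.prems(1) and ag = less.prems(2) and a = less.prems(3,4)
  have g: "fits Y lo hi"
    using f ag grid_cong[of K lo hi X Y] by blast
  have v: "val X lo' hi' = val Y lo' hi'" if "fits X lo' hi'" "\<forall>b\<in>box K lo' hi'. X b = Y b" for lo' hi'
    using val_cong[OF grid_bounds[OF that(1)]] that(2) by blast
  have "i \<in> thick lo hi"
    using a by (auto simp: thick_def)
  then obtain m where m: "lead lo hi m"
    using lead_exists by blast
  note s = leadD[OF m]
  note p = part_split[OF f s]
  note fU = fits_hi[OF f s] and fV = fits_lo[OF f s] and aU = agree_hi[OF ag f s] and aV = agree_lo[OF ag f s]
  have vU: "val X lo (hi(m := Suc (lo m))) = val Y lo (hi(m := Suc (lo m)))"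
    by (rule v[OF fU aU])
  show ?case
  proof (cases "i = m")
    case im: True
    show ?thesis
    proof (cases "a = Suc (lo m)")
      case True
      then show ?thesis
        using split_iso_lead(2)[OF f m] split_iso_lead(2)[OF g m] im v[OF f ag] by simp
    next
      case False
      then have sa: "(lo(m := Suc (lo m))) m < a" "a < hi m" "lo m < a"
        using a im by auto
      have "split_iso X m a (lo(m := Suc (lo m))) hi = split_iso Y m a (lo(m := Suc (lo m))) hi"
        using less.hyps[OF _ fV aV] p sa im by (simp add: part_def)
      then show ?thesis
        using split_iso_lead(3)[OF f m False] split_iso_lead(3)[OF g m False] im vU
          v[OF fits_hi[OF fV sa(1,2)] agree_hi[OF aV fV sa(1,2)]]
          v[OF fits_lo[OF f sa(3,2)] agree_lo[OF ag f sa(3,2)]] by simp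
    qed
  next
    case im: False
    then have a': "lo i < a" "a < (hi(m := Suc (lo m))) i" "(lo(m := Suc (lo m))) i < a" "a < hi i"
      using a by auto
    have "split_iso X i a lo (hi(m := Suc (lo m))) = split_iso Y i a lo (hi(m := Suc (lo m)))"
      "split_iso X i a (lo(m := Suc (lo m))) hi = split_iso Y i a (lo(m := Suc (lo m))) hi"
      using less.hyps[OF _ fU aU] less.hyps[OF _ fV aV] p a' im by (simp_all add: part_def)
    then show ?thesis
      using split_iso_lead(1)[OF f m im] split_iso_lead(1)[OF g m im]
        v[OF fits_hi[OF fU a'(1,2)] agree_hi[OF aU fU a'(1,2)]]
        v[OF fits_lo[OF fU a'(1,2)] agree_lo[OF aU fU a'(1,2)]]
        v[OF fits_hi[OF fV a'(3,4)] agree_hi[OF aV fV a'(3,4)]]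
        v[OF fits_lo[OF fV a'(3,4)] agree_lo[OF aV fV a'(3,4)]] by simp
  qed
qed

text \<open>The rule \<open>glue\<close> of \<open>built_iso\<close> evaluates components at
  restricted tuples; this lemma carries \<open>normalize\<close> from such a restriction to the
  whole tuple.\<close>

lemma normalize_cong:
  "tiling K lo hi T \<Longrightarrow> fits X lo hi \<Longrightarrow> \<forall>b\<in>box K lo hi. X b = Y b \<Longrightarrow> normalize X T = normalize Y T"
proof (induction rule: tiling.induct)
  case (block lo hi)
  then show ?case
    by (simp add: lo_in_box)
next
  case (glue lo hi i a F G)
  note a = glue.hyps(3,4)
  have "normalize X F = normalize Y F" "normalize X G = normalize Y G"
    using glue.IH fits_hi[OF glue.prems(1) a] fits_lo[OF glue.prems(1) a]
      agree_hi[OF glue.prems(2,1) a] agree_lo[OF glue.prems(2,1) a] by blast+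
  then show ?case
    unfolding normalize_Glue[OF glue.hyps(5,6)] using split_cong[OF glue.prems a] by simp
qed

section \<open>The category of composable tuples and its composition functors\<close>

abbreviation "tuples D \<equiv> composable_tuples P K D"

abbreviation "CT lo hi \<equiv> tuples (box K lo hi)"

lemma ct_sel:
  "Dom (tuples D) f = (\<lambda>b\<in>D. Dom M (f b))"
  "Cod (tuples D) f = (\<lambda>b\<in>D. Cod M (f b))"
  "Idt (tuples D) Y = (\<lambda>b\<in>D. \<iota> (Y b))"
  "Cmp (tuples D) g f = (\<lambda>b\<in>D. g b \<cdot> f b)"
  by (simp_all add: composable_tuples_def sub_cat_def power_cat_def)

lemma ct_Obj: "X \<in> Obj (tuples D) \<longleftrightarrow>
    X \<in> extensional D \<and> (\<forall>b\<in>D. X b \<in> Ob) \<and> X \<in> matching K D (so P K) (to P K)"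
  by (auto simp: composable_tuples_def sub_cat_def power_cat_def PiE_iff)

lemma ct_Arr: "f \<in> Arr (tuples D) \<longleftrightarrow>
    f \<in> extensional D \<and> (\<forall>b\<in>D. f b \<in> Arr M) \<and> f \<in> matching K D (sa P K) (ta P K)"
  by (auto simp: composable_tuples_def sub_cat_def power_cat_def PiE_iff)

lemma CT_fits: "bounds K lo hi \<Longrightarrow> X \<in> Obj (CT lo hi) \<Longrightarrow> fits X lo hi"
  by (simp add: ct_Obj grid_def)

lemma ct_restrict_Obj: "X \<in> Obj (tuples D) \<Longrightarrow> D' \<subseteq> D \<Longrightarrow> restrict X D' \<in> Obj (tuples D')"
  using matching_mono[of D' D X K] matching_cong[of D' "restrict X D'" X K] by (auto simp: ct_Obj)

lemma ct_restrict_Arr: "f \<in> Arr (tuples D) \<Longrightarrow> D' \<subseteq> D \<Longrightarrow> restrict f D' \<in> Arr (tuples D')"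
  using matching_mono[of D' D f K] matching_cong[of D' "restrict f D'" f K] by (auto simp: ct_Arr)

text \<open>Source and target are functors, so the domains and the codomains of matching arrows
  match.\<close>

lemma matching_dom:
  assumes "\<forall>b\<in>D. f b \<in> Arr M" "f \<in> matching K D (sa P K) (ta P K)"
  shows "(\<lambda>b\<in>D. Dom M (f b)) \<in> matching K D (so P K) (to P K)"
    and "(\<lambda>b\<in>D. Cod M (f b)) \<in> matching K D (so P K) (to P K)"
proof -
  have "oadj i (Dom M (f b)) (Dom M (f (b(i := Suc (b i))))) \<and> oadj i (Cod M (f b)) (Cod M (f (b(i := Suc (b i)))))"
    if "i \<in> K" "b \<in> D" "b(i := Suc (b i)) \<in> D" for i b
  proof -
    have "adj i (f b) (f (b(i := Suc (b i))))"
      using assms that by (auto simp: adj_def matching_def)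
    then show ?thesis
      using adj_dom adj_cod adj_def hom_def by metis
  qed
  then show "(\<lambda>b\<in>D. Dom M (f b)) \<in> matching K D (so P K) (to P K)"
    "(\<lambda>b\<in>D. Cod M (f b)) \<in> matching K D (so P K) (to P K)"
    by (auto simp: matching_def oadj_def)
qed

lemma matching_idt:
  assumes "\<forall>b\<in>D. X b \<in> Ob" "X \<in> matching K D (so P K) (to P K)"
  shows "(\<lambda>b\<in>D. \<iota> (X b)) \<in> matching K D (sa P K) (ta P K)"
proof -
  have "adj i (\<iota> (X b)) (\<iota> (X (b(i := Suc (b i)))))"
    if "i \<in> K" "b \<in> D" "b(i := Suc (b i)) \<in> D" for i b
    using that assms by (intro adj_id) (auto simp: oadj_def matching_def)
  then show ?thesis
    by (auto simp: matching_def adj_def)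
qed

lemma matching_cmp:
  assumes "\<forall>b\<in>D. f b \<in> Arr M \<and> g b \<in> Arr M \<and> Cod M (f b) = Dom M (g b)"
    "f \<in> matching K D (sa P K) (ta P K)" "g \<in> matching K D (sa P K) (ta P K)"
  shows "(\<lambda>b\<in>D. g b \<cdot> f b) \<in> matching K D (sa P K) (ta P K)"
proof -
  have "adj i (g b \<cdot> f b) (g (b(i := Suc (b i))) \<cdot> f (b(i := Suc (b i))))"
    if "i \<in> K" "b \<in> D" "b(i := Suc (b i)) \<in> D" for i b
    using that assms by (intro adj_cmp) (auto simp: adj_def hom_def matching_def)
  then show ?thesis
    by (auto simp: matching_def adj_def)
qed

lemma ct_category: "category (tuples D)"
proof
  fix f assume "f \<in> Arr (tuples D)"
  then show "Dom (tuples D) f \<in> Obj (tuples D)"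
    "Cod (tuples D) f \<in> Obj (tuples D)"
    using matching_dom[of D f] by (auto simp: ct_sel ct_Arr ct_Obj M.dom_obj M.cod_obj)
next
  fix X assume "X \<in> Obj (tuples D)"
  then show "Idt (tuples D) X \<in> Arr (tuples D)"
    using matching_idt[of D X] by (auto simp: ct_sel ct_Arr ct_Obj M.idt_arr)
next
  fix X assume "X \<in> Obj (tuples D)"
  then show "Dom (tuples D) (Idt (tuples D) X) = X"
    "Cod (tuples D) (Idt (tuples D) X) = X"
    by (auto simp: ct_sel ct_Obj M.dom_idt M.cod_idt intro: extensionalityI[of _ D])
next
  fix f g assume *: "f \<in> Arr (tuples D)" "g \<in> Arr (tuples D)"
    "Cod (tuples D) f = Dom (tuples D) g"
  have c: "Cod M (f b) = Dom M (g b)" if "b \<in> D" for b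
    using fun_cong[OF *(3), of b] that by (simp add: ct_sel)
  show "Cmp (tuples D) g f \<in> Arr (tuples D)"
    using * c matching_cmp[of D f g] by (auto simp: ct_sel(4) ct_Arr M.cmp_arr)
  show "Dom (tuples D) (Cmp (tuples D) g f) = Dom (tuples D) f"
    "Cod (tuples D) (Cmp (tuples D) g f) = Cod (tuples D) g"
    using * c by (auto simp: ct_sel ct_Arr M.dom_cmp M.cod_cmp intro!: restrict_ext)
next
  fix f assume "f \<in> Arr (tuples D)"
  then show "Cmp (tuples D) f (Idt (tuples D) (Dom (tuples D) f)) = f"
    "Cmp (tuples D) (Idt (tuples D) (Cod (tuples D) f)) f = f"
    by (auto simp: ct_sel ct_Arr M.cmp_idt_right M.cmp_idt_left intro: extensionalityI[of _ D])
next
  fix f g h assume *: "f \<in> Arr (tuples D)" "g \<in> Arr (tuples D)" "h \<in> Arr (tuples D)"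
    "Cod (tuples D) f = Dom (tuples D) g"
    "Cod (tuples D) g = Dom (tuples D) h"
  have c: "Cod M (f b) = Dom M (g b)" "Cod M (g b) = Dom M (h b)" if "b \<in> D" for b
    using fun_cong[OF *(4), of b] fun_cong[OF *(5), of b] that by (simp_all add: ct_sel)
  show "Cmp (tuples D) h (Cmp (tuples D) g f) =
      Cmp (tuples D) (Cmp (tuples D) h g) f"
    using * c by (auto simp: ct_sel(4) ct_Arr M.cmp_assoc intro!: restrict_ext)
qed

lemma eval_hom:
  assumes "tiling K lo hi T" "f \<in> Arr (CT lo hi)"
  shows "hom (eva T f) (ev T (Dom (CT lo hi) f)) (ev T (Cod (CT lo hi) f))"
  using assms
proof (induction arbitrary: f rule: tiling.induct)
  case (block lo hi)
  then show ?case
    using lo_in_box[OF block(1)] by (auto simp: ct_sel ct_Arr hom_def)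
next
  case (glue lo hi i a F G)
  note a = glue.hyps(3,4)
  have sub: "box K lo (hi(i := a)) \<subseteq> box K lo hi" "box K (lo(i := a)) hi \<subseteq> box K lo hi"
    using box_split[of i K lo a hi] glue.hyps by auto
  have bl: "blocks F = box K lo (hi(i := a))" "blocks G = box K (lo(i := a)) hi"
    using tiling_blocks glue.hyps by blast+
  have ev: "ev F (Dom (CT lo hi) f) = ev F (Dom (CT lo (hi(i := a))) (restrict f (blocks F)))"
    "ev F (Cod (CT lo hi) f) = ev F (Cod (CT lo (hi(i := a))) (restrict f (blocks F)))"
    "ev G (Dom (CT lo hi) f) = ev G (Dom (CT (lo(i := a)) hi) (restrict f (blocks G)))"
    "ev G (Cod (CT lo hi) f) = ev G (Cod (CT (lo(i := a)) hi) (restrict f (blocks G)))"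
    using sub bl by (auto simp: ct_sel intro!: eval_cong)
  have eva: "eva F (restrict f (blocks F)) = eva F f" "eva G (restrict f (blocks G)) = eva G f"
    by (auto intro!: eval_cong)
  have hF: "hom (eva F f) (ev F (Dom (CT lo hi) f)) (ev F (Cod (CT lo hi) f))"
    using glue.IH(1)[of "restrict f (blocks F)"] ct_restrict_Arr[OF glue.prems sub(1)] by (simp add: ev eva[unfolded bl] bl del: restrict_apply)
  have hG: "hom (eva G f) (ev G (Dom (CT lo hi) f)) (ev G (Cod (CT lo hi) f))"
    using glue.IH(2)[of "restrict f (blocks G)"] ct_restrict_Arr[OF glue.prems sub(2)] by (simp add: ev eva[unfolded bl] bl del: restrict_apply)
  have "grid K (Arr M) (sa P K) (ta P K) lo hi f"
    using glue.prems glue.hyps(1) by (simp add: grid_def ct_Arr)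
  then have "adj i (eva F f) (eva G f)"
    using arr.eval_tiling(2)[OF K glue.hyps(5,6,1-4,7)] hF hG glue.hyps(2) by (simp add: adj_def hom_def)
  then show ?case
    using hom_glue[OF hF hG] by simp
qed

lemma eval_adj:
  assumes "tiling K lo (hi(i := a)) F" "tiling K (lo(i := a)) hi G" "bounds K lo hi" "i \<in> K" "lo i < a" "a < hi i"
    "tgt_face i F = src_face i G" "f \<in> Arr (CT lo hi)"
  shows "adj i (eva F f) (eva G f)"
proof -
  have g: "grid K (Arr M) (sa P K) (ta P K) lo hi f"
    using assms by (simp add: grid_def ct_Arr)
  show ?thesis
    using arr.eval_tiling(2)[OF K assms(1-7) g] arr.eval_tiling(1)[OF K assms(1) grid_hi[OF g assms(4-6)]]
      arr.eval_tiling(1)[OF K assms(2) grid_lo[OF g assms(4-6)]] assms(4) by (simp add: adj_def)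
qed

text \<open>At each \<open>Glue\<close>, identities and composites are preserved because
  \<open>Glu\<close> is a functor, by \<open>glue_id\<close> and \<open>interchange\<close>.\<close>

lemma composition_is_functor:
  assumes "tiling K lo hi T"
  shows "is_functor (CT lo hi) M (composition_functor P K T)"
proof -
  note bd = tiling_bounds[OF assms]
  have idt: "eva T (Idt (CT lo hi) X) = \<iota> (ev T X)" if "X \<in> Obj (CT lo hi)" for X
    using assms that
  proof (induction arbitrary: X rule: tiling.induct)
    case (block lo hi)
    then show ?case
      using lo_in_box[OF block(1)] by (simp add: ct_sel)
  next
    case (glue lo hi i a F G)
    have sub: "box K lo (hi(i := a)) \<subseteq> box K lo hi" "box K (lo(i := a)) hi \<subseteq> box K lo hi"
      using box_split[of i K lo a hi] glue.hyps by auto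
    have bl: "blocks F = box K lo (hi(i := a))" "blocks G = box K (lo(i := a)) hi"
      using tiling_blocks glue.hyps by blast+
    have "eva F (Idt (CT lo hi) X) = eva F (Idt (CT lo (hi(i := a))) (restrict X (blocks F)))"
      "eva G (Idt (CT lo hi) X) = eva G (Idt (CT (lo(i := a)) hi) (restrict X (blocks G)))"
      using sub bl by (auto simp: ct_sel intro!: eval_cong)
    moreover have "ev F (restrict X (blocks F)) = ev F X" "ev G (restrict X (blocks G)) = ev G X"
      by (auto intro!: eval_cong)
    ultimately have id: "eva F (Idt (CT lo hi) X) = \<iota> (ev F X)" "eva G (Idt (CT lo hi) X) = \<iota> (ev G X)"
      using glue.IH ct_restrict_Obj[OF glue.prems sub(1)] ct_restrict_Obj[OF glue.prems sub(2)] by (simp_all add: bl del: restrict_apply)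
    have "fits X lo hi"
      using CT_fits glue.prems glue.hyps(1) by blast
    note f = this fits_hi[OF this glue.hyps(3,4)] fits_lo[OF this glue.hyps(3,4)]
    have "oadj i (ev F X) (ev G X)"
      using obj.eval_tiling(2)[OF K glue.hyps(5,6,1-4,7) f(1)] obj.eval_tiling(1)[OF K glue.hyps(5) f(2)]
        obj.eval_tiling(1)[OF K glue.hyps(6) f(3)] glue.hyps(2) by (simp add: oadj_def)
    then show ?case
      using id glue_id by simp
  qed
  have cmp: "eva T (Cmp (CT lo hi) g f) = eva T g \<cdot> eva T f"
    if "f \<in> Arr (CT lo hi)" "g \<in> Arr (CT lo hi)" "Cod (CT lo hi) f = Dom (CT lo hi) g" for f g
    using assms that
  proof (induction arbitrary: f g rule: tiling.induct)
    case (block lo hi)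
    then show ?case
      using lo_in_box[OF block(1)] by (simp add: ct_sel)
  next
    case (glue lo hi i a F G)
    have sub: "box K lo (hi(i := a)) \<subseteq> box K lo hi" "box K (lo(i := a)) hi \<subseteq> box K lo hi"
      using box_split[of i K lo a hi] glue.hyps by auto
    have bl: "blocks F = box K lo (hi(i := a))" "blocks G = box K (lo(i := a)) hi"
      using tiling_blocks glue.hyps by blast+
    have c: "Cod M (f b) = Dom M (g b)" if "b \<in> box K lo hi" for b
      using fun_cong[OF glue.prems(3), of b] that by (simp add: ct_sel)
    have "eva F (Cmp (CT lo hi) g f) = eva F (Cmp (CT lo (hi(i := a))) (restrict g (blocks F)) (restrict f (blocks F)))"
      "eva G (Cmp (CT lo hi) g f) = eva G (Cmp (CT (lo(i := a)) hi) (restrict g (blocks G)) (restrict f (blocks G)))"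
      using sub bl by (auto simp: ct_sel(4) intro!: eval_cong)
    moreover have "Cod (CT lo (hi(i := a))) (restrict f (blocks F)) = Dom (CT lo (hi(i := a))) (restrict g (blocks F))"
      "Cod (CT (lo(i := a)) hi) (restrict f (blocks G)) = Dom (CT (lo(i := a)) hi) (restrict g (blocks G))"
      using sub bl c by (auto simp: ct_sel intro!: restrict_ext)
    moreover have "eva F (restrict f (blocks F)) = eva F f" "eva G (restrict f (blocks G)) = eva G f"
      "eva F (restrict g (blocks F)) = eva F g" "eva G (restrict g (blocks G)) = eva G g"
      by (auto intro!: eval_cong)
    ultimately have id: "eva F (Cmp (CT lo hi) g f) = eva F g \<cdot> eva F f" "eva G (Cmp (CT lo hi) g f) = eva G g \<cdot> eva G f"
      using glue.IH ct_restrict_Arr[OF glue.prems(1) sub(1)] ct_restrict_Arr[OF glue.prems(1) sub(2)]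
        ct_restrict_Arr[OF glue.prems(2) sub(1)] ct_restrict_Arr[OF glue.prems(2) sub(2)] by (simp_all add: bl del: restrict_apply)
    have adj: "adj i (eva F f) (eva G f)" "adj i (eva F g) (eva G g)"
      using eval_adj[OF glue.hyps(5,6,1-4,7)] glue.prems by blast+
    \<comment> \<open>The interchange law requires the values of \<open>f\<close> and
      \<open>g\<close> on each factor to be composable; they inherit this from the tuples.\<close>
    have cc: "Cod M (eva H f) = Dom M (eva H g)" if H: "tiling K lo' hi' H" "box K lo' hi' \<subseteq> box K lo hi" for H lo' hi'
    proof -
      have "Cod (CT lo' hi') (restrict f (box K lo' hi')) = Dom (CT lo' hi') (restrict g (box K lo' hi'))"
        using H(2) c by (auto simp: ct_sel intro!: restrict_ext)
      moreover have "eva H (restrict f (box K lo' hi')) = eva H f" "eva H (restrict g (box K lo' hi')) = eva H g"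
        using tiling_blocks[OF H(1)] by (auto intro!: eval_cong)
      ultimately show ?thesis
        using eval_hom[OF H(1) ct_restrict_Arr[OF glue.prems(1) H(2)]] eval_hom[OF H(1) ct_restrict_Arr[OF glue.prems(2) H(2)]]
        by (simp add: hom_def)
    qed
    show ?case
      using id cc[OF glue.hyps(5) sub(1)] cc[OF glue.hyps(6) sub(2)] adj
        interchange[of "eva F f" _ _ "eva F g" _ "eva G f" _ _ "eva G g" _ i, unfolded hom_def]
      by (simp add: adj_def)
  qed
  interpret CT: category "CT lo hi"
    by (rule ct_category)
  show ?thesis
  proof
    show "on_obj (composition_functor P K T) X \<in> Ob" if "X \<in> Obj (CT lo hi)" for X
      using obj.eval_tiling(1)[OF K assms CT_fits[OF bd that]] by (simp add: composition_functor_def)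
  qed (use eval_hom[OF assms] idt cmp in \<open>auto simp: composition_functor_def hom_def\<close>)
qed

section \<open>Uniqueness: the invariant of \<open>built_iso\<close>\<close>

text \<open>Commutation with the isomorphisms to the normal form. Extensionality is included so that
  the invariant determines \<open>\<eta>\<close> as a HOL function.\<close>

definition coherent :: "block \<Rightarrow> block \<Rightarrow> scheme \<Rightarrow> scheme \<Rightarrow> ((block \<Rightarrow> 'o) \<Rightarrow> 'a) \<Rightarrow> bool" where
  "coherent lo hi T T' \<eta> \<longleftrightarrow> tiling K lo hi T \<and> tiling K lo hi T' \<and> \<eta> \<in> extensional (Obj (CT lo hi)) \<and>
     (\<forall>X\<in>Obj (CT lo hi). hom (\<eta> X) (ev T X) (ev T' X) \<and> normalize X T' \<cdot> \<eta> X = normalize X T)"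

text \<open>Since \<open>normalize X T'\<close> is invertible, the invariant leaves one possible
  component; this gives both uniqueness and invertibility.\<close>

lemma coherent_value:
  assumes "coherent lo hi T T' \<eta>" "X \<in> Obj (CT lo hi)"
  shows "\<eta> X = inverse_arr M (normalize X T') \<cdot> normalize X T" and "iso (\<eta> X)"
proof -
  have T: "tiling K lo hi T" "tiling K lo hi T'" and h: "hom (\<eta> X) (ev T X) (ev T' X)"
    and eq: "normalize X T' \<cdot> \<eta> X = normalize X T"
    using assms by (auto simp: coherent_def)
  have f: "fits X lo hi"
    using CT_fits[OF tiling_bounds[OF T(1)] assms(2)] .
  note n = normalize_hom[OF T(1) f] and n' = normalize_hom[OF T(2) f]
  note i = inverse[OF n'(2,1)]
  show v: "\<eta> X = inverse_arr M (normalize X T') \<cdot> normalize X T"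
    using assoc[OF h n'(1) i(2)] i(3) cmp_id_left[OF h] eq by simp
  show "iso (\<eta> X)"
    unfolding v using iso_cmp[OF n(2) i(5) n(1) i(2)] .
qed

text \<open>Carries the invariant of a part of the box over to tuples on the whole box, where the
  two factors of a gluing are compared.\<close>

lemma coherent_restrict:
  assumes "coherent lo' hi' T T' \<eta>" "X \<in> Obj (CT lo hi)" "box K lo' hi' \<subseteq> box K lo hi"
  shows "hom (\<eta> (restrict X (box K lo' hi'))) (ev T X) (ev T' X)"
    and "normalize X T' \<cdot> \<eta> (restrict X (box K lo' hi')) = normalize X T"
    and "\<eta> (restrict X (box K lo' hi')) = inverse_arr M (normalize X T') \<cdot> normalize X T"
proof -
  let ?X = "restrict X (box K lo' hi')"
  have T: "tiling K lo' hi' T" "tiling K lo' hi' T'"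
    using assms by (auto simp: coherent_def)
  have X: "?X \<in> Obj (CT lo' hi')"
    using ct_restrict_Obj[OF assms(2,3)] .
  have f: "fits ?X lo' hi'"
    using CT_fits[OF tiling_bounds[OF T(1)] X] .
  have n: "normalize ?X T = normalize X T" "normalize ?X T' = normalize X T'"
    using normalize_cong[OF T(1) f] normalize_cong[OF T(2) f] by simp_all
  have e: "ev T ?X = ev T X" "ev T' ?X = ev T' X"
    using tiling_blocks[OF T(1)] tiling_blocks[OF T(2)] by (auto intro!: eval_cong)
  show "hom (\<eta> ?X) (ev T X) (ev T' X)" "normalize X T' \<cdot> \<eta> ?X = normalize X T"
    using assms(1) X n e by (auto simp: coherent_def)
  show "\<eta> ?X = inverse_arr M (normalize X T') \<cdot> normalize X T"
    using coherent_value(1)[OF assms(1) X] n by simp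
qed

lemma fun_upd_cancel: "f(i := a) = f(i := b) \<Longrightarrow> a = b"
  by (drule fun_cong[of _ _ i]) simp

lemma assoc_tilings:
  assumes "tiling K lo hi (Glue i (Glue i F G) H)" "tiling K lo hi (Glue i F (Glue i G H))"
  obtains a b where "lo i < a" "a < b" "b < hi i" "tiling K lo (hi(i := a)) F"
    "tiling K (lo(i := a)) (hi(i := b)) G" "tiling K (lo(i := b)) hi H"
    "tgt_face i F = src_face i G" "tgt_face i G = src_face i H" "i \<in> K"
proof -
  obtain b where b: "i \<in> K" "b < hi i" "tiling K lo (hi(i := b)) (Glue i F G)" "tiling K (lo(i := b)) hi H"
    "tgt_face i (Glue i F G) = src_face i H"
    using assms(1) by (auto elim: tiling_GlueE)
  obtain a where a: "lo i < a" "a < b" "tiling K lo (hi(i := a)) F" "tiling K (lo(i := a)) (hi(i := b)) G"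
    "tgt_face i F = src_face i G"
    using b(3) by (auto elim: tiling_GlueE)
  show ?thesis
    using that a b by simp
qed

lemma intch_tilings:
  assumes "i \<noteq> j" "tiling K lo hi (Glue j (Glue i F G) (Glue i F' G'))" "tiling K lo hi (Glue i (Glue j F F') (Glue j G G'))"
  obtains a b where "lo i < a" "a < hi i" "lo j < b" "b < hi j" "tiling K lo (hi(j := b, i := a)) F"
    "tiling K (lo(i := a)) (hi(j := b)) G" "tiling K (lo(j := b)) (hi(i := a)) F'" "tiling K (lo(j := b, i := a)) hi G'"
    "tgt_face i F = src_face i G" "tgt_face i F' = src_face i G'" "tgt_face j F = src_face j F'"
    "tgt_face j G = src_face j G'" "i \<in> K" "j \<in> K"
proof -
  obtain b where b: "j \<in> K" "lo j < b" "b < hi j" "tiling K lo (hi(j := b)) (Glue i F G)" "tiling K (lo(j := b)) hi (Glue i F' G')"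
    using assms(2) by (auto elim: tiling_GlueE)
  obtain a where a: "lo i < a" "a < hi i" "tiling K lo (hi(j := b, i := a)) F" "tiling K (lo(i := a)) (hi(j := b)) G"
    "tgt_face i F = src_face i G" "i \<in> K"
    using b(4) assms(1) by (auto elim: tiling_GlueE)
  obtain a' where a': "tiling K (lo(j := b)) (hi(i := a')) F'" "tiling K (lo(j := b, i := a')) hi G'" "tgt_face i F' = src_face i G'"
    using b(5) by (auto elim: tiling_GlueE)
  obtain c where c: "tiling K lo (hi(i := c)) (Glue j F F')" "tiling K (lo(i := c)) hi (Glue j G G')"
    using assms(3) by (auto elim: tiling_GlueE)
  obtain d where d: "tiling K lo (hi(i := c, j := d)) F" "tiling K (lo(j := d)) (hi(i := c)) F'" "tgt_face j F = src_face j F'"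
    using c(1) by (auto elim: tiling_GlueE)
  have e: "tgt_face j G = src_face j G'"
    using c(2) by (auto elim: tiling_GlueE)
  \<comment> \<open>The scheme that is cut along \<open>i\<close> first has a single cut
    \<open>c\<close> through both rows. Comparing the corners of \<open>F\<close> identifies
    \<open>c\<close> with \<open>a\<close>, and comparing those of \<open>F'\<close> identifies it
    with \<open>a'\<close>.\<close>
  have "hi(i := c, j := d) = hi(j := b, i := a)"
    using tiling_unique[OF a(3) d(1)] by blast
  then have "(hi(i := c, j := d)) i = (hi(j := b, i := a)) i"
    by (rule fun_cong)
  then have "c = a"
    using assms(1) by simp
  moreover have "hi(i := c) = hi(i := a')"
    using tiling_unique[OF a'(1) d(2)] by simp
  ultimately have "a' = a"
    using fun_upd_cancel by metis
  then show ?thesis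
    using that a a' b d e by simp
qed

lemma glue_tilings:
  assumes "tiling K lo hi (Glue i F G)"
  obtains a where "lo i < a" "a < hi i" "i \<in> K" "tiling K lo (hi(i := a)) F" "tiling K (lo(i := a)) hi G"
    "tgt_face i F = src_face i G" "box K lo (hi(i := a)) \<subseteq> box K lo hi" "box K (lo(i := a)) hi \<subseteq> box K lo hi"
proof -
  obtain a where a: "lo i < a" "a < hi i" "i \<in> K" "tiling K lo (hi(i := a)) F" "tiling K (lo(i := a)) hi G"
    "tgt_face i F = src_face i G"
    using assms by (auto elim: tiling_GlueE)
  then show ?thesis
    using that[of a] box_split[of i K lo a hi] by simp
qed

text \<open>The components match because each is a normalization followed by the inverse of one, and
  both kinds match along \<open>i\<close>. In \<open>connected_glue\<close> this supplies the last
  premise of the rule \<open>glue\<close> of \<open>built_iso\<close>.\<close>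

lemma coherent_glue:
  assumes "coherent lo (hi(i := a)) F F' \<eta>" "coherent (lo(i := a)) hi G G' \<theta>"
    and T: "tiling K lo hi (Glue i F G)" "tiling K lo hi (Glue i F' G')" and X: "X \<in> Obj (CT lo hi)"
  shows "adj i (\<eta> (restrict X (box K lo (hi(i := a))))) (\<theta> (restrict X (box K (lo(i := a)) hi)))"
    and "hom (\<eta> (restrict X (box K lo (hi(i := a)))) \<odot>\<^sub>i \<theta> (restrict X (box K (lo(i := a)) hi))) (ev (Glue i F G) X) (ev (Glue i F' G') X)"
    and "normalize X (Glue i F' G') \<cdot> (\<eta> (restrict X (box K lo (hi(i := a)))) \<odot>\<^sub>i \<theta> (restrict X (box K (lo(i := a)) hi))) = normalize X (Glue i F G)"
proof -
  obtain a0 where a0: "lo i < a0" "a0 < hi i" "i \<in> K" "tiling K lo (hi(i := a0)) F" "tiling K (lo(i := a0)) hi G"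
    "tgt_face i F = src_face i G" "box K lo (hi(i := a0)) \<subseteq> box K lo hi" "box K (lo(i := a0)) hi \<subseteq> box K lo hi"
    using glue_tilings[OF T(1)] .
  have t: "tiling K lo (hi(i := a)) F" "tiling K lo (hi(i := a)) F'" "tiling K (lo(i := a)) hi G" "tiling K (lo(i := a)) hi G'"
    using assms(1,2) by (auto simp: coherent_def)
  \<comment> \<open>A scheme tiles only one box, so the cut of \<open>Glue i F G\<close> is the
    given \<open>a\<close>.\<close>
  have "a0 = a"
    using tiling_unique[OF t(1) a0(4)] fun_upd_cancel by metis
  note a = a0[unfolded this]
  have faces': "tgt_face i F' = src_face i G'"
    using T(2) by (auto elim: tiling_GlueE)
  have f: "fits X lo hi"
    using CT_fits[OF tiling_bounds[OF T(1)] X] .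
  note fs = fits_hi[OF f a(1,2)] fits_lo[OF f a(1,2)]
  note cF = coherent_restrict[OF assms(1) X a(7)] and cG = coherent_restrict[OF assms(2) X a(8)]
  note nF = normalize_hom[OF t(1) fs(1)] normalize_hom[OF t(2) fs(1)] and nG = normalize_hom[OF t(3) fs(2)] normalize_hom[OF t(4) fs(2)]
  note n1 = normalize_adj[OF t(1,3) a(1,2) f a(6)] and n2 = normalize_adj[OF t(2,4) a(1,2) f faces']
  show adj: "adj i (\<eta> (restrict X (box K lo (hi(i := a))))) (\<theta> (restrict X (box K (lo(i := a)) hi)))"
    unfolding cF(3) cG(3)
    using adj_cmp[OF nF(1) inverse(2)[OF nF(4,3)] nG(1) inverse(2)[OF nG(4,3)] n1 iso_glue(1)[OF nF(4) nG(4) n2]] .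
  show "hom (\<eta> (restrict X (box K lo (hi(i := a)))) \<odot>\<^sub>i \<theta> (restrict X (box K (lo(i := a)) hi))) (ev (Glue i F G) X) (ev (Glue i F' G') X)"
    using hom_glue[OF cF(1) cG(1) adj] by simp
  show "normalize X (Glue i F' G') \<cdot> (\<eta> (restrict X (box K lo (hi(i := a)))) \<odot>\<^sub>i \<theta> (restrict X (box K (lo(i := a)) hi))) = normalize X (Glue i F G)"
    unfolding normalize_Glue[OF t(1,3)] normalize_Glue[OF t(2,4)]
    using assoc[OF hom_glue[OF cF(1) cG(1) adj] hom_glue[OF nF(3) nG(3) n2] split_hom(1)[OF f a(1,2)]]
      interchange[OF cF(1) nF(3) cG(1) nG(3) adj n2] cF(2) cG(2) by simp
qed

text \<open>For \<open>\<alpha>\<close> and \<open>\<beta>\<close> the invariant is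
  \<open>normalize_assoc\<close> and \<open>normalize_intch\<close>, for their inverses it follows
  by \<open>inverse_shift\<close>, and composition and gluing preserve it.\<close>

lemma built_iso_coherent:
  "built_iso P K D T T' \<eta> \<Longrightarrow> bounds K lo hi \<Longrightarrow> D = box K lo hi \<Longrightarrow> coherent lo hi T T' \<eta>"
proof (induction arbitrary: lo hi rule: built_iso.induct)
  case (assoc D i F G H)
  note bd = assoc.prems(1)
  have T: "tiling K lo hi (Glue i (Glue i F G) H)" "tiling K lo hi (Glue i F (Glue i G H))"
    using assoc built_imp_tiling by blast+
  obtain a b where ab: "lo i < a" "a < b" "b < hi i" and t: "tiling K lo (hi(i := a)) F"
    "tiling K (lo(i := a)) (hi(i := b)) G" "tiling K (lo(i := b)) hi H"
    "tgt_face i F = src_face i G" "tgt_face i G = src_face i H"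
    using assoc_tilings[OF T] by metis
  show ?case
    unfolding coherent_def
    using T normalize_assoc[OF t ab CT_fits[OF bd]] hom_assoc(1) assoc.prems(2) by auto
next
  case (assoc_inv D i F G H)
  note bd = assoc_inv.prems(1)
  have T: "tiling K lo hi (Glue i (Glue i F G) H)" "tiling K lo hi (Glue i F (Glue i G H))"
    using assoc_inv built_imp_tiling by blast+
  obtain a b where ab: "lo i < a" "a < b" "b < hi i" and t: "tiling K lo (hi(i := a)) F"
    "tiling K (lo(i := a)) (hi(i := b)) G" "tiling K (lo(i := b)) hi H"
    "tgt_face i F = src_face i G" "tgt_face i G = src_face i H"
    using assoc_tilings[OF T] by metis
  have "hom (inverse_arr M (\<alpha> i (ev F X) (ev G X) (ev H X))) (ev (Glue i F (Glue i G H)) X) (ev (Glue i (Glue i F G) H) X) \<and>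
      normalize X (Glue i (Glue i F G) H) \<cdot> inverse_arr M (\<alpha> i (ev F X) (ev G X) (ev H X)) = normalize X (Glue i F (Glue i G H))"
    if "X \<in> Obj (CT lo hi)" for X
  proof -
    note f = CT_fits[OF bd that]
    note n = normalize_assoc[OF t ab f]
    note h = hom_assoc[OF n(2,3)]
    show ?thesis
      using inverse(2)[OF h(2,1)] inverse_shift[OF h(2,1) _ n(1)] normalize_hom(1)[OF T(2) f] by simp
  qed
  then show ?case
    unfolding coherent_def using T assoc_inv.prems(2) by auto
next
  case (intch i j D F G F' G')
  note bd = intch.prems(1)
  have T: "tiling K lo hi (Glue j (Glue i F G) (Glue i F' G'))" "tiling K lo hi (Glue i (Glue j F F') (Glue j G G'))"
    using intch built_imp_tiling by blast+
  obtain a b where ab: "lo i < a" "a < hi i" "lo j < b" "b < hi j" and t: "tiling K lo (hi(j := b, i := a)) F"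
    "tiling K (lo(i := a)) (hi(j := b)) G" "tiling K (lo(j := b)) (hi(i := a)) F'" "tiling K (lo(j := b, i := a)) hi G'"
    "tgt_face i F = src_face i G" "tgt_face i F' = src_face i G'" "tgt_face j F = src_face j F'"
    "tgt_face j G = src_face j G'"
    using intch_tilings[OF intch.hyps(1) T] by metis
  note n = normalize_intch[OF intch.hyps(1) t ab CT_fits[OF bd]]
  show ?case
    unfolding coherent_def
    using T n(1) hom_intch(1)[OF intch.hyps(1) n(2-5)] intch.prems(2) by auto
next
  case (intch_inv i j D F G F' G')
  note bd = intch_inv.prems(1)
  have T: "tiling K lo hi (Glue j (Glue i F G) (Glue i F' G'))" "tiling K lo hi (Glue i (Glue j F F') (Glue j G G'))"
    using intch_inv built_imp_tiling by blast+
  obtain a b where ab: "lo i < a" "a < hi i" "lo j < b" "b < hi j" and t: "tiling K lo (hi(j := b, i := a)) F"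
    "tiling K (lo(i := a)) (hi(j := b)) G" "tiling K (lo(j := b)) (hi(i := a)) F'" "tiling K (lo(j := b, i := a)) hi G'"
    "tgt_face i F = src_face i G" "tgt_face i F' = src_face i G'" "tgt_face j F = src_face j F'"
    "tgt_face j G = src_face j G'"
    using intch_tilings[OF intch_inv.hyps(1) T] by metis
  have "hom (inverse_arr M (\<beta> i j (ev F X) (ev G X) (ev F' X) (ev G' X)))
        (ev (Glue i (Glue j F F') (Glue j G G')) X) (ev (Glue j (Glue i F G) (Glue i F' G')) X) \<and>
      normalize X (Glue j (Glue i F G) (Glue i F' G')) \<cdot> inverse_arr M (\<beta> i j (ev F X) (ev G X) (ev F' X) (ev G' X)) =
      normalize X (Glue i (Glue j F F') (Glue j G G'))"
    if "X \<in> Obj (CT lo hi)" for X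
  proof -
    note f = CT_fits[OF bd that]
    note n = normalize_intch[OF intch_inv.hyps(1) t ab f]
    note h = hom_intch[OF intch_inv.hyps(1) n(2-5)]
    show ?thesis
      using inverse(2)[OF h(2,1)] inverse_shift[OF h(2,1) _ n(1)] normalize_hom(1)[OF T(2) f] by simp
  qed
  then show ?case
    unfolding coherent_def using T intch_inv.prems(2) by auto
next
  case (ident D T)
  have T: "tiling K lo hi T"
    using ident built_imp_tiling by blast
  have "hom (\<iota> (ev T X)) (ev T X) (ev T X) \<and> normalize X T \<cdot> \<iota> (ev T X) = normalize X T" if "X \<in> Obj (CT lo hi)" for X
    using normalize_hom(1)[OF T CT_fits[OF ident.prems(1) that]] hom_id hom_obj cmp_id_right by blast
  then show ?case
    unfolding coherent_def using T ident.prems(2) by auto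
next
  case (comp D T T' \<eta> T'' \<theta>)
  note c = comp.IH(1)[OF comp.prems] comp.IH(2)[OF comp.prems]
  have T: "tiling K lo hi T" "tiling K lo hi T''" "tiling K lo hi T'"
    using c by (auto simp: coherent_def)
  have "hom (\<theta> X \<cdot> \<eta> X) (ev T X) (ev T'' X) \<and> normalize X T'' \<cdot> \<theta> X \<cdot> \<eta> X = normalize X T" if X: "X \<in> Obj (CT lo hi)" for X
  proof -
    have h: "hom (\<eta> X) (ev T X) (ev T' X)" "hom (\<theta> X) (ev T' X) (ev T'' X)"
      "normalize X T' \<cdot> \<eta> X = normalize X T" "normalize X T'' \<cdot> \<theta> X = normalize X T'"
      using c X by (auto simp: coherent_def)
    show ?thesis
      using hom_cmp[OF h(1,2)] assoc[OF h(1,2) normalize_hom(1)[OF T(2) CT_fits[OF comp.prems(1) X]]] h(3,4) by simp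
  qed
  then show ?case
    unfolding coherent_def using T comp.prems(2) by auto
next
  case (glue F F' \<eta> G G' \<theta> D i)
  have T: "tiling K lo hi (Glue i F G)" "tiling K lo hi (Glue i F' G')"
    using glue.hyps glue.prems built_imp_tiling by blast+
  obtain a where a: "lo i < a" "a < hi i" "i \<in> K" "tiling K lo (hi(i := a)) F" "tiling K (lo(i := a)) hi G"
    using glue_tilings[OF T(1)] by metis
  have bl: "blocks F = box K lo (hi(i := a))" "blocks G = box K (lo(i := a)) hi"
    using tiling_blocks a(4,5) by blast+
  have c: "coherent lo (hi(i := a)) F F' \<eta>" "coherent (lo(i := a)) hi G G' \<theta>"
    using glue.IH(1)[OF tiling_bounds[OF a(4)] bl(1)] glue.IH(2)[OF tiling_bounds[OF a(5)] bl(2)] by auto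
  note cg = coherent_glue[OF c T]
  show ?case
    unfolding coherent_def glue.prems(2) bl using T cg(2,3) by (auto simp del: eval.simps normalize.simps)
qed

section \<open>Existence: every tiling is connected to the normal form\<close>

text \<open>Only existence is recorded; the components are determined by
  \<open>coherent_value\<close> anyway.\<close>

definition connected :: "block \<Rightarrow> block \<Rightarrow> scheme \<Rightarrow> scheme \<Rightarrow> bool" where
  "connected lo hi T T' \<longleftrightarrow> (\<exists>\<eta>. built_iso P K (box K lo hi) T T' \<eta>)"

lemma connected_refl: "tiling K lo hi T \<Longrightarrow> connected lo hi T T"
  unfolding connected_def using built_iso.ident[OF tiling_imp_built] by blast

lemma connected_trans: "connected lo hi T T' \<Longrightarrow> connected lo hi T' T'' \<Longrightarrow> connected lo hi T T''"
  unfolding connected_def using built_iso.comp by blast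

lemma connected_glue:
  assumes "connected lo (hi(i := a)) F F'" "connected (lo(i := a)) hi G G'"
    and T: "tiling K lo hi (Glue i F G)" "tiling K lo hi (Glue i F' G')"
    and t: "tiling K lo (hi(i := a)) F" "tiling K (lo(i := a)) hi G"
  shows "connected lo hi (Glue i F G) (Glue i F' G')"
proof -
  obtain \<eta> \<theta> where b: "built_iso P K (box K lo (hi(i := a))) F F' \<eta>" "built_iso P K (box K (lo(i := a)) hi) G G' \<theta>"
    using assms by (auto simp: connected_def)
  note c = built_iso_coherent[OF b(1) tiling_bounds[OF t(1)] refl] built_iso_coherent[OF b(2) tiling_bounds[OF t(2)] refl]
  have bl: "blocks F = box K lo (hi(i := a))" "blocks G = box K (lo(i := a)) hi"
    using tiling_blocks t by blast+
  show ?thesis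
    unfolding connected_def
    using built_iso.glue[OF b[folded bl] tiling_imp_built[OF T(1)] tiling_imp_built[OF T(2)]]
      coherent_glue(1)[OF c T] unfolding bl adj_def by blast
qed

text \<open>There is no rule for inverses in \<open>built_iso\<close>, but its generators come in
  inverse pairs, so a derivation can be reversed rule by rule.\<close>

lemma connected_sym: "connected lo hi T T' \<Longrightarrow> bounds K lo hi \<Longrightarrow> connected lo hi T' T"
proof -
  have "built_iso P K D T T' \<eta> \<Longrightarrow> bounds K lo hi \<Longrightarrow> D = box K lo hi \<Longrightarrow> connected lo hi T' T" for D \<eta>
  proof (induction arbitrary: lo hi rule: built_iso.induct)
    case (glue F F' \<eta> G G' \<theta> D i)
    have T: "tiling K lo hi (Glue i F G)" "tiling K lo hi (Glue i F' G')"
      using glue.hyps glue.prems built_imp_tiling by blast+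
    obtain a where a: "tiling K lo (hi(i := a)) F" "tiling K (lo(i := a)) hi G"
      using glue_tilings[OF T(1)] by metis
    note bl = tiling_blocks[OF a(1)] tiling_blocks[OF a(2)]
    note bd = tiling_bounds[OF a(1)] tiling_bounds[OF a(2)]
    have "tiling K lo (hi(i := a)) F'" "tiling K (lo(i := a)) hi G'"
      using built_iso_coherent[OF glue.hyps(1) bd(1) bl(1)] built_iso_coherent[OF glue.hyps(2) bd(2) bl(2)]
      by (auto simp: coherent_def)
    then show ?case
      using connected_glue[OF glue.IH(1)[OF bd(1) bl(1)] glue.IH(2)[OF bd(2) bl(2)] T(2,1)] by blast
  next
    case (comp D T T' \<eta> T'' \<theta>)
    then show ?case
      using connected_trans by blast
  qed (auto simp: connected_def intro: built_iso.intros)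
  then show "connected lo hi T T' \<Longrightarrow> bounds K lo hi \<Longrightarrow> connected lo hi T' T"
    unfolding connected_def by blast
qed

lemma normal_tile: "bounds K lo hi \<Longrightarrow> tiling K lo hi (normal lo hi)"
  using normal_tiling[OF finite_K[OF K]] .

lemma bounds_split:
  assumes "bounds K lo hi" "lo i < a" "a < hi i"
  shows "i \<in> K" "bounds K lo (hi(i := a))" "bounds K (lo(i := a)) hi"
proof -
  have "Suc (lo i) < hi i"
    using assms by linarith
  then show "i \<in> K"
    using bounds_thick[OF assms(1)] by blast
  then show "bounds K lo (hi(i := a))" "bounds K (lo(i := a)) hi"
    using assms bounds_hi bounds_lo by blast+
qed

lemma split_tiling:
  assumes "bounds K lo hi" "lo i < a" "a < hi i"
  shows "tiling K lo hi (Glue i (normal lo (hi(i := a))) (normal (lo(i := a)) hi))"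
  using tiling.glue[OF assms(1) bounds_split(1)[OF assms] assms(2,3) normal_tile normal_tile normal_face_eq]
    bounds_split(2,3)[OF assms] by blast

text \<open>Realizes the recursion of \<open>split_iso\<close> by the rules of
  \<open>built_iso\<close>: an associator if \<open>i = m\<close> and an interchanger otherwise,
  followed by a gluing of smaller cases.\<close>

lemma connected_split:
  "bounds K lo hi \<Longrightarrow> lo i < a \<Longrightarrow> a < hi i \<Longrightarrow>
    connected lo hi (Glue i (normal lo (hi(i := a))) (normal (lo(i := a)) hi)) (normal lo hi)"
proof (induction "bulk lo hi" arbitrary: lo hi rule: less_induct)
  case less
  note bd = less.prems(1) and a = less.prems(2,3)
  have fin: "finite (thick lo' hi')" if "bounds K lo' hi'" for lo' hi'
    using finite_thick[OF finite_K[OF K] that] .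
  have "i \<in> thick lo hi"
    using a by (auto simp: thick_def)
  then obtain m where m: "lead lo hi m"
    using lead_exists by blast
  let ?s = "Suc (lo m)"
  note s = leadD[OF m]
  let ?U = "hi(m := ?s)" and ?V = "lo(m := ?s)"
  note N = normal_lead[OF fin[OF bd] m]
  note bs = bounds_split[OF bd s] and ba = bounds_split[OF bd a]
  note tN = split_tiling[OF bd s]
  note tS = split_tiling[OF bd a]
  have small: "bulk lo ?U < bulk lo hi" "bulk ?V hi < bulk lo hi"
    using bulk_hi[OF fin[OF bd] s] bulk_lo[OF fin[OF bd] s] .
  show ?case
  proof (cases "i = m")
    case im: True
    show ?thesis
    proof (cases "a = ?s")
      case True
      then show ?thesis
        using connected_refl[OF tS] N im by simp
    next
      case False
      then have sa: "?s < a" "a < hi m" "?V m < a"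
        using a im by auto
      have lm: "lead lo (hi(m := a)) m"
        using m sa by (auto simp: lead_def)
      have N': "normal lo (hi(m := a)) = Glue m (normal lo ?U) (normal ?V (hi(m := a)))"
        using normal_lead[OF fin[OF ba(2)]] lm im by simp
      have tV: "tiling K ?V hi (Glue m (normal ?V (hi(m := a))) (normal (lo(m := a)) hi))"
        using split_tiling[OF bs(3) sa(3,2)] by simp
      have t: "tiling K lo hi (Glue m (normal lo ?U) (Glue m (normal ?V (hi(m := a))) (normal (lo(m := a)) hi)))"
        by (rule tiling.glue[OF bd bs(1) s normal_tile[OF bs(2)] tV]) (simp add: normal_face)
      have tL: "tiling K lo hi (Glue m (Glue m (normal lo ?U) (normal ?V (hi(m := a)))) (normal (lo(m := a)) hi))"
        using tS unfolding im N' .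
      have "connected lo hi (Glue m (Glue m (normal lo ?U) (normal ?V (hi(m := a)))) (normal (lo(m := a)) hi))
          (Glue m (normal lo ?U) (Glue m (normal ?V (hi(m := a))) (normal (lo(m := a)) hi)))"
        unfolding connected_def using built_iso.assoc[OF tiling_imp_built[OF tL] tiling_imp_built[OF t]] by blast
      moreover have "connected ?V hi (Glue m (normal ?V (hi(m := a))) (normal (lo(m := a)) hi)) (normal ?V hi)"
        using less.hyps[OF small(2) bs(3)] sa im by simp
      then have "connected lo hi (Glue m (normal lo ?U) (Glue m (normal ?V (hi(m := a))) (normal (lo(m := a)) hi)))
          (Glue m (normal lo ?U) (normal ?V hi))"
        using connected_glue[OF connected_refl[OF normal_tile[OF bs(2)]] _ t tN normal_tile[OF bs(2)] tV] by blast
      ultimately show ?thesis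
        unfolding N im N' by (rule connected_trans)
    qed
  next
    case im: False
    have tw: "g(i := c, m := d) = g(m := d, i := c)" for g :: block and c d
      using im by (simp add: fun_upd_twist)
    have ml: "lead lo (hi(i := a)) m" "lead (lo(i := a)) hi m"
      using m lead_less[OF m _ im] a by (auto simp: lead_def)
    have N1: "normal lo (hi(i := a)) = Glue m (normal lo (?U(i := a))) (normal ?V (hi(i := a)))"
      using normal_lead[OF fin[OF ba(2)] ml(1)] im by (simp add: tw)
    have N2: "normal (lo(i := a)) hi = Glue m (normal (lo(i := a)) ?U) (normal (?V(i := a)) hi)"
      using normal_lead[OF fin[OF ba(3)] ml(2)] im by (simp add: tw)
    have aU: "lo i < a" "a < ?U i" and aV: "?V i < a" "a < hi i"
      using a im by auto
    note tU = split_tiling[OF bs(2) aU] and tV = split_tiling[OF bs(3) aV]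
    \<comment> \<open>The interchanged scheme is again a tiling, since faces of normal forms are
      normal forms.\<close>
    have t: "tiling K lo hi (Glue m (Glue i (normal lo (?U(i := a))) (normal (lo(i := a)) ?U))
        (Glue i (normal ?V (hi(i := a))) (normal (?V(i := a)) hi)))"
      by (rule tiling.glue[OF bd bs(1) s tU tV]) (use im in \<open>simp add: normal_face tw\<close>)
    have "connected lo hi (Glue i (normal lo (hi(i := a))) (normal (lo(i := a)) hi))
        (Glue m (Glue i (normal lo (?U(i := a))) (normal (lo(i := a)) ?U)) (Glue i (normal ?V (hi(i := a))) (normal (?V(i := a)) hi)))"
      unfolding connected_def N1 N2
      using built_iso.intch[OF im[symmetric] tiling_imp_built[OF tS[unfolded N1 N2]] tiling_imp_built[OF t]] by blast
    moreover have "connected lo hi (Glue m (Glue i (normal lo (?U(i := a))) (normal (lo(i := a)) ?U)) (Glue i (normal ?V (hi(i := a))) (normal (?V(i := a)) hi)))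
        (Glue m (normal lo ?U) (normal ?V hi))"
      using connected_glue[OF less.hyps[OF small(1) bs(2) aU] less.hyps[OF small(2) bs(3) aV] t tN tU tV] .
    ultimately show ?thesis
      unfolding N using connected_trans by blast
  qed
qed

lemma connected_normal: "tiling K lo hi T \<Longrightarrow> connected lo hi T (normal lo hi)"
proof (induction rule: tiling.induct)
  case (block lo hi)
  then have "thick lo hi = {}"
    using bounds_thick[OF block(1)] by (fastforce simp: thick_def)
  then show ?case
    using connected_refl[OF tiling.block[OF block]] by (simp add: normal_thin)
next
  case (glue lo hi i a F G)
  note t = tiling.glue[OF glue.hyps]
  show ?case
    using connected_trans[OF connected_glue[OF glue.IH t split_tiling[OF glue.hyps(1,3,4)] glue.hyps(5,6)]
      connected_split[OF glue.hyps(1,3,4)]] .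
qed

lemma connected_tilings:
  assumes "tiling K lo hi T" "tiling K lo hi T'"
  shows "connected lo hi T T'"
  using connected_trans[OF connected_normal[OF assms(1)] connected_sym[OF connected_normal[OF assms(2)] tiling_bounds[OF assms(1)]]] .

section \<open>Naturality in the tuple\<close>

text \<open>Transfers the naturality of \<open>\<alpha>\<close> and \<open>\<beta>\<close> to their
  inverses: a commuting square with two opposite invertible sides still commutes when these are
  reversed.\<close>

lemma inverse_natural:
  assumes "iso p" "iso q" "hom p a b" "hom q c d" "hom u a c" "hom v b d" "q \<cdot> u = v \<cdot> p"
  shows "inverse_arr M q \<cdot> v = u \<cdot> inverse_arr M p"
proof -
  note p = inverse[OF assms(1,3)] and q = inverse[OF assms(2,4)]
  have "inverse_arr M q \<cdot> v = inverse_arr M q \<cdot> (v \<cdot> p) \<cdot> inverse_arr M p"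
    using assoc[OF p(2) assms(3,6)] p(4) cmp_id_right[OF assms(6)] by simp
  also have "\<dots> = inverse_arr M q \<cdot> (q \<cdot> u) \<cdot> inverse_arr M p"
    using assms(7) by simp
  also have "\<dots> = u \<cdot> inverse_arr M p"
    using assoc[OF p(2) assms(5,4)] assoc[OF hom_cmp[OF p(2) assms(5)] assms(4) q(2)] q(3)
      cmp_id_left[OF hom_cmp[OF p(2) assms(5)]] by simp
  finally show ?thesis .
qed

lemma eval_hom_sub:
  assumes "tiling K lo' hi' T" "box K lo' hi' \<subseteq> box K lo hi" "f \<in> Arr (CT lo hi)"
  shows "hom (eva T f) (ev T (Dom (CT lo hi) f)) (ev T (Cod (CT lo hi) f))"
proof -
  have "ev T (Dom (CT lo' hi') (restrict f (box K lo' hi'))) = ev T (Dom (CT lo hi) f)"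
    "ev T (Cod (CT lo' hi') (restrict f (box K lo' hi'))) = ev T (Cod (CT lo hi) f)"
    using assms(2) tiling_blocks[OF assms(1)] by (auto simp: ct_sel intro!: eval_cong)
  moreover have "eva T (restrict f (box K lo' hi')) = eva T f"
    using tiling_blocks[OF assms(1)] by (auto intro!: eval_cong)
  ultimately show ?thesis
    using eval_hom[OF assms(1) ct_restrict_Arr[OF assms(3,2)]] by simp
qed

text \<open>The axiom speaks of matching triples of arrows; here these are the values of the three
  factors at an arrow of tuples, which match by \<open>arr.eval_tiling\<close>. The typing facts are
  in the form that \<open>inverse_natural\<close> expects.\<close>

lemma assoc_natural_eval:
  assumes T: "tiling K lo hi (Glue i (Glue i F G) H)" "tiling K lo hi (Glue i F (Glue i G H))" and f: "f \<in> Arr (CT lo hi)"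
  defines "A \<equiv> \<lambda>X. \<alpha> i (ev F X) (ev G X) (ev H X)" and "X \<equiv> Dom (CT lo hi) f" and "Y \<equiv> Cod (CT lo hi) f"
  shows "A Y \<cdot> eva (Glue i (Glue i F G) H) f = eva (Glue i F (Glue i G H)) f \<cdot> A X"
    and "iso (A X)" and "iso (A Y)"
    and "hom (A X) (ev (Glue i (Glue i F G) H) X) (ev (Glue i F (Glue i G H)) X)"
    and "hom (A Y) (ev (Glue i (Glue i F G) H) Y) (ev (Glue i F (Glue i G H)) Y)"
proof -
  note bd = tiling_bounds[OF T(1)]
  obtain a b where ab: "lo i < a" "a < b" "b < hi i" and t: "tiling K lo (hi(i := a)) F"
    "tiling K (lo(i := a)) (hi(i := b)) G" "tiling K (lo(i := b)) hi H"
    "tgt_face i F = src_face i G" "tgt_face i G = src_face i H" and i: "i \<in> K"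
    using assoc_tilings[OF T] .
  have sub: "box K lo (hi(i := b)) \<subseteq> box K lo hi" "box K (lo(i := a)) hi \<subseteq> box K lo hi" "box K (lo(i := b)) hi \<subseteq> box K lo hi"
    using box_split[of i K lo b hi] box_split[of i K lo a hi] i ab by auto
  have sub': "box K lo (hi(i := a)) \<subseteq> box K lo hi" "box K (lo(i := a)) (hi(i := b)) \<subseteq> box K lo hi"
    using box_split[of i K lo a "hi(i := b)"] i ab sub(1) by auto
  note h = eval_hom_sub[OF t(1) sub'(1) f] eval_hom_sub[OF t(2) sub'(2) f] eval_hom_sub[OF t(3) sub(3) f]
  have bds: "bounds K lo (hi(i := b))" "bounds K (lo(i := a)) hi"
    using bounds_hi[OF bd i, of b] bounds_lo[OF bd i, of a] ab by auto
  have g: "grid K (Arr M) (sa P K) (ta P K) lo hi f"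
    using f bd by (simp add: grid_def ct_Arr)
  have FG: "adj i (eva F f) (eva G f)"
    using arr.eval_tiling(2)[OF K, of lo "hi(i := b)" i a F G f] t bds ab i h grid_hi[OF g i, of b]
    by (simp add: adj_def hom_def)
  have GH: "adj i (eva G f) (eva H f)"
    using arr.eval_tiling(2)[OF K, of "lo(i := a)" hi i b G H f] t bds ab i h grid_lo[OF g i, of a]
    by (simp add: adj_def hom_def)
  show "A Y \<cdot> eva (Glue i (Glue i F G) H) f = eva (Glue i F (Glue i G H)) f \<cdot> A X"
    unfolding A_def X_def Y_def using assoc_nat[OF h FG GH] by simp
  have "oadj i (ev F Z) (ev G Z)" "oadj i (ev G Z) (ev H Z)" if "Z = X \<or> Z = Y" for Z
    using that adj_dom[OF FG h(1,2)] adj_dom[OF GH h(2,3)] adj_cod[OF FG h(1,2)] adj_cod[OF GH h(2,3)]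
    by (auto simp: X_def Y_def)
  then show "iso (A X)" "iso (A Y)"
    "hom (A X) (ev (Glue i (Glue i F G) H) X) (ev (Glue i F (Glue i G H)) X)"
    "hom (A Y) (ev (Glue i (Glue i F G) H) Y) (ev (Glue i F (Glue i G H)) Y)"
    using hom_assoc by (auto simp: A_def)
qed

lemma intch_natural_eval:
  assumes ij: "i \<noteq> j" and T: "tiling K lo hi (Glue j (Glue i F G) (Glue i F' G'))" "tiling K lo hi (Glue i (Glue j F F') (Glue j G G'))"
    and f: "f \<in> Arr (CT lo hi)"
  defines "B \<equiv> \<lambda>X. \<beta> i j (ev F X) (ev G X) (ev F' X) (ev G' X)" and "X \<equiv> Dom (CT lo hi) f" and "Y \<equiv> Cod (CT lo hi) f"
  shows "B Y \<cdot> eva (Glue j (Glue i F G) (Glue i F' G')) f = eva (Glue i (Glue j F F') (Glue j G G')) f \<cdot> B X"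
    and "iso (B X)" and "iso (B Y)"
    and "hom (B X) (ev (Glue j (Glue i F G) (Glue i F' G')) X) (ev (Glue i (Glue j F F') (Glue j G G')) X)"
    and "hom (B Y) (ev (Glue j (Glue i F G) (Glue i F' G')) Y) (ev (Glue i (Glue j F F') (Glue j G G')) Y)"
proof -
  note bd = tiling_bounds[OF T(1)]
  obtain a b where ab: "lo i < a" "a < hi i" "lo j < b" "b < hi j" and t: "tiling K lo (hi(j := b, i := a)) F"
    "tiling K (lo(i := a)) (hi(j := b)) G" "tiling K (lo(j := b)) (hi(i := a)) F'" "tiling K (lo(j := b, i := a)) hi G'"
    and faces: "tgt_face i F = src_face i G" "tgt_face i F' = src_face i G'" "tgt_face j F = src_face j F'"
    "tgt_face j G = src_face j G'" and K': "i \<in> K" "j \<in> K"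
    using intch_tilings[OF ij T] .
  have tw: "g(i := c, j := d) = g(j := d, i := c)" for g :: block and c d
    using ij by (simp add: fun_upd_twist)
  have sub: "box K lo (hi(j := b)) \<subseteq> box K lo hi" "box K (lo(j := b)) hi \<subseteq> box K lo hi"
    using box_split[of j K lo b hi] K' ab by auto
  have sub': "box K lo (hi(j := b, i := a)) \<subseteq> box K lo hi" "box K (lo(i := a)) (hi(j := b)) \<subseteq> box K lo hi"
    "box K (lo(j := b)) (hi(i := a)) \<subseteq> box K lo hi" "box K (lo(j := b, i := a)) hi \<subseteq> box K lo hi"
    using box_split[of i K lo a "hi(j := b)"] box_split[of i K "lo(j := b)" a hi] K' ab ij sub by auto
  note h = eval_hom_sub[OF t(1) sub'(1) f] eval_hom_sub[OF t(2) sub'(2) f] eval_hom_sub[OF t(3) sub'(3) f] eval_hom_sub[OF t(4) sub'(4) f]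
  have bds: "bounds K lo (hi(j := b))" "bounds K (lo(j := b)) hi" "bounds K lo (hi(i := a))" "bounds K (lo(i := a)) hi"
    using bounds_hi[OF bd] bounds_lo[OF bd] ab K' by auto
  have g: "grid K (Arr M) (sa P K) (ta P K) lo hi f"
    using f bd by (simp add: grid_def ct_Arr)
  note gs = grid_hi[OF g K'(2) ab(3,4)] grid_lo[OF g K'(2) ab(3,4)] grid_hi[OF g K'(1) ab(1,2)] grid_lo[OF g K'(1) ab(1,2)]
  have adj: "adj i (eva F f) (eva G f)" "adj i (eva F' f) (eva G' f)"
    using arr.eval_tiling(2)[OF K t(1,2) bds(1) K'(1) _ _ faces(1) gs(1)]
      arr.eval_tiling(2)[OF K t(3,4) bds(2) K'(1) _ _ faces(2) gs(2)] ab ij K' h by (simp_all add: adj_def hom_def)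
  have adj': "adj j (eva F f) (eva F' f)" "adj j (eva G f) (eva G' f)"
    using arr.eval_tiling(2)[OF K _ _ bds(3) K'(2) _ _ faces(3) gs(3), of b]
      arr.eval_tiling(2)[OF K _ _ bds(4) K'(2) _ _ faces(4) gs(4), of b] t ab ij K' h by (simp_all add: adj_def hom_def tw)
  show "B Y \<cdot> eva (Glue j (Glue i F G) (Glue i F' G')) f = eva (Glue i (Glue j F F') (Glue j G G')) f \<cdot> B X"
    unfolding B_def X_def Y_def using intch_nat[OF ij h adj adj'] by simp
  have "oadj i (ev F Z) (ev G Z)" "oadj i (ev F' Z) (ev G' Z)" "oadj j (ev F Z) (ev F' Z)" "oadj j (ev G Z) (ev G' Z)"
    if "Z = X \<or> Z = Y" for Z
    using that adj_dom[OF adj(1) h(1,2)] adj_dom[OF adj(2) h(3,4)] adj_dom[OF adj'(1) h(1,3)] adj_dom[OF adj'(2) h(2,4)]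
      adj_cod[OF adj(1) h(1,2)] adj_cod[OF adj(2) h(3,4)] adj_cod[OF adj'(1) h(1,3)] adj_cod[OF adj'(2) h(2,4)]
    by (auto simp: X_def Y_def)
  then show "iso (B X)" "iso (B Y)"
    "hom (B X) (ev (Glue j (Glue i F G) (Glue i F' G')) X) (ev (Glue i (Glue j F F') (Glue j G G')) X)"
    "hom (B Y) (ev (Glue j (Glue i F G) (Glue i F' G')) Y) (ev (Glue i (Glue j F F') (Glue j G G')) Y)"
    using hom_intch[OF ij] by (auto simp: B_def)
qed

lemma built_iso_natural:
  "built_iso P K D T T' \<eta> \<Longrightarrow> bounds K lo hi \<Longrightarrow> D = box K lo hi \<Longrightarrow> f \<in> Arr (CT lo hi) \<Longrightarrow>
    \<eta> (Cod (CT lo hi) f) \<cdot> eva T f = eva T' f \<cdot> \<eta> (Dom (CT lo hi) f)"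
proof (induction arbitrary: lo hi f rule: built_iso.induct)
  case (assoc D i F G H)
  note f = assoc.prems(3)
  have T: "tiling K lo hi (Glue i (Glue i F G) H)" "tiling K lo hi (Glue i F (Glue i G H))"
    using assoc built_imp_tiling by blast+
  have c: "Dom (CT lo hi) f \<in> Obj (CT lo hi)" "Cod (CT lo hi) f \<in> Obj (CT lo hi)"
    using category.dom_obj[OF ct_category f] category.cod_obj[OF ct_category f] .
  have "\<alpha> i (ev F (Cod (CT lo hi) f)) (ev G (Cod (CT lo hi) f)) (ev H (Cod (CT lo hi) f)) \<cdot> eva (Glue i (Glue i F G) H) f =
      eva (Glue i F (Glue i G H)) f \<cdot> \<alpha> i (ev F (Dom (CT lo hi) f)) (ev G (Dom (CT lo hi) f)) (ev H (Dom (CT lo hi) f))"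
    using assoc_natural_eval[OF T f] by blast
  then show ?case
    using c assoc.prems(2) by (simp del: eval.simps)
next
  case (assoc_inv D i F G H)
  note f = assoc_inv.prems(3)
  have T: "tiling K lo hi (Glue i (Glue i F G) H)" "tiling K lo hi (Glue i F (Glue i G H))"
    using assoc_inv built_imp_tiling by blast+
  have c: "Dom (CT lo hi) f \<in> Obj (CT lo hi)" "Cod (CT lo hi) f \<in> Obj (CT lo hi)"
    using category.dom_obj[OF ct_category f] category.cod_obj[OF ct_category f] .
  show ?case
    using inverse_natural[OF assoc_natural_eval(2-5)[OF T f] eval_hom[OF T(1) f] eval_hom[OF T(2) f] assoc_natural_eval(1)[OF T f]]
      c assoc_inv.prems(2) by (simp del: eval.simps)
next
  case (intch i j D F G F' G')
  note f = intch.prems(3)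
  have T: "tiling K lo hi (Glue j (Glue i F G) (Glue i F' G'))" "tiling K lo hi (Glue i (Glue j F F') (Glue j G G'))"
    using intch built_imp_tiling by blast+
  have c: "Dom (CT lo hi) f \<in> Obj (CT lo hi)" "Cod (CT lo hi) f \<in> Obj (CT lo hi)"
    using category.dom_obj[OF ct_category f] category.cod_obj[OF ct_category f] .
  show ?case
    using intch_natural_eval(1)[OF intch.hyps(1) T f] c intch.prems(2) by (simp del: eval.simps)
next
  case (intch_inv i j D F G F' G')
  note f = intch_inv.prems(3)
  have T: "tiling K lo hi (Glue j (Glue i F G) (Glue i F' G'))" "tiling K lo hi (Glue i (Glue j F F') (Glue j G G'))"
    using intch_inv built_imp_tiling by blast+
  have c: "Dom (CT lo hi) f \<in> Obj (CT lo hi)" "Cod (CT lo hi) f \<in> Obj (CT lo hi)"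
    using category.dom_obj[OF ct_category f] category.cod_obj[OF ct_category f] .
  show ?case
    using inverse_natural[OF intch_natural_eval(2-5)[OF intch_inv.hyps(1) T f] eval_hom[OF T(1) f] eval_hom[OF T(2) f]
        intch_natural_eval(1)[OF intch_inv.hyps(1) T f]]
      c intch_inv.prems(2) by (simp del: eval.simps)
next
  case (ident D T)
  note f = ident.prems(3)
  have T: "tiling K lo hi T"
    using ident built_imp_tiling by blast
  have c: "Dom (CT lo hi) f \<in> Obj (CT lo hi)" "Cod (CT lo hi) f \<in> Obj (CT lo hi)"
    using category.dom_obj[OF ct_category f] category.cod_obj[OF ct_category f] .
  show ?case
    using c ident.prems(2) cmp_id_left[OF eval_hom[OF T f]] cmp_id_right[OF eval_hom[OF T f]] by simp
next
  case (comp D T T' \<eta> T'' \<theta>)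
  note f = comp.prems(3)
  note c1 = built_iso_coherent[OF comp.hyps(1) comp.prems(1,2)] and c2 = built_iso_coherent[OF comp.hyps(2) comp.prems(1,2)]
  have T: "tiling K lo hi T" "tiling K lo hi T'" "tiling K lo hi T''"
    using c1 c2 by (auto simp: coherent_def)
  have c: "Dom (CT lo hi) f \<in> Obj (CT lo hi)" "Cod (CT lo hi) f \<in> Obj (CT lo hi)"
    using category.dom_obj[OF ct_category f] category.cod_obj[OF ct_category f] .
  have h: "hom (\<eta> X) (ev T X) (ev T' X)" "hom (\<theta> X) (ev T' X) (ev T'' X)" if "X \<in> Obj (CT lo hi)" for X
    using c1 c2 that by (auto simp: coherent_def)
  note e = eval_hom[OF T(1) f] eval_hom[OF T(2) f] eval_hom[OF T(3) f]
  note IH = comp.IH[OF comp.prems]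
  let ?X = "Dom (CT lo hi) f" and ?Y = "Cod (CT lo hi) f"
  have "(\<theta> ?Y \<cdot> \<eta> ?Y) \<cdot> eva T f = (\<theta> ?Y \<cdot> eva T' f) \<cdot> \<eta> ?X"
    using assoc[OF e(1) h[OF c(2)]] assoc[OF h(1)[OF c(1)] e(2) h(2)[OF c(2)]] IH(1) by simp
  also have "\<dots> = eva T'' f \<cdot> \<theta> ?X \<cdot> \<eta> ?X"
    using assoc[OF h[OF c(1)] e(3)] IH(2) by simp
  finally show ?case
    using c comp.prems(2) by simp
next
  case (glue F F' \<eta> G G' \<theta> D i)
  note f = glue.prems(3)
  have T: "tiling K lo hi (Glue i F G)" "tiling K lo hi (Glue i F' G')"
    using glue.hyps glue.prems built_imp_tiling by blast+
  obtain a where a: "lo i < a" "a < hi i" "i \<in> K" "tiling K lo (hi(i := a)) F" "tiling K (lo(i := a)) hi G"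
    "tgt_face i F = src_face i G" "box K lo (hi(i := a)) \<subseteq> box K lo hi" "box K (lo(i := a)) hi \<subseteq> box K lo hi"
    using glue_tilings[OF T(1)] .
  note bd = tiling_bounds[OF a(4)] tiling_bounds[OF a(5)]
  note bl = tiling_blocks[OF a(4)] tiling_blocks[OF a(5)]
  note c1 = built_iso_coherent[OF glue.hyps(1) bd(1) bl(1)] and c2 = built_iso_coherent[OF glue.hyps(2) bd(2) bl(2)]
  have t: "tiling K lo (hi(i := a)) F'" "tiling K (lo(i := a)) hi G'"
    using c1 c2 by (auto simp: coherent_def)
  note bl' = tiling_blocks[OF t(1)] tiling_blocks[OF t(2)]
  have c: "Dom (CT lo hi) f \<in> Obj (CT lo hi)" "Cod (CT lo hi) f \<in> Obj (CT lo hi)"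
    using category.dom_obj[OF ct_category f] category.cod_obj[OF ct_category f] .
  have r: "Dom (CT lo (hi(i := a))) (restrict f (blocks F)) = restrict (Dom (CT lo hi) f) (blocks F)"
    "Cod (CT lo (hi(i := a))) (restrict f (blocks F)) = restrict (Cod (CT lo hi) f) (blocks F)"
    "Dom (CT (lo(i := a)) hi) (restrict f (blocks G)) = restrict (Dom (CT lo hi) f) (blocks G)"
    "Cod (CT (lo(i := a)) hi) (restrict f (blocks G)) = restrict (Cod (CT lo hi) f) (blocks G)"
    unfolding bl using a(7,8) by (auto simp: ct_sel restrict_def fun_eq_iff)
  have e: "eva F (restrict f (blocks F)) = eva F f" "eva F' (restrict f (blocks F)) = eva F' f"
    "eva G (restrict f (blocks G)) = eva G f" "eva G' (restrict f (blocks G)) = eva G' f"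
    using bl bl' by (auto intro!: eval_cong)
  have rf: "restrict f (blocks F) \<in> Arr (CT lo (hi(i := a)))" "restrict f (blocks G) \<in> Arr (CT (lo(i := a)) hi)"
    unfolding bl using ct_restrict_Arr[OF f a(7)] ct_restrict_Arr[OF f a(8)] .
  have nF: "\<eta> (restrict (Cod (CT lo hi) f) (blocks F)) \<cdot> eva F f = eva F' f \<cdot> \<eta> (restrict (Dom (CT lo hi) f) (blocks F))"
    using glue.IH(1)[OF bd(1) bl(1) rf(1)] unfolding r e .
  have nG: "\<theta> (restrict (Cod (CT lo hi) f) (blocks G)) \<cdot> eva G f = eva G' f \<cdot> \<theta> (restrict (Dom (CT lo hi) f) (blocks G))"
    using glue.IH(2)[OF bd(2) bl(2) rf(2)] unfolding r e .
  note hF = eval_hom_sub[OF a(4,7) f] eval_hom_sub[OF t(1) a(7) f]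
  note hG = eval_hom_sub[OF a(5,8) f] eval_hom_sub[OF t(2) a(8) f]
  note cF = coherent_restrict(1)[OF c1 c(1) a(7), folded bl(1)] coherent_restrict(1)[OF c1 c(2) a(7), folded bl(1)]
  note cG = coherent_restrict(1)[OF c2 c(1) a(8), folded bl(2)] coherent_restrict(1)[OF c2 c(2) a(8), folded bl(2)]
  note cadj = coherent_glue(1)[OF c1 c2 T c(1), folded bl] coherent_glue(1)[OF c1 c2 T c(2), folded bl]
  have faces': "tgt_face i F' = src_face i G'"
    using T(2) by (auto elim: tiling_GlueE)
  note ea = eval_adj[OF a(4,5) glue.prems(1) a(3,1,2,6) f] eval_adj[OF t glue.prems(1) a(3,1,2) faces' f]
  \<comment> \<open>The interchange law reduces the naturality square of the gluing to those of its
    two factors.\<close>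
  have "(\<eta> (restrict (Cod (CT lo hi) f) (blocks F)) \<odot>\<^sub>i \<theta> (restrict (Cod (CT lo hi) f) (blocks G))) \<cdot> (eva F f \<odot>\<^sub>i eva G f) =
      (eva F' f \<odot>\<^sub>i eva G' f) \<cdot> (\<eta> (restrict (Dom (CT lo hi) f) (blocks F)) \<odot>\<^sub>i \<theta> (restrict (Dom (CT lo hi) f) (blocks G)))"
    unfolding interchange[OF hF(1) cF(2) hG(1) cG(2) ea(1) cadj(2), symmetric]
      interchange[OF cF(1) hF(2) cG(1) hG(2) cadj(1) ea(2), symmetric] nF nG ..
  then show ?case
    unfolding glue.prems(2) using c by (simp del: restrict_apply add: restrict_apply[of _ "Obj (CT lo hi)"])
qed

end

lemma regular_diagram_box: "regular_diagram K p = box K (\<lambda>i\<in>K. 0) (restrict p K)"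
  by (auto simp: regular_diagram_def box_def PiE_iff)

theorem theorem10p1:
  fixes n k :: nat and P :: "('o, 'a) nfold" and K :: "nat set" and p :: "nat \<Rightarrow> nat"
    and T T' :: scheme
  assumes "pseudo_nfold_category n P"
    and "k \<le> n"
    and "K \<subseteq> {1..n}" and "card K = k"
    and "\<forall>i\<in>K. p i \<ge> 1"
    and "built_from_composition K (regular_diagram K p) T"
    and "built_from_composition K (regular_diagram K p) T'"
  shows "\<exists>!\<eta>. natural_iso (composable_tuples P K (regular_diagram K p)) (Mor P K)
                (composition_functor P K T) (composition_functor P K T') \<eta>
            \<and> built_iso P K (regular_diagram K p) T T' \<eta>"
proof -
  interpret cube_category n P K
    using assms(1,3) by (simp add: cube_category_def cube_category_axioms_def)
  \<comment> \<open>The regular diagram is the box from \<open>0\<close> to \<open>p\<close>; both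
    corners are restricted to \<open>K\<close> because \<open>bounds\<close> demands
    extensionality.\<close>
  define lo hi where "lo = (\<lambda>i\<in>K. 0::nat)" and "hi = restrict p K"
  have bd: "bounds K lo hi"
    using assms(5) by (auto simp: bounds_def lo_def hi_def)
  have D: "regular_diagram K p = box K lo hi"
    using regular_diagram_box by (simp add: lo_def hi_def)
  have T: "tiling K lo hi T" "tiling K lo hi T'"
    using assms(6,7) built_imp_tiling[OF _ bd D] by blast+
  obtain \<eta> where b: "built_iso P K (box K lo hi) T T' \<eta>"
    using connected_tilings[OF T] by (auto simp: connected_def)
  note c = built_iso_coherent[OF b bd refl]
  have nat: "natural_iso (CT lo hi) M (composition_functor P K T) (composition_functor P K T') \<eta>"
  proof (rule natural_iso.intro)
    fix X assume X: "X \<in> Obj (CT lo hi)"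
    then have "hom (\<eta> X) (ev T X) (ev T' X)"
      using c by (simp add: coherent_def)
    then show "\<eta> X \<in> Arr M" "Dom M (\<eta> X) = on_obj (composition_functor P K T) X"
      "Cod M (\<eta> X) = on_obj (composition_functor P K T') X"
      by (simp_all add: hom_def composition_functor_def)
    show "\<exists>g. inverse_arrows M (\<eta> X) g"
      using coherent_value(2)[OF c X] by (simp add: iso_def)
  next
    fix f assume f: "f \<in> Arr (CT lo hi)"
    then show "\<eta> (Cod (CT lo hi) f) \<cdot> on_arr (composition_functor P K T) f =
        on_arr (composition_functor P K T') f \<cdot> \<eta> (Dom (CT lo hi) f)"
      using built_iso_natural[OF b bd refl f] by (simp add: composition_functor_def)
  qed (use composition_is_functor T in auto)
  \<comment> \<open>Both components are the one given by \<open>coherent_value\<close>, and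
    extensionality turns agreement on composable tuples into equality of functions.\<close>
  have "\<theta> = \<eta>" if "built_iso P K (box K lo hi) T T' \<theta>" for \<theta>
  proof (rule extensionalityI[of _ "Obj (CT lo hi)"])
    note c' = built_iso_coherent[OF that bd refl]
    show "\<theta> \<in> extensional (Obj (CT lo hi))" "\<eta> \<in> extensional (Obj (CT lo hi))"
      using c c' by (simp_all add: coherent_def)
    show "\<theta> X = \<eta> X" if "X \<in> Obj (CT lo hi)" for X
      using coherent_value(1)[OF c that] coherent_value(1)[OF c' that] by simp
  qed
  then show ?thesis
    unfolding D using b nat by blast
qed

end
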